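(* Let $d,N,k\geq 1$ be integers and let $P$ be a germ of a $\mathbb{C}$-valued holomorphic function at $0\in\mathbb{C}^d$, $P\not\equiv 0$, with $P(0)=0$. For $j=1,\dots,k$ let $$L_j=\sum_{|\alpha|=j} a_\alpha^{(j)}(x)\,\partial_\alpha$$ be a differential operator with coefficients $a_\alpha^{(j)}$ holomorphic near $0\in\mathbb{C}^d$, and set $$L_j^\star(P)=\sum_{|\alpha|=j} a_\alpha^{(j)}(x)\,(\partial_{x_1}P)^{\alpha_1}\cdots(\partial_{x_d}P)^{\alpha_d}.$$ Let $F$ be a $\mathbb{C}^N$-valued holomorphic map defined near $(0,0)\in\mathbb{C}^d\times\mathbb{C}^N$, and consider the system of partial differential equations $$P(x)^kL_k(y)(x)+\cdots+P(x)L_1(y)(x)=F(x,y),\qquad x\in(\mathbb{C}^d,0),\quad y=(y_1,\dots,y_N).$$ Suppose that $F(0,0)=0$ and that the matrix $D_yF(0,0)$ is invertible. If $L_k\not\equiv 0$ and $P$ divides $L_j^\star(P)$ (in $\mathbb{C}\{x\}$) for every $j=1,\dots,k$, then the system admits a unique formal power series solution $\widehat{y}\in\mathbb{C}[[x]]^N$ with $\widehat{y}(0)=0$. Moreover, $\widehat{y}$ is a $P$-$k$-Gevrey series.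
   Context: Notation: $x=(x_1,\dots,x_d)$; for $\alpha\in\mathbb{N}^d$ (with $0\in\mathbb{N}$), $|\alpha|=\alpha_1+\cdots+\alpha_d$ and $\partial_\alpha=\partial^{|\alpha|}/\partial x_1^{\alpha_1}\cdots\partial x_d^{\alpha_d}$. The operators $L_j$ act on vectors componentwise. $\mathbb{C}[[x]]$ and $\mathbb{C}\{x\}$ denote formal and convergent power series in $x$, and $D_yF(0,0)\in\mathbb{C}^{N\times N}$ is the Jacobian matrix of $F$ with respect to $y$ at the origin. $P$-$s$-Gevrey series: for $s\geq 0$, a series $\hat f\in\mathbb{C}[[x]]$ is $P$-$s$-Gevrey if there are a polyradius $r\in\mathbb{R}_{>0}^d$, constants $C,A>0$ and a sequence $(f_n)_{n\in\mathbb{N}}$ of bounded holomorphic functions on the polydisc $D_r=\{x\in\mathbb{C}^d:|x_j|<r_j,\ j=1,\dots,d\}$ such that $\hat f=\sum_{n=0}^\infty f_nP^n$ (as formal power series in $x$, each $f_n$ and $P$ being identified with its Taylor series at $0$) and $\sup_{x\in D_r}|f_n(x)|\leq CA^n\,n!^s$ for all $n$. A vector $(\hat f_1,\dots,\hat f_N)\in\mathbb{C}[[x]]^N$ is $P$-$s$-Gevrey if every component is. *)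

theory Defs
  imports "HOL-Analysis.Analysis"
begin

section \<open>Multi-indices\<close>

text \<open>A multi-index over the finite index type \<^typ>\<open>'i\<close> is a function \<^typ>\<open>'i \<Rightarrow> nat\<close>;
  \<open>\<beta> \<le> \<gamma>\<close> is the pointwise order.\<close>

definition mdeg :: "('i::finite \<Rightarrow> nat) \<Rightarrow> nat" where
  "mdeg \<alpha> = (\<Sum>i\<in>UNIV. \<alpha> i)"

lemma finite_atMost_multi: "finite {..\<gamma> :: 'i::finite \<Rightarrow> nat}"
proof (rule finite_subset)
  show "{..\<gamma>} \<subseteq> (\<Pi>\<^sub>E i\<in>UNIV. {..\<gamma> i})"
    by (auto simp: le_fun_def PiE_def extensional_def)
  show "finite (\<Pi>\<^sub>E i\<in>UNIV. {..\<gamma> i})"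
    by (rule finite_PiE) auto
qed

lemma le_mdeg: "\<alpha> i \<le> mdeg \<alpha>"
  unfolding mdeg_def by (rule member_le_sum) auto

lemma finite_mdeg_le: "finite {\<alpha> :: 'i::finite \<Rightarrow> nat. mdeg \<alpha> \<le> n}"
proof (rule finite_subset)
  show "{\<alpha> :: 'i \<Rightarrow> nat. mdeg \<alpha> \<le> n} \<subseteq> {..(\<lambda>_. n)}"
    using le_mdeg order_trans by (auto simp: le_fun_def) blast
qed (rule finite_atMost_multi)

lemma finite_mdeg_eq: "finite {\<alpha> :: 'i::finite \<Rightarrow> nat. mdeg \<alpha> = n}"
  by (rule finite_subset[OF _ finite_mdeg_le[of n]]) auto


section \<open>Formal power series in finitely many variables\<close>

text \<open>The ring of formal power series over \<^typ>\<open>'a\<close> with one variable for each element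
  of \<^typ>\<open>'i\<close>.\<close>

typedef ('a, 'i) mfps = "UNIV :: (('i \<Rightarrow> nat) \<Rightarrow> 'a) set"
  morphisms mfps_coeff Abs_mfps
  by auto

lemma mfps_coeff_Abs [simp]: "mfps_coeff (Abs_mfps f) = f"
  by (rule Abs_mfps_inverse) simp

lemma mfps_eqI: "(\<And>\<alpha>. mfps_coeff f \<alpha> = mfps_coeff g \<alpha>) \<Longrightarrow> f = g"
  by (metis ext mfps_coeff_inverse)

instantiation mfps :: (comm_ring_1, finite) comm_ring_1
begin

definition zero_mfps :: "('a, 'b) mfps" where
  "zero_mfps = Abs_mfps (\<lambda>_. 0)"

definition one_mfps :: "('a, 'b) mfps" where
  "one_mfps = Abs_mfps (\<lambda>\<alpha>. if \<alpha> = (\<lambda>_. 0) then 1 else 0)"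

definition plus_mfps :: "('a, 'b) mfps \<Rightarrow> ('a, 'b) mfps \<Rightarrow> ('a, 'b) mfps" where
  "plus_mfps f g = Abs_mfps (\<lambda>\<alpha>. mfps_coeff f \<alpha> + mfps_coeff g \<alpha>)"

definition uminus_mfps :: "('a, 'b) mfps \<Rightarrow> ('a, 'b) mfps" where
  "uminus_mfps f = Abs_mfps (\<lambda>\<alpha>. - mfps_coeff f \<alpha>)"

definition minus_mfps :: "('a, 'b) mfps \<Rightarrow> ('a, 'b) mfps \<Rightarrow> ('a, 'b) mfps" where
  "minus_mfps f g = Abs_mfps (\<lambda>\<alpha>. mfps_coeff f \<alpha> - mfps_coeff g \<alpha>)"

definition times_mfps :: "('a, 'b) mfps \<Rightarrow> ('a, 'b) mfps \<Rightarrow> ('a, 'b) mfps" where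
  "times_mfps f g = Abs_mfps (\<lambda>\<gamma>. \<Sum>\<beta>\<in>{..\<gamma>}. mfps_coeff f \<beta> * mfps_coeff g (\<lambda>i. \<gamma> i - \<beta> i))"

instance
proof
  fix f g h :: "('a, 'b) mfps"
  show "f * g * h = f * (g * h)"
  proof (rule mfps_eqI)
    fix \<gamma> :: "'b \<Rightarrow> nat"
    let ?S = "SIGMA \<beta>:{..\<gamma>}. {..\<beta>}"
    let ?T = "SIGMA \<delta>:{..\<gamma>}. {..(\<lambda>i. \<gamma> i - \<delta> i)}"
    have "mfps_coeff (f * g * h) \<gamma>
        = (\<Sum>(\<beta>,\<delta>)\<in>?S. mfps_coeff f \<delta> * mfps_coeff g (\<lambda>i. \<beta> i - \<delta> i) * mfps_coeff h (\<lambda>i. \<gamma> i - \<beta> i))"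
      by (simp add: times_mfps_def sum_distrib_right sum.Sigma finite_atMost_multi)
    also have "\<dots> = (\<Sum>(\<delta>,\<epsilon>)\<in>?T. mfps_coeff f \<delta> * mfps_coeff g \<epsilon> * mfps_coeff h (\<lambda>i. \<gamma> i - \<delta> i - \<epsilon> i))"
    proof (rule sum.reindex_bij_witness[where i = "\<lambda>(\<delta>,\<epsilon>). (\<lambda>i. \<delta> i + \<epsilon> i, \<delta>)"
            and j = "\<lambda>(\<beta>,\<delta>). (\<delta>, \<lambda>i. \<beta> i - \<delta> i)"], goal_cases)
      case (1 p)
      then show ?case by (auto simp: le_fun_def)
    next
      case (2 p)
      then obtain \<beta> \<delta> where p: "p = (\<beta>, \<delta>)" "\<beta> \<le> \<gamma>" "\<delta> \<le> \<beta>" by auto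
      have "\<delta> \<le> \<gamma>"
        using p(3,2) by (rule order_trans)
      moreover have "(\<lambda>i. \<beta> i - \<delta> i) \<le> (\<lambda>i. \<gamma> i - \<delta> i)"
        using p(2) by (simp add: le_fun_def diff_le_mono)
      ultimately show ?case using p(1) by simp
    next
      case (3 p)
      then show ?case by auto
    next
      case (4 p)
      then show ?case by (auto simp: le_fun_def le_diff_conv2 add.commute)
    next
      case (5 p)
      then show ?case by (auto simp: le_fun_def)
    qed
    also have "\<dots> = mfps_coeff (f * (g * h)) \<gamma>"
      by (simp add: times_mfps_def sum_distrib_left sum.Sigma finite_atMost_multi mult.assoc)
    finally show "mfps_coeff (f * g * h) \<gamma> = mfps_coeff (f * (g * h)) \<gamma>" .
  qed
  show "f * g = g * f"
  proof (rule mfps_eqI)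
    fix \<gamma>
    show "mfps_coeff (f * g) \<gamma> = mfps_coeff (g * f) \<gamma>"
      unfolding times_mfps_def mfps_coeff_Abs
      by (rule sum.reindex_bij_witness[where i = "\<lambda>\<beta> i. \<gamma> i - \<beta> i" and j = "\<lambda>\<beta> i. \<gamma> i - \<beta> i"])
         (simp_all add: le_fun_def mult.commute)
  qed
  show "1 * f = f"
  proof (rule mfps_eqI)
    fix \<gamma>
    have "mfps_coeff (1 * f) \<gamma> = (\<Sum>\<beta>\<in>{..\<gamma>}. if \<beta> = (\<lambda>_. 0) then mfps_coeff f \<gamma> else 0)"
      unfolding times_mfps_def one_mfps_def mfps_coeff_Abs by (intro sum.cong) auto
    also have "\<dots> = mfps_coeff f \<gamma>"
      by (simp add: finite_atMost_multi le_fun_def)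
    finally show "mfps_coeff (1 * f) \<gamma> = mfps_coeff f \<gamma>" .
  qed
  show "(f + g) * h = f * h + g * h"
    by (rule mfps_eqI) (simp add: times_mfps_def plus_mfps_def distrib_right sum.distrib)
  show "(0 :: ('a, 'b) mfps) \<noteq> 1"
  proof
    assume "(0 :: ('a, 'b) mfps) = 1"
    then have "mfps_coeff (0 :: ('a, 'b) mfps) (\<lambda>_. 0) = mfps_coeff (1 :: ('a, 'b) mfps) (\<lambda>_. 0)"
      by simp
    then show False
      by (simp add: zero_mfps_def one_mfps_def)
  qed
qed (rule mfps_eqI, simp add: plus_mfps_def zero_mfps_def uminus_mfps_def minus_mfps_def add_ac)+

end

definition mfps_X :: "'i \<Rightarrow> ('a::comm_ring_1, 'i::finite) mfps" where
  "mfps_X i = Abs_mfps (\<lambda>\<alpha>. if \<alpha> = (\<lambda>j. if j = i then 1 else 0) then 1 else 0)"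

text \<open>\<open>\<partial>\<^sub>\<alpha>\<close> on formal series:
  \<open>\<partial>\<^sub>\<alpha> x\<^sup>\<beta>\<^sup>+\<^sup>\<alpha> = ((\<beta>+\<alpha>)! / \<beta>!) x\<^sup>\<beta>\<close>.\<close>

definition mfps_deriv :: "('i \<Rightarrow> nat) \<Rightarrow> ('a::field_char_0, 'i::finite) mfps \<Rightarrow> ('a, 'i) mfps" where
  "mfps_deriv \<alpha> f = Abs_mfps (\<lambda>\<beta>.
     (\<Prod>i\<in>UNIV. fact (\<beta> i + \<alpha> i) / fact (\<beta> i)) * mfps_coeff f (\<lambda>i. \<beta> i + \<alpha> i))"

lemma mfps_deriv_mfps_deriv:
  "mfps_deriv \<alpha> (mfps_deriv \<beta> f) = mfps_deriv (\<lambda>i. \<alpha> i + \<beta> i) f"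
  by (rule mfps_eqI) (simp add: mfps_deriv_def prod_dividef add.assoc)

lemma mfps_coeff_deriv_single:
  fixes f :: "('a::field_char_0, 'i::finite) mfps"
  shows "mfps_coeff (mfps_deriv (\<lambda>j. if j = i then 1 else 0) f) \<beta>
           = of_nat (Suc (\<beta> i)) * mfps_coeff f (\<beta>(i := Suc (\<beta> i)))"
proof -
  have "(\<Prod>j\<in>UNIV. fact (\<beta> j + (if j = i then 1 else 0)) / fact (\<beta> j))
          = (\<Prod>j\<in>UNIV. if j = i then of_nat (Suc (\<beta> i)) else (1::'a))"
    by (intro prod.cong) (auto simp del: of_nat_Suc)
  moreover have "(\<lambda>j. \<beta> j + (if j = i then 1 else 0)) = \<beta>(i := Suc (\<beta> i))"
    by (auto simp: fun_eq_iff)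
  ultimately show ?thesis
    by (simp add: mfps_deriv_def)
qed

text \<open>Substitution \<open>F(g)\<close> of series \<open>g\<^sub>i\<close> without constant term for the variables of \<open>F\<close>.
  The monomial \<open>g\<^sup>\<beta>\<close> has no terms of degree below \<open>|\<beta>|\<close>
  (lemma \<open>mfps_coeff_monomial_eq_0\<close> below), so only the finitely many \<open>\<beta>\<close> with
  \<open>|\<beta>| \<le> |\<gamma>|\<close> contribute to the coefficient at \<open>\<gamma>\<close>.\<close>

definition mfps_subst ::
  "('a::comm_ring_1, 'i::finite) mfps \<Rightarrow> ('i \<Rightarrow> ('a, 'j::finite) mfps) \<Rightarrow> ('a, 'j) mfps" where
  "mfps_subst F g = Abs_mfps (\<lambda>\<gamma>.
     \<Sum>\<beta> | mdeg \<beta> \<le> mdeg \<gamma>. mfps_coeff F \<beta> * mfps_coeff (\<Prod>i\<in>UNIV. g i ^ \<beta> i) \<gamma>)"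

lemma mfps_coeff_mult_low:
  fixes f g :: "('a::comm_ring_1, 'i::finite) mfps"
  assumes f: "\<And>\<alpha>. mdeg \<alpha> < m \<Longrightarrow> mfps_coeff f \<alpha> = 0"
    and g: "\<And>\<alpha>. mdeg \<alpha> < n \<Longrightarrow> mfps_coeff g \<alpha> = 0"
    and \<gamma>: "mdeg \<gamma> < m + n"
  shows "mfps_coeff (f * g) \<gamma> = 0"
proof -
  have "mfps_coeff f \<beta> * mfps_coeff g (\<lambda>i. \<gamma> i - \<beta> i) = 0" if "\<beta> \<le> \<gamma>" for \<beta>
  proof -
    have "mdeg \<beta> + mdeg (\<lambda>i. \<gamma> i - \<beta> i) = mdeg \<gamma>"
      using that by (simp add: mdeg_def le_fun_def flip: sum.distrib)
    with \<gamma> have "mdeg \<beta> < m \<or> mdeg (\<lambda>i. \<gamma> i - \<beta> i) < n" by linarith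
    then show ?thesis using f g by auto
  qed
  then show ?thesis by (simp add: times_mfps_def)
qed

lemma mfps_coeff_power_low:
  fixes f :: "('a::comm_ring_1, 'i::finite) mfps"
  assumes "mfps_coeff f (\<lambda>_. 0) = 0" and "mdeg \<gamma> < n"
  shows "mfps_coeff (f ^ n) \<gamma> = 0"
  using assms(2)
proof (induction n arbitrary: \<gamma>)
  case (Suc n)
  have "\<alpha> = (\<lambda>_. 0)" if "mdeg \<alpha> < 1" for \<alpha> :: "'i \<Rightarrow> nat"
    using that by (auto simp: mdeg_def)
  then show ?case
    using mfps_coeff_mult_low[of 1 f n "f ^ n" \<gamma>] Suc assms(1) by auto
qed simp

lemma mfps_coeff_monomial_eq_0:
  fixes g :: "'i::finite \<Rightarrow> ('a::comm_ring_1, 'j::finite) mfps"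
  assumes "\<And>i. mfps_coeff (g i) (\<lambda>_. 0) = 0" and "mdeg \<gamma> < mdeg \<beta>"
  shows "mfps_coeff (\<Prod>i\<in>UNIV. g i ^ \<beta> i) \<gamma> = 0"
proof -
  have "mfps_coeff (\<Prod>i\<in>I. g i ^ \<beta> i) \<gamma> = 0" if "finite I" "mdeg \<gamma> < (\<Sum>i\<in>I. \<beta> i)" for I \<gamma>
    using that
  proof (induction I arbitrary: \<gamma> rule: finite_induct)
    case (insert i I)
    have "mfps_coeff (g i ^ \<beta> i * (\<Prod>i\<in>I. g i ^ \<beta> i)) \<gamma> = 0"
      by (rule mfps_coeff_mult_low[of "\<beta> i" _ "\<Sum>i\<in>I. \<beta> i"])
         (use insert mfps_coeff_power_low[of "g i", OF assms(1)] in simp_all)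
    then show ?case using insert by simp
  qed simp
  from this[of UNIV \<gamma>] show ?thesis using assms(2) by (simp add: mdeg_def)
qed

text \<open>Convergence of \<open>\<Sum>\<^sub>n u\<^sub>n\<close> to \<open>f\<close> in the Krull topology: every coefficient of the partial
  sums is eventually equal to that of \<open>f\<close>.\<close>

definition mfps_sums :: "(nat \<Rightarrow> ('a::comm_ring_1, 'i::finite) mfps) \<Rightarrow> ('a, 'i) mfps \<Rightarrow> bool" where
  "mfps_sums u f \<longleftrightarrow>
     (\<forall>\<alpha>. \<forall>\<^sub>F m in sequentially. mfps_coeff (\<Sum>n<m. u n) \<alpha> = mfps_coeff f \<alpha>)"


section \<open>Holomorphic functions of several complex variables\<close>

definition mholomorphic_on :: "(complex ^ 'i \<Rightarrow> complex) \<Rightarrow> (complex ^ 'i) set \<Rightarrow> bool" where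
  "mholomorphic_on f U \<longleftrightarrow> open U \<and>
     (\<forall>x\<in>U. \<exists>D. (f has_derivative D) (at x) \<and> (\<forall>c v. D (c *s v) = c * D v))"

definition holomorphic_near_0 :: "(complex ^ 'i \<Rightarrow> complex) \<Rightarrow> bool" where
  "holomorphic_near_0 f \<longleftrightarrow> (\<exists>U. 0 \<in> U \<and> mholomorphic_on f U)"

definition zero_germ :: "(complex ^ 'i \<Rightarrow> complex) \<Rightarrow> bool" where
  "zero_germ f \<longleftrightarrow> (\<forall>\<^sub>F x in nhds 0. f x = 0)"

text \<open>Divisibility in \<open>\<complex>{x}\<close>, the ring of germs at 0 of holomorphic functions.\<close>

definition germ_dvd :: "(complex ^ 'i \<Rightarrow> complex) \<Rightarrow> (complex ^ 'i \<Rightarrow> complex) \<Rightarrow> bool" where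
  "germ_dvd f g \<longleftrightarrow> (\<exists>q. holomorphic_near_0 q \<and> (\<forall>\<^sub>F x in nhds 0. g x = f x * q x))"

definition cpartial :: "'i \<Rightarrow> (complex ^ 'i \<Rightarrow> complex) \<Rightarrow> complex ^ 'i \<Rightarrow> complex" where
  "cpartial i f x = deriv (\<lambda>z. f (x + axis i z)) 0"

text \<open>The order in which the partial derivatives are taken is irrelevant for holomorphic
  functions; we fix an arbitrary enumeration of the index type.\<close>

definition index_list :: "'i::finite list" where
  "index_list = (SOME is. distinct is \<and> set is = UNIV)"

lemma index_list: "distinct (index_list :: 'i::finite list)" "set (index_list :: 'i list) = UNIV"
proof -
  have "\<exists>is :: 'i list. distinct is \<and> set is = UNIV"
    using finite_distinct_list[of "UNIV :: 'i set"] by auto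
  from someI_ex[OF this] show "distinct (index_list :: 'i list)" "set (index_list :: 'i list) = UNIV"
    by (auto simp: index_list_def)
qed

definition cpartials ::
  "('i::finite \<Rightarrow> nat) \<Rightarrow> (complex ^ 'i \<Rightarrow> complex) \<Rightarrow> complex ^ 'i \<Rightarrow> complex" where
  "cpartials \<alpha> f = fold (\<lambda>i. cpartial i ^^ \<alpha> i) index_list f"

definition taylor :: "(complex ^ 'i::finite \<Rightarrow> complex) \<Rightarrow> (complex, 'i) mfps" where
  "taylor f = Abs_mfps (\<lambda>\<alpha>. cpartials \<alpha> f 0 / (\<Prod>i\<in>UNIV. fact (\<alpha> i)))"

definition polydisc :: "real ^ 'i \<Rightarrow> (complex ^ 'i) set" where
  "polydisc r = {x. \<forall>i. norm (x $ i) < r $ i}"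


section \<open>Gevrey series with respect to a germ\<close>

definition gevrey :: "(complex ^ 'i::finite \<Rightarrow> complex) \<Rightarrow> real \<Rightarrow> (complex, 'i) mfps \<Rightarrow> bool" where
  "gevrey P s f \<longleftrightarrow>
     (\<exists>(r :: real ^ 'i) (C :: real) (A :: real) (u :: nat \<Rightarrow> complex ^ 'i \<Rightarrow> complex).
        (\<forall>i. r $ i > 0) \<and> C > 0 \<and> A > 0 \<and>
        (\<forall>n. mholomorphic_on (u n) (polydisc r)) \<and>
        mfps_sums (\<lambda>n. taylor (u n) * taylor P ^ n) f \<and>
        (\<forall>n. \<forall>x\<in>polydisc r. norm (u n x) \<le> C * A ^ n * fact n powr s))"


section \<open>The system of partial differential equations\<close>

text \<open>A family \<open>a\<close> stores the coefficients of all the operators: \<open>a j \<alpha>\<close> is the coefficient of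
  \<open>\<partial>\<^sub>\<alpha>\<close> in \<open>L\<^sub>j\<close>, and is only used for \<open>|\<alpha>| = j\<close>.\<close>

definition L_op ::
  "(nat \<Rightarrow> ('d::finite \<Rightarrow> nat) \<Rightarrow> complex ^ 'd \<Rightarrow> complex) \<Rightarrow> nat \<Rightarrow> (complex, 'd) mfps \<Rightarrow> (complex, 'd) mfps"
  where "L_op a j f = (\<Sum>\<alpha> | mdeg \<alpha> = j. taylor (a j \<alpha>) * mfps_deriv \<alpha> f)"

definition L_star ::
  "(nat \<Rightarrow> ('d::finite \<Rightarrow> nat) \<Rightarrow> complex ^ 'd \<Rightarrow> complex) \<Rightarrow> nat \<Rightarrow>
   (complex ^ 'd \<Rightarrow> complex) \<Rightarrow> complex ^ 'd \<Rightarrow> complex"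
  where "L_star a j P x = (\<Sum>\<alpha> | mdeg \<alpha> = j. a j \<alpha> x * (\<Prod>i\<in>UNIV. cpartial i P x ^ \<alpha> i))"

text \<open>A function of \<open>(x, y) \<in> \<complex>\<^sup>d \<times> \<complex>\<^sup>N\<close> as a function on \<open>\<complex>\<^sup>d\<^sup>+\<^sup>N\<close>:
  the coordinates indexed by \<^const>\<open>Inl\<close> are those of \<open>x\<close>, the ones indexed by \<^const>\<open>Inr\<close>
  those of \<open>y\<close>.\<close>

definition joint ::
  "(complex ^ 'd \<Rightarrow> complex ^ 'n \<Rightarrow> complex) \<Rightarrow> complex ^ ('d::finite + 'n::finite) \<Rightarrow> complex"
  where "joint f z = f (\<chi> i. z $ Inl i) (\<chi> l. z $ Inr l)"

definition jacobian_y ::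
  "(complex ^ 'd \<Rightarrow> complex ^ 'n \<Rightarrow> complex ^ 'n) \<Rightarrow> complex ^ 'd \<Rightarrow> complex ^ 'n \<Rightarrow> complex ^ 'n ^ 'n"
  where "jacobian_y F x y = (\<chi> l m. cpartial m (\<lambda>y. F x y $ l) y)"

definition formal_solution ::
  "(complex ^ 'd::finite \<Rightarrow> complex) \<Rightarrow> nat \<Rightarrow> (nat \<Rightarrow> ('d \<Rightarrow> nat) \<Rightarrow> complex ^ 'd \<Rightarrow> complex) \<Rightarrow>
   (complex ^ 'd \<Rightarrow> complex ^ 'n \<Rightarrow> complex ^ 'n) \<Rightarrow> (complex, 'd) mfps ^ 'n::finite \<Rightarrow> bool"
  where "formal_solution P k a F y \<longleftrightarrow>
    (\<forall>l. (\<Sum>j=1..k. taylor P ^ j * L_op a j (y $ l))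
         = mfps_subst (taylor (joint (\<lambda>x y. F x y $ l))) (case_sum mfps_X (\<lambda>m. y $ m)))"

end

theory Submission
  imports Defs "HOL-Complex_Analysis.Cauchy_Integral_Formula"
begin

text \<open>
  The idea is to treat \<open>P\<close> as an additional variable \<open>t\<close>. On series in \<open>(x, t)\<close>, evaluation at
  \<open>t = P\<close> intertwines \<open>\<partial>\<^sub>i + (\<partial>\<^sub>i P) \<partial>\<^sub>t\<close> with \<open>\<partial>\<^sub>i\<close>, so \<open>P\<^sup>j L\<^sub>j\<close> lifts to \<open>t\<^sup>j\<close> times a differential
  operator whose leading part in \<open>\<partial>\<^sub>t\<close> is \<open>L\<^sub>j\<^sup>*(P) \<partial>\<^sub>t\<^sup>j = P q\<^sub>j \<partial>\<^sub>t\<^sup>j\<close>. Replacing the factor \<open>P\<close> by \<open>t\<close> does not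
  change the evaluation, and then every term of the lifted operator increases the degree in \<open>t\<close>
  by some \<open>l \<ge> 1\<close> while differentiating at most \<open>l\<close> times in \<open>x\<close>.

  Multiplying \<open>F\<close> by the inverse Jacobian brings the lifted system into the form
  \<open>Y = H(x, Y) + G(Y)\<close>, where \<open>H\<close> has no terms linear in \<open>Y\<close>. The right-hand side is contracting for
  the order in which \<open>x\<^sub>i\<close> has weight 1 and \<open>t\<close> has weight 2, which yields existence and uniqueness.
  It also preserves a ball of the submultiplicative norm
  \<open>\<Sum> |Y\<^sub>\<alpha>\<^sub>n| \<rho>\<^sup>p \<tau>\<^sup>n p! / ((p + n)! n!\<^sup>k\<^sup>-\<^sup>1)\<close> with \<open>p = |\<alpha>|\<close>, because \<open>G\<close> has norm \<open>O(\<tau>)\<close>. A series of finite norm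
  has coefficients of \<open>t\<^sup>n\<close> that are bounded on a fixed polydisc by \<open>C A\<^sup>n n!\<^sup>k\<close>.
\<close>

text \<open>The obstacle is that evaluation at \<open>t = P\<close> is not injective: multiples of
  \<open>t - P\<close> are lost, so a solution has many lifts. Existence and bounds come from one
  fixed point of the lifted map. Uniqueness is argued after evaluation: a solution \<open>y\<close>,
  viewed as a series free of \<open>t\<close>, need not be a fixed point of the lifted map, but all
  iterates of the map started there evaluate to \<open>y\<close>, and they approach the fixed point.

  The freedom in the lift is also what permits trading \<open>P\<close> for \<open>t\<close>. The
  operator \<open>t^j d_t^j\<close> keeps the degree in \<open>t\<close> and multiplies the
  coefficient of \<open>t^n\<close> by about \<open>n^j\<close>, so it is unbounded in the norm.
  With one more \<open>t\<close>, the step from \<open>n\<close> to \<open>n + 1\<close> in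
  \<open>(p + n)! n!^(k-1)\<close> supplies \<open>k\<close> factors of size at least
  \<open>n\<close>, enough for every \<open>j\<close> up to \<open>k\<close>; this is the origin of
  the Gevrey order. Derivatives in \<open>x\<close> are paid by the quotient
  \<open>(p + n)! / p!\<close>: differentiating lowers the degree in \<open>x\<close> and the
  accompanying power of \<open>t\<close> raises \<open>n\<close>, so the quotient grows by the
  factor that the derivative produces.\<close>

lemma mfps_coeff_0 [simp]: "mfps_coeff 0 \<alpha> = 0"
  by (simp add: zero_mfps_def)

lemma mfps_coeff_add [simp]: "mfps_coeff (f + g) \<alpha> = mfps_coeff f \<alpha> + mfps_coeff g \<alpha>"
  by (simp add: plus_mfps_def)

lemma mfps_coeff_diff [simp]: "mfps_coeff (f - g) \<alpha> = mfps_coeff f \<alpha> - mfps_coeff g \<alpha>"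
  by (simp add: minus_mfps_def)

lemma mfps_coeff_1: "mfps_coeff 1 \<alpha> = (if \<alpha> = (\<lambda>_. 0) then 1 else 0)"
  by (simp add: one_mfps_def)

lemma mfps_coeff_sum: "mfps_coeff (sum f S) \<alpha> = (\<Sum>x\<in>S. mfps_coeff (f x) \<alpha>)"
  by (induction S rule: infinite_finite_induct) auto

lemma mfps_coeff_mult:
  "mfps_coeff (f * g) \<gamma> = (\<Sum>\<beta>\<in>{..\<gamma>}. mfps_coeff f \<beta> * mfps_coeff g (\<lambda>i. \<gamma> i - \<beta> i))"
  by (simp add: times_mfps_def)

definition mfps_const :: "'a \<Rightarrow> ('a::comm_ring_1, 'i::finite) mfps" where
  "mfps_const c = Abs_mfps (\<lambda>\<alpha>. if \<alpha> = (\<lambda>_. 0) then c else 0)"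

lemma mfps_coeff_const_mult [simp]: "mfps_coeff (mfps_const c * f) \<gamma> = c * mfps_coeff f \<gamma>"
proof -
  have "mfps_coeff (mfps_const c * f) \<gamma> = (\<Sum>\<beta>\<in>{..\<gamma>}. if \<beta> = (\<lambda>_. 0) then c * mfps_coeff f \<gamma> else 0)"
    unfolding mfps_coeff_mult mfps_const_def mfps_coeff_Abs by (intro sum.cong) auto
  also have "\<dots> = c * mfps_coeff f \<gamma>"
    by (simp add: finite_atMost_multi le_fun_def)
  finally show ?thesis .
qed

lemma mfps_const_add: "mfps_const (c + d) = mfps_const c + mfps_const d"
  by (rule mfps_eqI) (simp add: mfps_const_def)

lemma mfps_const_0 [simp]: "mfps_const 0 = 0"
  by (rule mfps_eqI) (simp add: mfps_const_def)

lemma mfps_const_1 [simp]: "mfps_const 1 = 1"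
  by (rule mfps_eqI) (simp add: mfps_const_def mfps_coeff_1)

lemma mfps_const_mult: "mfps_const (c * d) = mfps_const c * mfps_const d"
  by (rule mfps_eqI) (simp, simp add: mfps_const_def)

lemma mfps_const_sum: "mfps_const (sum f S) = (\<Sum>x\<in>S. mfps_const (f x))"
  by (induction S rule: infinite_finite_induct) (auto simp: mfps_const_add)

lemma mfps_const_of_nat: "mfps_const (of_nat n) = of_nat n"
  by (induction n) (auto simp: mfps_const_add)

lemma mfps_coeff_of_nat_mult [simp]: "mfps_coeff (of_nat n * f) \<gamma> = of_nat n * mfps_coeff f \<gamma>"
  by (simp flip: mfps_const_of_nat)

abbreviation munit :: "'i \<Rightarrow> 'i \<Rightarrow> nat" where
  "munit i \<equiv> (\<lambda>j. if j = i then 1 else 0)"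

lemma mdeg_add: "mdeg (\<lambda>i. \<alpha> i + \<beta> i) = mdeg \<alpha> + mdeg \<beta>"
  by (simp add: mdeg_def sum.distrib)

lemma mdeg_eq_0_iff: "mdeg \<alpha> = 0 \<longleftrightarrow> \<alpha> = (\<lambda>_. 0)"
  by (auto simp: mdeg_def)

lemma mdeg_zero [simp]: "mdeg (\<lambda>_. 0) = 0"
  by (simp add: mdeg_def)

lemma mdeg_munit [simp]: "mdeg (munit i) = 1"
  by (simp add: mdeg_def)

lemma mdeg_upd_Suc: "mdeg (\<beta>(i := Suc (\<beta> i))) = Suc (mdeg \<beta>)"
proof -
  have "\<beta>(i := Suc (\<beta> i)) = (\<lambda>j. \<beta> j + munit i j)" by auto
  then show ?thesis by (simp only: mdeg_add mdeg_munit)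
qed

lemma mdeg_eq_Suc_0_iff: "mdeg \<alpha> = Suc 0 \<longleftrightarrow> (\<exists>i. \<alpha> = munit i)"
proof
  assume a: "mdeg \<alpha> = Suc 0"
  then obtain i where i: "\<alpha> i \<noteq> 0"
    by (metis Zero_not_Suc mdeg_eq_0_iff)
  define \<beta> where "\<beta> = \<alpha>(i := \<alpha> i - 1)"
  have "\<alpha> = \<beta>(i := Suc (\<beta> i))" using i by (auto simp: \<beta>_def)
  with a have "mdeg \<beta> = 0" by (metis mdeg_upd_Suc nat.inject)
  then have "\<beta> = (\<lambda>_. 0)" by (simp add: mdeg_eq_0_iff)
  with \<open>\<alpha> = \<beta>(i := Suc (\<beta> i))\<close> show "\<exists>i. \<alpha> = munit i" by (intro exI[of _ i]) auto
next
  show "\<exists>i. \<alpha> = munit i \<Longrightarrow> mdeg \<alpha> = Suc 0"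
    using mdeg_munit by force
qed

lemma mfps_coeff_const_0 [simp]: "mfps_coeff (mfps_const c) (\<lambda>_. 0) = c"
  by (simp add: mfps_const_def)

subsection \<open>Partial derivatives\<close>

abbreviation mfps_D :: "'i \<Rightarrow> ('a::field_char_0, 'i::finite) mfps \<Rightarrow> ('a, 'i) mfps" where
  "mfps_D i \<equiv> mfps_deriv (munit i)"

lemma mfps_deriv_add [simp]: "mfps_deriv \<alpha> (f + g) = mfps_deriv \<alpha> f + mfps_deriv \<alpha> g"
  by (rule mfps_eqI) (simp add: mfps_deriv_def distrib_left)

lemma mfps_deriv_diff [simp]: "mfps_deriv \<alpha> (f - g) = mfps_deriv \<alpha> f - mfps_deriv \<alpha> g"
  by (rule mfps_eqI) (simp add: mfps_deriv_def right_diff_distrib)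

lemma mfps_deriv_zero [simp]: "mfps_deriv \<alpha> 0 = 0"
  by (rule mfps_eqI) (simp add: mfps_deriv_def)

lemma mfps_deriv_0 [simp]: "mfps_deriv (\<lambda>_. 0) f = f"
  by (rule mfps_eqI) (simp add: mfps_deriv_def)

lemma mfps_D_const [simp]: "mfps_D i (mfps_const c) = 0"
  by (rule mfps_eqI) (auto simp: mfps_coeff_deriv_single mfps_const_def fun_eq_iff)

lemma mfps_D_X: "mfps_D i (mfps_X j) = (if i = j then 1 else 0)"
proof (rule mfps_eqI)
  fix \<beta> :: "'b \<Rightarrow> nat"
  have "\<beta>(i := Suc (\<beta> i)) = munit j \<longleftrightarrow> i = j \<and> \<beta> = (\<lambda>_. 0)"
    by (auto simp: fun_eq_iff)
  then show "mfps_coeff (mfps_D i (mfps_X j :: ('a, 'b) mfps)) \<beta> = mfps_coeff (if i = j then 1 else 0) \<beta>"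
    unfolding mfps_coeff_deriv_single by (auto simp: mfps_X_def mfps_coeff_1)
qed

lemma inj_upd_Suc: "inj_on (\<lambda>\<delta>. \<delta>(i := Suc (\<delta> i))) A"
proof (rule inj_onI)
  fix x y :: "'a \<Rightarrow> nat" assume "x(i := Suc (x i)) = y(i := Suc (y i))"
  then have "(x(i := Suc (x i))) j = (y(i := Suc (y i))) j" for j by simp
  then show "x = y" by (metis ext fun_upd_def nat.inject)
qed

lemma upd_Suc_le_iff:
  "\<delta>(i := Suc (\<delta> i)) \<le> \<beta>(i := Suc (\<beta> i)) \<longleftrightarrow> \<delta> \<le> (\<beta> :: 'i \<Rightarrow> nat)"
proof -
  have "(\<delta>(i := Suc (\<delta> i))) j \<le> (\<beta>(i := Suc (\<beta> i))) j \<longleftrightarrow> \<delta> j \<le> \<beta> j" for j by simp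
  then show ?thesis unfolding le_fun_def by blast
qed

text \<open>The index shift behind the product rule, the chain rule and termwise differentiation.
  Indices that are not shifts have \<open>\<beta> i = 0\<close>, and the factor
  \<open>of_nat (\<beta> i)\<close> removes them.\<close>

lemma sum_upd_Suc:
  fixes h :: "('i \<Rightarrow> nat) \<Rightarrow> 'a::comm_semiring_1"
  assumes B: "finite B" and BA: "\<And>\<delta>. \<delta>(i := Suc (\<delta> i)) \<in> B \<longleftrightarrow> \<delta> \<in> A"
  shows "(\<Sum>\<beta>\<in>B. of_nat (\<beta> i) * h \<beta>) = (\<Sum>\<delta>\<in>A. of_nat (Suc (\<delta> i)) * h (\<delta>(i := Suc (\<delta> i))))"
proof -
  let ?S = "\<lambda>\<delta>. \<delta>(i := Suc (\<delta> i))"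
  have "(\<Sum>\<beta>\<in>B. of_nat (\<beta> i) * h \<beta>) = (\<Sum>\<beta>\<in>?S ` A. of_nat (\<beta> i) * h \<beta>)"
  proof (rule sum.mono_neutral_right[OF B])
    show "?S ` A \<subseteq> B" using BA by blast
    show "\<forall>\<beta>\<in>B - ?S ` A. of_nat (\<beta> i) * h \<beta> = 0"
    proof
      fix \<beta> assume b: "\<beta> \<in> B - ?S ` A"
      have "\<beta> i = 0"
      proof (rule ccontr)
        assume "\<beta> i \<noteq> 0"
        then have e: "\<beta> = ?S (\<beta>(i := \<beta> i - 1))" by auto
        with b BA[of "\<beta>(i := \<beta> i - 1)"] have "\<beta>(i := \<beta> i - 1) \<in> A" by simp
        with e b show False by blast
      qed
      then show "of_nat (\<beta> i) * h \<beta> = 0" by simp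
    qed
  qed
  then show ?thesis unfolding sum.reindex[OF inj_upd_Suc] by (simp only: o_def fun_upd_same)
qed

text \<open>The factor \<open>Suc (\<beta> i)\<close> produced by differentiating is shared between
  the two exponents in each term of the Cauchy product, and each share differentiates one factor. At
  the boundary \<open>\<delta> i = Suc (\<beta> i)\<close> the share of \<open>g\<close> is
  zero.\<close>

lemma mfps_D_mult:
  fixes f g :: "('a::field_char_0, 'i::finite) mfps"
  shows "mfps_D i (f * g) = mfps_D i f * g + f * mfps_D i g"
proof (rule mfps_eqI)
  fix \<beta> :: "'i \<Rightarrow> nat"
  let ?b = "\<beta>(i := Suc (\<beta> i))"
  let ?F = "mfps_coeff f" and ?G = "mfps_coeff g"
  have "mfps_coeff (mfps_D i (f * g)) \<beta>
      = (\<Sum>\<delta>\<in>{..?b}. of_nat (Suc (\<beta> i)) * (?F \<delta> * ?G (\<lambda>j. ?b j - \<delta> j)))"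
    unfolding mfps_coeff_deriv_single mfps_coeff_mult sum_distrib_left ..
  also have "\<dots> = (\<Sum>\<delta>\<in>{..?b}. of_nat (\<delta> i) * (?F \<delta> * ?G (\<lambda>j. ?b j - \<delta> j))
      + of_nat (Suc (\<beta> i) - \<delta> i) * (?F \<delta> * ?G (\<lambda>j. ?b j - \<delta> j)))"
  proof (rule sum.cong[OF refl])
    fix \<delta> assume "\<delta> \<in> {..?b}"
    then have "\<delta> i \<le> Suc (\<beta> i)" using le_funD[of \<delta> ?b i] by simp
    then have "of_nat (Suc (\<beta> i)) = (of_nat (\<delta> i) + of_nat (Suc (\<beta> i) - \<delta> i) :: 'a)"
      by (metis le_add_diff_inverse of_nat_add)
    then show "of_nat (Suc (\<beta> i)) * (?F \<delta> * ?G (\<lambda>j. ?b j - \<delta> j))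
       = of_nat (\<delta> i) * (?F \<delta> * ?G (\<lambda>j. ?b j - \<delta> j))
      + of_nat (Suc (\<beta> i) - \<delta> i) * (?F \<delta> * ?G (\<lambda>j. ?b j - \<delta> j))"
      by (simp only: distrib_right)
  qed
  also have "\<dots> = (\<Sum>\<delta>\<in>{..?b}. of_nat (\<delta> i) * (?F \<delta> * ?G (\<lambda>j. ?b j - \<delta> j)))
      + (\<Sum>\<delta>\<in>{..?b}. of_nat (Suc (\<beta> i) - \<delta> i) * (?F \<delta> * ?G (\<lambda>j. ?b j - \<delta> j)))"
    by (rule sum.distrib)
  also have "(\<Sum>\<delta>\<in>{..?b}. of_nat (\<delta> i) * (?F \<delta> * ?G (\<lambda>j. ?b j - \<delta> j)))
      = (\<Sum>\<delta>\<in>{..\<beta>}. of_nat (Suc (\<delta> i)) * (?F (\<delta>(i := Suc (\<delta> i))) * ?G (\<lambda>j. \<beta> j - \<delta> j)))"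
  proof -
    have "(\<lambda>j. ?b j - (\<delta>(i := Suc (\<delta> i))) j) = (\<lambda>j. \<beta> j - \<delta> j)" for \<delta> by auto
    then show ?thesis
      by (subst sum_upd_Suc[where A = "{..\<beta>}"]) (simp_all only: atMost_iff upd_Suc_le_iff finite_atMost_multi)
  qed
  also have "\<dots> = mfps_coeff (mfps_D i f * g) \<beta>"
    unfolding mfps_coeff_deriv_single mfps_coeff_mult by (simp only: mult.assoc)
  also have "(\<Sum>\<delta>\<in>{..?b}. of_nat (Suc (\<beta> i) - \<delta> i) * (?F \<delta> * ?G (\<lambda>j. ?b j - \<delta> j)))
      = (\<Sum>\<delta>\<in>{..\<beta>}. of_nat (Suc (\<beta> i) - \<delta> i) * (?F \<delta> * ?G (\<lambda>j. ?b j - \<delta> j)))"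
  proof (rule sum.mono_neutral_right)
    show "{..\<beta>} \<subseteq> {..?b}" by (simp add: le_fun_def)
    show "\<forall>\<delta>\<in>{..?b} - {..\<beta>}. of_nat (Suc (\<beta> i) - \<delta> i) * (?F \<delta> * ?G (\<lambda>j. ?b j - \<delta> j)) = 0"
    proof
      fix \<delta> assume d: "\<delta> \<in> {..?b} - {..\<beta>}"
      then obtain j where "\<not> \<delta> j \<le> \<beta> j" by (auto simp only: Diff_iff atMost_iff le_fun_def)
      moreover have "\<delta> j \<le> ?b j" using d by (auto simp only: Diff_iff atMost_iff le_fun_def)
      ultimately have "j = i" "\<delta> i = Suc (\<beta> i)" by (auto split: if_splits)
      then show "of_nat (Suc (\<beta> i) - \<delta> i) * (?F \<delta> * ?G (\<lambda>j. ?b j - \<delta> j)) = 0" by simp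
    qed
  qed (simp add: finite_atMost_multi)
  also have "\<dots> = mfps_coeff (f * mfps_D i g) \<beta>"
    unfolding mfps_coeff_deriv_single mfps_coeff_mult
  proof (rule sum.cong[OF refl])
    fix \<delta> assume "\<delta> \<in> {..\<beta>}"
    then have le: "\<delta> i \<le> \<beta> i" using le_funD by auto
    then have "(\<lambda>j. ?b j - \<delta> j) = (\<lambda>j. \<beta> j - \<delta> j)(i := Suc (\<beta> i - \<delta> i))" by (auto simp: Suc_diff_le)
    with le show "of_nat (Suc (\<beta> i) - \<delta> i) * (?F \<delta> * ?G (\<lambda>j. ?b j - \<delta> j))
      = ?F \<delta> * (of_nat (Suc (\<beta> i - \<delta> i)) * ?G ((\<lambda>j. \<beta> j - \<delta> j)(i := Suc (\<beta> i - \<delta> i))))"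
      by (simp only: Suc_diff_le mult.left_commute)
  qed
  finally show "mfps_coeff (mfps_D i (f * g)) \<beta> = mfps_coeff (mfps_D i f * g + f * mfps_D i g) \<beta>"
    by simp
qed

lemma mfps_D_1 [simp]: "mfps_D i 1 = 0"
  using mfps_D_const[of i 1] by simp

lemma mfps_D_power: "mfps_D i (f ^ n) = of_nat n * f ^ (n - 1) * mfps_D i f"
proof (induction n)
  case (Suc n)
  then show ?case by (cases n) (simp_all add: mfps_D_mult algebra_simps)
qed simp

lemma mfps_D_prod:
  fixes g :: "'m \<Rightarrow> ('a::field_char_0, 'i::finite) mfps"
  assumes "finite S"
  shows "mfps_D i (prod g S) = (\<Sum>m\<in>S. prod g (S - {m}) * mfps_D i (g m))"
  using assms
proof (induction S rule: finite_induct)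
  case (insert x S)
  have "(\<Sum>m\<in>S. prod g (insert x S - {m}) * mfps_D i (g m)) = g x * (\<Sum>m\<in>S. prod g (S - {m}) * mfps_D i (g m))"
    unfolding sum_distrib_left
  proof (rule sum.cong[OF refl])
    fix m assume "m \<in> S"
    with insert(2) have e: "insert x S - {m} = insert x (S - {m})" "x \<notin> S - {m}" by auto
    show "prod g (insert x S - {m}) * mfps_D i (g m) = g x * (prod g (S - {m}) * mfps_D i (g m))"
      unfolding e(1) using insert(1) by (subst prod.insert[OF _ e(2)]) (auto simp: mult.assoc)
  qed
  moreover have "insert x S - {x} = S" using insert(2) by auto
  ultimately show ?case unfolding sum.insert[OF insert(1,2)] prod.insert[OF insert(1,2)] mfps_D_mult insert(3)
    by (simp only: mult.commute)
qed simp

subsection \<open>Substitution\<close>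

definition mfps_mono :: "('i::finite \<Rightarrow> ('a::comm_ring_1, 'j::finite) mfps) \<Rightarrow> ('i \<Rightarrow> nat) \<Rightarrow> ('a, 'j) mfps" where
  "mfps_mono g \<beta> = (\<Prod>i\<in>UNIV. g i ^ \<beta> i)"

lemma mfps_mono_0 [simp]: "mfps_mono g (\<lambda>_. 0) = 1"
  by (simp add: mfps_mono_def)

lemma mfps_mono_add: "mfps_mono g (\<lambda>i. \<alpha> i + \<beta> i) = mfps_mono g \<alpha> * mfps_mono g \<beta>"
  by (simp add: mfps_mono_def power_add prod.distrib)

lemma mfps_mono_munit [simp]: "mfps_mono g (munit i) = g i"
proof -
  have "mfps_mono g (munit i) = (\<Prod>j\<in>UNIV. if j = i then g i else 1)"
    unfolding mfps_mono_def by (intro prod.cong) auto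
  then show ?thesis by simp
qed

lemma mfps_mono_upd_Suc: "mfps_mono g (\<beta>(i := Suc (\<beta> i))) = mfps_mono g \<beta> * g i"
proof -
  have "\<beta>(i := Suc (\<beta> i)) = (\<lambda>j. \<beta> j + munit i j)" by auto
  then show ?thesis by (simp only: mfps_mono_add mfps_mono_munit)
qed

text \<open>\<open>mfps_subst\<close> cuts its sum at degree \<open>mdeg \<gamma>\<close> for every
  \<open>g\<close>; this condition guarantees that the discarded terms are zero, so that the result
  is a genuine substitution.\<close>

definition mfps_vanish :: "('i \<Rightarrow> ('a::comm_ring_1, 'j::finite) mfps) \<Rightarrow> bool" where
  "mfps_vanish g \<longleftrightarrow> (\<forall>i. mfps_coeff (g i) (\<lambda>_. 0) = 0)"

lemma mfps_coeff_mono_eq_0: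
  "mfps_vanish g \<Longrightarrow> mdeg \<gamma> < mdeg \<beta> \<Longrightarrow> mfps_coeff (mfps_mono g \<beta>) \<gamma> = 0"
  unfolding mfps_mono_def mfps_vanish_def by (rule mfps_coeff_monomial_eq_0) auto

text \<open>The extra multi-indices contribute zero. A freely chosen bound \<open>N\<close> lets the
  sums for different coefficients run over one common index set.\<close>

lemma mfps_coeff_subst:
  assumes "mfps_vanish g" "mdeg \<gamma> \<le> N"
  shows "mfps_coeff (mfps_subst F g) \<gamma> = (\<Sum>\<beta> | mdeg \<beta> \<le> N. mfps_coeff F \<beta> * mfps_coeff (mfps_mono g \<beta>) \<gamma>)"
  unfolding mfps_subst_def mfps_coeff_Abs mfps_mono_def[symmetric]
proof (rule sum.mono_neutral_left)
  show "\<forall>\<beta>\<in>{\<beta>. mdeg \<beta> \<le> N} - {\<beta>. mdeg \<beta> \<le> mdeg \<gamma>}. mfps_coeff F \<beta> * mfps_coeff (mfps_mono g \<beta>) \<gamma> = 0"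
    using mfps_coeff_mono_eq_0[OF assms(1)] by auto
qed (use assms in \<open>auto simp: finite_mdeg_le\<close>)

lemma mdeg_mono: "\<beta> \<le> \<gamma> \<Longrightarrow> mdeg \<beta> \<le> mdeg \<gamma>"
  unfolding mdeg_def le_fun_def by (rule sum_mono) auto

lemma mfps_coeff_subst_mult:
  assumes "mfps_vanish g" "mdeg \<gamma> \<le> N"
  shows "mfps_coeff (mfps_subst F g * h) \<gamma> = (\<Sum>\<beta> | mdeg \<beta> \<le> N. mfps_coeff F \<beta> * mfps_coeff (mfps_mono g \<beta> * h) \<gamma>)"
proof -
  have "mfps_coeff (mfps_subst F g * h) \<gamma> = (\<Sum>\<delta>\<in>{..\<gamma>}. (\<Sum>\<beta> | mdeg \<beta> \<le> N. mfps_coeff F \<beta> * mfps_coeff (mfps_mono g \<beta>) \<delta>)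
     * mfps_coeff h (\<lambda>i. \<gamma> i - \<delta> i))"
    unfolding mfps_coeff_mult
  proof (rule sum.cong[OF refl])
    fix \<delta> assume "\<delta> \<in> {..\<gamma>}"
    then have "mdeg \<delta> \<le> N" using mdeg_mono assms(2) by (meson atMost_iff le_trans)
    from mfps_coeff_subst[OF assms(1) this]
    show "mfps_coeff (mfps_subst F g) \<delta> * mfps_coeff h (\<lambda>i. \<gamma> i - \<delta> i) =
         (\<Sum>\<beta> | mdeg \<beta> \<le> N. mfps_coeff F \<beta> * mfps_coeff (mfps_mono g \<beta>) \<delta>) * mfps_coeff h (\<lambda>i. \<gamma> i - \<delta> i)"
      by simp
  qed
  also have "\<dots> = (\<Sum>\<beta> | mdeg \<beta> \<le> N. mfps_coeff F \<beta> * mfps_coeff (mfps_mono g \<beta> * h) \<gamma>)"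
    unfolding mfps_coeff_mult sum_distrib_left sum_distrib_right
    by (subst sum.swap) (simp only: mult.assoc)
  finally show ?thesis .
qed

lemma mfps_subst_add [simp]: "mfps_subst (f + h) g = mfps_subst f g + mfps_subst h g"
  by (rule mfps_eqI) (simp add: mfps_subst_def distrib_right sum.distrib)

lemma mfps_subst_diff [simp]: "mfps_subst (f - h) g = mfps_subst f g - mfps_subst h g"
  by (rule mfps_eqI) (simp add: mfps_subst_def left_diff_distrib sum_subtractf)

lemma mfps_subst_0 [simp]: "mfps_subst 0 g = 0"
  by (rule mfps_eqI) (simp add: mfps_subst_def)

lemma mfps_subst_sum: "mfps_subst (sum f S) g = (\<Sum>x\<in>S. mfps_subst (f x) g)"
  by (induction S rule: infinite_finite_induct) auto

lemma mfps_subst_const [simp]: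
  fixes g :: "'i::finite \<Rightarrow> ('a::comm_ring_1, 'j::finite) mfps"
  shows "mfps_subst (mfps_const c) g = mfps_const c"
proof (rule mfps_eqI)
  fix \<gamma>
  have "mfps_coeff (mfps_subst (mfps_const c) g) \<gamma>
     = (\<Sum>\<beta> :: 'i \<Rightarrow> nat | mdeg \<beta> \<le> mdeg \<gamma>. if \<beta> = (\<lambda>_. 0) then c * mfps_coeff 1 \<gamma> else 0)"
    unfolding mfps_subst_def mfps_coeff_Abs
    by (intro sum.cong refl) (auto simp: mfps_const_def)
  also have "\<dots> = mfps_coeff (mfps_const c) \<gamma>"
    by (simp add: finite_mdeg_le mfps_coeff_1 mfps_const_def)
  finally show "mfps_coeff (mfps_subst (mfps_const c) g) \<gamma> = mfps_coeff (mfps_const c) \<gamma>" .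
qed

lemma mfps_subst_1 [simp]: "mfps_subst 1 g = 1"
  using mfps_subst_const[of 1 g] by simp

lemma mfps_subst_X:
  assumes "mfps_vanish g" shows "mfps_subst (mfps_X i) g = g i"
proof (rule mfps_eqI)
  fix \<gamma>
  have "mfps_coeff (mfps_subst (mfps_X i) g) \<gamma>
     = (\<Sum>\<beta> | mdeg \<beta> \<le> mdeg \<gamma> + 1. mfps_coeff (mfps_X i) \<beta> * mfps_coeff (mfps_mono g \<beta>) \<gamma>)"
    by (rule mfps_coeff_subst[OF assms]) simp
  also have "\<dots> = (\<Sum>\<beta> | mdeg \<beta> \<le> mdeg \<gamma> + 1. if \<beta> = munit i then mfps_coeff (g i) \<gamma> else 0)"
  proof (intro sum.cong refl)
    fix \<beta> :: "'a \<Rightarrow> nat"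
    show "mfps_coeff (mfps_X i) \<beta> * mfps_coeff (mfps_mono g \<beta>) \<gamma> = (if \<beta> = munit i then mfps_coeff (g i) \<gamma> else 0)"
      by (cases "\<beta> = munit i") (simp_all only: mfps_X_def mfps_coeff_Abs if_True if_False mfps_mono_munit, simp_all)
  qed
  also have "\<dots> = mfps_coeff (g i) \<gamma>"
    by (subst sum.delta[OF finite_mdeg_le]) (simp add: mdeg_def)
  finally show "mfps_coeff (mfps_subst (mfps_X i) g) \<gamma> = mfps_coeff (g i) \<gamma>" .
qed

lemma mfps_subst_mult:
  fixes f h :: "('a::comm_ring_1, 'i::finite) mfps" and g :: "'i \<Rightarrow> ('a, 'j::finite) mfps"
  assumes g: "mfps_vanish g"
  shows "mfps_subst (f * h) g = mfps_subst f g * mfps_subst h g"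
proof (rule mfps_eqI)
  fix \<gamma>
  let ?N = "mdeg (\<gamma> :: 'j \<Rightarrow> nat)"
  let ?M = "\<lambda>\<beta>. mfps_mono g \<beta>"
  let ?A = "{\<beta> :: 'i \<Rightarrow> nat. mdeg \<beta> \<le> ?N}"
  have "mfps_coeff (mfps_subst f g * mfps_subst h g) \<gamma>
     = (\<Sum>\<beta>\<in>?A. mfps_coeff f \<beta> * mfps_coeff (mfps_subst h g * ?M \<beta>) \<gamma>)"
    by (subst mfps_coeff_subst_mult[OF g order_refl]) (simp only: mult.commute)
  also have "\<dots> = (\<Sum>\<beta>\<in>?A. mfps_coeff f \<beta> * (\<Sum>\<beta>'\<in>?A. mfps_coeff h \<beta>' * mfps_coeff (?M \<beta>' * ?M \<beta>) \<gamma>))"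
    unfolding mfps_coeff_subst_mult[OF g order_refl] ..
  also have "\<dots> = (\<Sum>(\<beta>,\<beta>')\<in>?A \<times> ?A. mfps_coeff f \<beta> * mfps_coeff h \<beta>' * mfps_coeff (?M (\<lambda>i. \<beta> i + \<beta>' i)) \<gamma>)"
    by (simp add: sum_distrib_left sum.cartesian_product mfps_mono_add ac_simps)
  \<comment> \<open>Pairs of total degree above \<open>?N\<close> give monomials that vanish at
    \<open>\<gamma>\<close>. Only this smaller set can be regrouped by the sum of the two
    multi-indices.\<close>
  also have "\<dots> = (\<Sum>(\<beta>,\<beta>')\<in>{(\<beta>,\<beta>'). mdeg \<beta> + mdeg \<beta>' \<le> ?N}. mfps_coeff f \<beta> * mfps_coeff h \<beta>' * mfps_coeff (?M (\<lambda>i. \<beta> i + \<beta>' i)) \<gamma>)"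
  proof (rule sum.mono_neutral_right)
    show "\<forall>x\<in>?A \<times> ?A - {(\<beta>,\<beta>'). mdeg \<beta> + mdeg \<beta>' \<le> ?N}.
        (case x of (\<beta>,\<beta>') \<Rightarrow> mfps_coeff f \<beta> * mfps_coeff h \<beta>' * mfps_coeff (?M (\<lambda>i. \<beta> i + \<beta>' i)) \<gamma>) = 0"
    proof
      fix x assume x: "x \<in> ?A \<times> ?A - {(\<beta>,\<beta>'). mdeg \<beta> + mdeg \<beta>' \<le> ?N}"
      obtain \<beta> \<beta>' where [simp]: "x = (\<beta>, \<beta>')" by (cases x)
      have "?N < mdeg (\<lambda>i. \<beta> i + \<beta>' i)" using x by (simp add: mdeg_add)
      from mfps_coeff_mono_eq_0[OF g this]
      show "(case x of (\<beta>,\<beta>') \<Rightarrow> mfps_coeff f \<beta> * mfps_coeff h \<beta>' * mfps_coeff (?M (\<lambda>i. \<beta> i + \<beta>' i)) \<gamma>) = 0"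
        by simp
    qed
  qed (auto simp: finite_mdeg_le)
  also have "\<dots> = (\<Sum>(\<kappa>,\<beta>)\<in>(SIGMA \<kappa>:?A. {..\<kappa>}). mfps_coeff f \<beta> * mfps_coeff h (\<lambda>i. \<kappa> i - \<beta> i) * mfps_coeff (?M \<kappa>) \<gamma>)"
  proof (rule sum.reindex_bij_witness[where i = "\<lambda>(\<kappa>,\<beta>). (\<beta>, \<lambda>i. \<kappa> i - \<beta> i)" and j = "\<lambda>(\<beta>,\<beta>'). (\<lambda>i. \<beta> i + \<beta>' i, \<beta>)"], goal_cases)
    case (4 p)
    then obtain \<kappa> \<beta> where p: "p = (\<kappa>, \<beta>)" "mdeg \<kappa> \<le> ?N" "\<beta> \<le> \<kappa>" by auto
    have "(\<lambda>i. \<beta> i + (\<kappa> i - \<beta> i)) = \<kappa>" using le_funD[OF p(3)] by simp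
    with p(2) have "mdeg \<beta> + mdeg (\<lambda>i. \<kappa> i - \<beta> i) \<le> ?N" unfolding mdeg_add[symmetric] by simp
    with p(1) show ?case by simp
  next
    case (3 p)
    then show ?case using le_funD by (cases p) fastforce
  qed (auto simp: le_fun_def mdeg_add)
  also have "\<dots> = mfps_coeff (mfps_subst (f * h) g) \<gamma>"
    unfolding mfps_coeff_subst[OF g order_refl] mfps_coeff_mult
    by (simp add: sum_distrib_right sum.Sigma finite_mdeg_le finite_atMost_multi)
  finally show "mfps_coeff (mfps_subst (f * h) g) \<gamma> = mfps_coeff (mfps_subst f g * mfps_subst h g) \<gamma>" ..
qed

lemma mfps_subst_power: "mfps_vanish g \<Longrightarrow> mfps_subst (f ^ n) g = mfps_subst f g ^ n"
  by (induction n) (auto simp: mfps_subst_mult)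

lemma mfps_subst_prod:
  "mfps_vanish g \<Longrightarrow> mfps_subst (prod f S) g = (\<Prod>x\<in>S. mfps_subst (f x) g)"
  by (induction S rule: infinite_finite_induct) (auto simp: mfps_subst_mult)

lemma mfps_subst_mono:
  "mfps_vanish g \<Longrightarrow> mfps_subst (mfps_mono G \<kappa>) g = mfps_mono (\<lambda>i. mfps_subst (G i) g) \<kappa>"
  by (simp add: mfps_mono_def mfps_subst_prod mfps_subst_power)

lemma mfps_coeff_0_subst [simp]:
  fixes F :: "('a::comm_ring_1, 'i::finite) mfps"
  shows "mfps_coeff (mfps_subst F g) (\<lambda>_. 0) = mfps_coeff F (\<lambda>_. 0)"
proof -
  have "{\<beta> :: 'i \<Rightarrow> nat. mdeg \<beta> = 0} = {\<lambda>_. 0}" by (auto simp: mdeg_eq_0_iff)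
  then show ?thesis unfolding mfps_subst_def mfps_coeff_Abs mdeg_zero le_zero_eq
    by (simp add: mfps_coeff_1)
qed

text \<open>Both substitutions can be cut at the degree of the requested coefficient, so
  associativity becomes an exchange of two finite sums.\<close>

lemma mfps_subst_subst:
  fixes F :: "('a::comm_ring_1, 'i::finite) mfps" and G :: "'i \<Rightarrow> ('a, 'j::finite) mfps"
    and g :: "'j \<Rightarrow> ('a, 'k::finite) mfps"
  assumes G: "mfps_vanish G" and g: "mfps_vanish g"
  shows "mfps_subst (mfps_subst F G) g = mfps_subst F (\<lambda>i. mfps_subst (G i) g)"
proof (rule mfps_eqI)
  fix \<gamma>
  let ?A = "{\<beta> :: 'j \<Rightarrow> nat. mdeg \<beta> \<le> mdeg (\<gamma> :: 'k \<Rightarrow> nat)}"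
  have Gg: "mfps_vanish (\<lambda>i. mfps_subst (G i) g)" using G by (simp add: mfps_vanish_def)
  have "mfps_coeff (mfps_subst (mfps_subst F G) g) \<gamma>
     = (\<Sum>\<beta>\<in>?A. (\<Sum>\<kappa>\<in>{\<beta>. mdeg \<beta> \<le> mdeg \<gamma>}. mfps_coeff F \<kappa> * mfps_coeff (mfps_mono G \<kappa>) \<beta>) * mfps_coeff (mfps_mono g \<beta>) \<gamma>)"
    unfolding mfps_coeff_subst[OF g order_refl]
    by (intro sum.cong refl) (subst mfps_coeff_subst[OF G, where N = "mdeg \<gamma>"], auto)
  also have "\<dots> = (\<Sum>\<kappa>\<in>{\<beta>. mdeg \<beta> \<le> mdeg \<gamma>}. mfps_coeff F \<kappa> * mfps_coeff (mfps_subst (mfps_mono G \<kappa>) g) \<gamma>)"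
    unfolding mfps_coeff_subst[OF g order_refl] sum_distrib_left sum_distrib_right
    by (subst sum.swap) (simp only: mult.assoc)
  also have "\<dots> = mfps_coeff (mfps_subst F (\<lambda>i. mfps_subst (G i) g)) \<gamma>"
    unfolding mfps_coeff_subst[OF Gg order_refl] mfps_subst_mono[OF g] ..
  finally show "mfps_coeff (mfps_subst (mfps_subst F G) g) \<gamma> = mfps_coeff (mfps_subst F (\<lambda>i. mfps_subst (G i) g)) \<gamma>" .
qed

section \<open>Multiplication by monomials and the identity substitution\<close>

lemma mfps_coeff_X_mult:
  "mfps_coeff (mfps_X i * f) \<gamma> = (if \<gamma> i = 0 then 0 else mfps_coeff f (\<gamma>(i := \<gamma> i - 1)))"
proof -
  have "mfps_coeff (mfps_X i * f) \<gamma> = (\<Sum>\<beta>\<in>{..\<gamma>}. if \<beta> = munit i then mfps_coeff f (\<gamma>(i := \<gamma> i - 1)) else 0)"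
    unfolding mfps_coeff_mult
  proof (intro sum.cong refl)
    fix \<beta> :: "'b \<Rightarrow> nat"
    have "(\<lambda>j. \<gamma> j - munit i j) = \<gamma>(i := \<gamma> i - 1)" by auto
    then show "mfps_coeff (mfps_X i) \<beta> * mfps_coeff f (\<lambda>j. \<gamma> j - \<beta> j) = (if \<beta> = munit i then mfps_coeff f (\<gamma>(i := \<gamma> i - 1)) else 0)"
      by (cases "\<beta> = munit i") (simp_all only: mfps_X_def mfps_coeff_Abs if_True if_False, simp_all)
  qed
  also have "\<dots> = (if munit i \<in> {..\<gamma>} then mfps_coeff f (\<gamma>(i := \<gamma> i - 1)) else 0)"
    by (subst sum.delta[OF finite_atMost_multi]) simp
  also have "munit i \<in> {..\<gamma>} \<longleftrightarrow> \<gamma> i \<noteq> 0"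
    by (auto simp: le_fun_def)
  finally show ?thesis by simp
qed

lemma mfps_coeff_mono_X_mult:
  "mfps_coeff (mfps_mono mfps_X \<beta> * f) \<gamma> = (if \<beta> \<le> \<gamma> then mfps_coeff f (\<lambda>i. \<gamma> i - \<beta> i) else 0)"
proof (induction "mdeg \<beta>" arbitrary: \<beta> \<gamma>)
  case 0
  then have "\<beta> = (\<lambda>_. 0)" by (simp add: mdeg_eq_0_iff)
  then show ?case by (simp add: le_fun_def)
next
  case (Suc n)
  then obtain i where i: "\<beta> i \<noteq> 0" by (metis Zero_not_Suc mdeg_eq_0_iff)
  define \<alpha> where "\<alpha> = \<beta>(i := \<beta> i - 1)"
  have b: "\<beta> = \<alpha>(i := Suc (\<alpha> i))" using i by (auto simp: \<alpha>_def)
  then have "mdeg \<alpha> = n" using Suc(2) by (metis mdeg_upd_Suc nat.inject)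
  note IH = Suc(1)[OF this[symmetric]]
  have "mfps_coeff (mfps_mono mfps_X \<beta> * f) \<gamma> = mfps_coeff (mfps_X i * (mfps_mono mfps_X \<alpha> * f)) \<gamma>"
    unfolding b mfps_mono_upd_Suc by (simp add: ac_simps)
  also have "\<dots> = (if \<beta> \<le> \<gamma> then mfps_coeff f (\<lambda>i. \<gamma> i - \<beta> i) else 0)"
  proof (cases "\<gamma> i = 0")
    case True
    then have "\<not> \<beta> \<le> \<gamma>" using i unfolding le_fun_def by (metis le_zero_eq)
    then show ?thesis using True by (simp add: mfps_coeff_X_mult)
  next
    case False
    then have "\<alpha> j \<le> (\<gamma>(i := \<gamma> i - 1)) j \<longleftrightarrow> \<beta> j \<le> \<gamma> j" for j
      unfolding b by auto
    then have "\<alpha> \<le> \<gamma>(i := \<gamma> i - 1) \<longleftrightarrow> \<beta> \<le> \<gamma>"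
      unfolding le_fun_def by blast
    moreover have "(\<lambda>j. (\<gamma>(i := \<gamma> i - 1)) j - \<alpha> j) = (\<lambda>j. \<gamma> j - \<beta> j)"
      unfolding b using False by auto
    ultimately show ?thesis using False by (simp only: mfps_coeff_X_mult IH if_False)
  qed
  finally show ?case .
qed

lemma mfps_coeff_mono_X: "mfps_coeff (mfps_mono mfps_X \<beta>) \<gamma> = (if \<beta> = \<gamma> then 1 else 0)"
proof -
  have "(\<beta> \<le> \<gamma> \<and> (\<forall>i. \<gamma> i \<le> \<beta> i)) \<longleftrightarrow> \<beta> = \<gamma>" by (auto simp: le_fun_def intro!: antisym)
  then show ?thesis using mfps_coeff_mono_X_mult[of \<beta> 1 \<gamma>] by (auto simp: mfps_coeff_1 fun_eq_iff)
qed

lemma mfps_vanish_X [simp]: "mfps_vanish mfps_X"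
  by (auto simp: mfps_vanish_def mfps_X_def fun_eq_iff)

lemma mfps_subst_id [simp]: "mfps_subst F mfps_X = F"
proof (rule mfps_eqI)
  fix \<gamma>
  have "mfps_coeff (mfps_subst F mfps_X) \<gamma> = (\<Sum>\<beta> | mdeg \<beta> \<le> mdeg \<gamma>. if \<beta> = \<gamma> then mfps_coeff F \<gamma> else 0)"
    unfolding mfps_coeff_subst[OF mfps_vanish_X order_refl] mfps_coeff_mono_X
    by (intro sum.cong) auto
  then show "mfps_coeff (mfps_subst F mfps_X) \<gamma> = mfps_coeff F \<gamma>" by (simp add: finite_mdeg_le)
qed

lemma mfps_D_mono:
  "mfps_D i (mfps_mono g \<beta>) = (\<Sum>m\<in>UNIV. of_nat (\<beta> m) * (mfps_mono g (\<beta>(m := \<beta> m - 1)) * mfps_D i (g m)))"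
  unfolding mfps_mono_def mfps_D_prod[OF finite] mfps_D_power
proof (rule sum.cong[OF refl])
  fix m
  have "(\<Prod>j\<in>UNIV. g j ^ (\<beta>(m := \<beta> m - 1)) j) = g m ^ (\<beta> m - 1) * (\<Prod>j\<in>UNIV - {m}. g j ^ \<beta> j)"
    by (subst prod.remove[of _ m]) (auto intro!: prod.cong)
  then show "(\<Prod>j\<in>UNIV - {m}. g j ^ \<beta> j) * (of_nat (\<beta> m) * g m ^ (\<beta> m - 1) * mfps_D i (g m))
      = of_nat (\<beta> m) * ((\<Prod>j\<in>UNIV. g j ^ (\<beta>(m := \<beta> m - 1)) j) * mfps_D i (g m))"
    by (simp add: ac_simps)
qed

text \<open>Chain rule. The coefficient of the derivative at \<open>\<gamma>\<close> looks one
  degree higher, hence the cut at \<open>Suc (mdeg \<gamma>)\<close>; shifting the index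
  \<open>\<beta> m\<close> brings it back to \<open>mdeg \<gamma>\<close>.\<close>

lemma mfps_D_subst:
  fixes F :: "('a::field_char_0, 'm::finite) mfps" and g :: "'m \<Rightarrow> ('a, 'i::finite) mfps"
  assumes g: "mfps_vanish g"
  shows "mfps_D i (mfps_subst F g) = (\<Sum>m\<in>UNIV. mfps_subst (mfps_D m F) g * mfps_D i (g m))"
proof (rule mfps_eqI)
  fix \<gamma> :: "'i \<Rightarrow> nat"
  let ?A = "{\<beta> :: 'm \<Rightarrow> nat. mdeg \<beta> \<le> mdeg \<gamma>}" and ?B = "{\<beta> :: 'm \<Rightarrow> nat. mdeg \<beta> \<le> Suc (mdeg \<gamma>)}"
  have "mfps_coeff (mfps_D i (mfps_subst F g)) \<gamma>
      = (\<Sum>\<beta>\<in>?B. mfps_coeff F \<beta> * mfps_coeff (mfps_D i (mfps_mono g \<beta>)) \<gamma>)"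
    unfolding mfps_coeff_deriv_single
    by (subst mfps_coeff_subst[OF g, of _ "Suc (mdeg \<gamma>)"])
       (simp_all only: mdeg_upd_Suc sum_distrib_left mult.left_commute order_refl)
  also have "\<dots> = (\<Sum>m\<in>UNIV. \<Sum>\<beta>\<in>?B. of_nat (\<beta> m) * (mfps_coeff F \<beta> * mfps_coeff (mfps_mono g (\<beta>(m := \<beta> m - 1)) * mfps_D i (g m)) \<gamma>))"
    unfolding mfps_D_mono mfps_coeff_sum sum_distrib_left mfps_coeff_of_nat_mult
    by (subst sum.swap) (simp only: mult.left_commute)
  also have "\<dots> = (\<Sum>m\<in>UNIV. mfps_coeff (mfps_subst (mfps_D m F) g * mfps_D i (g m)) \<gamma>)"
  proof (rule sum.cong[OF refl])
    fix m
    let ?h = "mfps_D i (g m)"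
    have "(\<delta>(m := Suc (\<delta> m)))(m := (\<delta>(m := Suc (\<delta> m))) m - 1) = \<delta>" for \<delta> :: "'m \<Rightarrow> nat" by simp
    then have "(\<Sum>\<beta>\<in>?B. of_nat (\<beta> m) * (mfps_coeff F \<beta> * mfps_coeff (mfps_mono g (\<beta>(m := \<beta> m - 1)) * ?h) \<gamma>))
      = (\<Sum>\<delta>\<in>?A. mfps_coeff (mfps_D m F) \<delta> * mfps_coeff (mfps_mono g \<delta> * ?h) \<gamma>)"
      unfolding mfps_coeff_deriv_single
      by (subst sum_upd_Suc[where A = ?A])
        (simp_all only: mdeg_upd_Suc mem_Collect_eq Suc_le_mono finite_mdeg_le mult.assoc)
    also have "\<dots> = mfps_coeff (mfps_subst (mfps_D m F) g * ?h) \<gamma>"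
      unfolding mfps_coeff_subst_mult[OF g order_refl] ..
    finally show "(\<Sum>\<beta>\<in>?B. of_nat (\<beta> m) * (mfps_coeff F \<beta> * mfps_coeff (mfps_mono g (\<beta>(m := \<beta> m - 1)) * ?h) \<gamma>))
      = mfps_coeff (mfps_subst (mfps_D m F) g * ?h) \<gamma>" .
  qed
  finally show "mfps_coeff (mfps_D i (mfps_subst F g)) \<gamma> = mfps_coeff (\<Sum>m\<in>UNIV. mfps_subst (mfps_D m F) g * mfps_D i (g m)) \<gamma>"
    by (simp only: mfps_coeff_sum)
qed

subsection \<open>Weighted norms\<close>

text \<open>A bound on the weighted l^1 norm. Finite partial sums avoid any summability side
  condition and pass directly to coefficientwise limits.\<close>

definition mfps_bnd :: "(('i \<Rightarrow> nat) \<Rightarrow> real) \<Rightarrow> (complex, 'i::finite) mfps \<Rightarrow> real \<Rightarrow> bool" where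
  "mfps_bnd W f B \<longleftrightarrow> (\<forall>S. finite S \<longrightarrow> (\<Sum>\<alpha>\<in>S. norm (mfps_coeff f \<alpha>) * W \<alpha>) \<le> B)"

text \<open>The conditions under which the weighted l^1 norm is a submultiplicative norm in which 1
  has norm at most 1.\<close>

definition submult :: "(('i \<Rightarrow> nat) \<Rightarrow> real) \<Rightarrow> bool" where
  "submult W \<longleftrightarrow> (\<forall>\<alpha>. 0 \<le> W \<alpha>) \<and> W (\<lambda>_. 0) \<le> 1 \<and> (\<forall>\<alpha> \<beta>. W (\<lambda>i. \<alpha> i + \<beta> i) \<le> W \<alpha> * W \<beta>)"

lemma submult_nonneg: "submult W \<Longrightarrow> 0 \<le> W \<alpha>"
  by (simp add: submult_def)

lemma mfps_bndI: "(\<And>S. finite S \<Longrightarrow> (\<Sum>\<alpha>\<in>S. norm (mfps_coeff f \<alpha>) * W \<alpha>) \<le> B) \<Longrightarrow> mfps_bnd W f B"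
  by (simp add: mfps_bnd_def)

lemma mfps_bndD: "mfps_bnd W f B \<Longrightarrow> finite S \<Longrightarrow> (\<Sum>\<alpha>\<in>S. norm (mfps_coeff f \<alpha>) * W \<alpha>) \<le> B"
  by (simp add: mfps_bnd_def)

lemma mfps_bnd_nonneg: "mfps_bnd W f B \<Longrightarrow> 0 \<le> B"
  using mfps_bndD[of W f B "{}"] by simp

lemma mfps_bnd_coeff: "mfps_bnd W f B \<Longrightarrow> norm (mfps_coeff f \<alpha>) * W \<alpha> \<le> B"
  using mfps_bndD[of W f B "{\<alpha>}"] by simp

lemma mfps_bnd_mono: "mfps_bnd W f B \<Longrightarrow> B \<le> B' \<Longrightarrow> mfps_bnd W f B'"
  unfolding mfps_bnd_def by (meson order_trans)

lemma mfps_bnd_weight_mono: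
  assumes "mfps_bnd W f B" "\<And>\<alpha>. mfps_coeff f \<alpha> \<noteq> 0 \<Longrightarrow> W' \<alpha> \<le> c * W \<alpha>" "0 \<le> c"
  shows "mfps_bnd W' f (c * B)"
proof (rule mfps_bndI)
  fix S :: "('a \<Rightarrow> nat) set" assume S: "finite S"
  have "(\<Sum>\<alpha>\<in>S. norm (mfps_coeff f \<alpha>) * W' \<alpha>) \<le> (\<Sum>\<alpha>\<in>S. c * (norm (mfps_coeff f \<alpha>) * W \<alpha>))"
  proof (rule sum_mono)
    fix \<alpha>
    show "norm (mfps_coeff f \<alpha>) * W' \<alpha> \<le> c * (norm (mfps_coeff f \<alpha>) * W \<alpha>)"
      using mult_left_mono[OF assms(2)[of \<alpha>], of "norm (mfps_coeff f \<alpha>)"]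
      by (cases "mfps_coeff f \<alpha> = 0") (auto simp: mult.left_commute)
  qed
  also have "\<dots> \<le> c * B"
    unfolding sum_distrib_left[symmetric] by (rule mult_left_mono[OF mfps_bndD[OF assms(1) S] assms(3)])
  finally show "(\<Sum>\<alpha>\<in>S. norm (mfps_coeff f \<alpha>) * W' \<alpha>) \<le> c * B" .
qed

text \<open>For operators such as derivatives and multiplication by powers of a variable, where each
  coefficient of the image comes from a single coefficient of the argument.\<close>

lemma mfps_bnd_reindex:
  fixes f :: "(complex, 'a::finite) mfps" and h :: "(complex, 'b::finite) mfps"
  assumes f: "mfps_bnd W f B" and c: "0 \<le> c" and inj: "inj_on \<phi> A"
    and z: "\<And>\<alpha>. \<alpha> \<notin> A \<Longrightarrow> mfps_coeff h \<alpha> = 0"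
    and le: "\<And>\<alpha>. \<alpha> \<in> A \<Longrightarrow> norm (mfps_coeff h \<alpha>) * W' \<alpha> \<le> c * (norm (mfps_coeff f (\<phi> \<alpha>)) * W (\<phi> \<alpha>))"
  shows "mfps_bnd W' h (c * B)"
proof (rule mfps_bndI)
  fix S :: "('b \<Rightarrow> nat) set" assume S: "finite S"
  have "(\<Sum>\<alpha>\<in>S. norm (mfps_coeff h \<alpha>) * W' \<alpha>) = (\<Sum>\<alpha>\<in>S \<inter> A. norm (mfps_coeff h \<alpha>) * W' \<alpha>)"
    using S z by (intro sum.mono_neutral_right) auto
  also have "\<dots> \<le> (\<Sum>\<alpha>\<in>S \<inter> A. c * (norm (mfps_coeff f (\<phi> \<alpha>)) * W (\<phi> \<alpha>)))"
    by (intro sum_mono le) auto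
  also have "\<dots> = c * (\<Sum>\<beta>\<in>\<phi> ` (S \<inter> A). norm (mfps_coeff f \<beta>) * W \<beta>)"
    unfolding sum_distrib_left[symmetric]
    by (subst sum.reindex) (use inj in \<open>auto intro: inj_on_subset\<close>)
  also have "\<dots> \<le> c * B"
    using S by (intro mult_left_mono c mfps_bndD[OF f]) auto
  finally show "(\<Sum>\<alpha>\<in>S. norm (mfps_coeff h \<alpha>) * W' \<alpha>) \<le> c * B" .
qed

lemma mfps_bnd_0: "mfps_bnd W 0 0"
  by (simp add: mfps_bnd_def)

lemma mfps_bnd_add:
  assumes W: "submult W" and f: "mfps_bnd W f A" and g: "mfps_bnd W g B"
  shows "mfps_bnd W (f + g) (A + B)"
proof (rule mfps_bndI)
  fix S :: "('a \<Rightarrow> nat) set" assume S: "finite S"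
  have "(\<Sum>\<alpha>\<in>S. norm (mfps_coeff (f + g) \<alpha>) * W \<alpha>)
      \<le> (\<Sum>\<alpha>\<in>S. norm (mfps_coeff f \<alpha>) * W \<alpha> + norm (mfps_coeff g \<alpha>) * W \<alpha>)"
    by (intro sum_mono) (simp add: distrib_right[symmetric] mult_right_mono norm_triangle_ineq submult_nonneg[OF W])
  then show "(\<Sum>\<alpha>\<in>S. norm (mfps_coeff (f + g) \<alpha>) * W \<alpha>) \<le> A + B"
    using mfps_bndD[OF f S] mfps_bndD[OF g S] by (simp add: sum.distrib)
qed

lemma mfps_bnd_sum:
  assumes W: "submult W" and f: "\<And>x. x \<in> I \<Longrightarrow> mfps_bnd W (f x) (B x)"
  shows "mfps_bnd W (\<Sum>x\<in>I. f x) (\<Sum>x\<in>I. B x)"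
  using f by (induction I rule: infinite_finite_induct) (auto simp: mfps_bnd_0 intro: mfps_bnd_add[OF W])

lemma mfps_bnd_1: "submult W \<Longrightarrow> mfps_bnd W 1 1"
proof (rule mfps_bndI)
  fix S :: "('a \<Rightarrow> nat) set" assume S: "finite S" and W: "submult W"
  have "(\<Sum>\<alpha>\<in>S. norm (mfps_coeff (1 :: (complex, 'a) mfps) \<alpha>) * W \<alpha>) = (\<Sum>\<alpha>\<in>S. if \<alpha> = (\<lambda>_. 0) then W (\<lambda>_. 0) else 0)"
    by (intro sum.cong) (auto simp: mfps_coeff_1)
  also have "\<dots> \<le> 1" using S W by (auto simp: submult_def)
  finally show "(\<Sum>\<alpha>\<in>S. norm (mfps_coeff (1 :: (complex, 'a) mfps) \<alpha>) * W \<alpha>) \<le> 1" .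
qed

text \<open>The Cauchy product is spread over the pairs of exponents \<open>\<beta>\<close> and
  \<open>\<gamma> - \<beta>\<close>, which determine the term. The finitely many pairs are enclosed
  in a rectangle, where the double sum factors.\<close>

lemma mfps_bnd_mult:
  assumes W: "submult W" and f: "mfps_bnd W f A" and g: "mfps_bnd W g B"
  shows "mfps_bnd W (f * g) (A * B)"
proof (rule mfps_bndI)
  fix S :: "('a \<Rightarrow> nat) set" assume S: "finite S"
  note W0 = submult_nonneg[OF W]
  let ?F = "\<lambda>\<alpha>. norm (mfps_coeff f \<alpha>)" and ?G = "\<lambda>\<alpha>. norm (mfps_coeff g \<alpha>)"
  let ?P = "SIGMA \<gamma>:S. {..\<gamma>}" and ?\<phi> = "\<lambda>(\<gamma>,\<beta>). (\<beta>, \<lambda>i. \<gamma> i - \<beta> i :: nat)"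
  have finP: "finite ?P" using S by (auto simp: finite_atMost_multi)
  have inj: "inj_on ?\<phi> ?P"
  proof (rule inj_onI)
    fix x y assume x: "x \<in> ?P" and y: "y \<in> ?P" and e: "?\<phi> x = ?\<phi> y"
    obtain \<gamma> \<beta> \<gamma>' \<beta>' where [simp]: "x = (\<gamma>, \<beta>)" "y = (\<gamma>', \<beta>')" by (cases x; cases y)
    have b: "\<beta> = \<beta>'" and d: "\<gamma> i - \<beta> i = \<gamma>' i - \<beta>' i" for i using e by (auto simp: fun_eq_iff)
    have "\<beta> \<le> \<gamma>" "\<beta>' \<le> \<gamma>'" using x y by auto
    then have "\<gamma> i = \<gamma>' i" for i using d[of i] b le_funD[of \<beta> \<gamma> i] le_funD[of \<beta>' \<gamma>' i] by simp
    then show "x = y" using b by auto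
  qed
  have "(\<Sum>\<gamma>\<in>S. norm (mfps_coeff (f * g) \<gamma>) * W \<gamma>)
     \<le> (\<Sum>\<gamma>\<in>S. \<Sum>\<beta>\<in>{..\<gamma>}. (?F \<beta> * W \<beta>) * (?G (\<lambda>i. \<gamma> i - \<beta> i) * W (\<lambda>i. \<gamma> i - \<beta> i)))"
  proof (rule sum_mono)
    fix \<gamma>
    have "norm (mfps_coeff (f * g) \<gamma>) * W \<gamma> \<le> (\<Sum>\<beta>\<in>{..\<gamma>}. ?F \<beta> * ?G (\<lambda>i. \<gamma> i - \<beta> i)) * W \<gamma>"
      unfolding mfps_coeff_mult by (intro mult_right_mono W0 order_trans[OF norm_sum] sum_mono) (simp add: norm_mult)
    also have "\<dots> \<le> (\<Sum>\<beta>\<in>{..\<gamma>}. (?F \<beta> * W \<beta>) * (?G (\<lambda>i. \<gamma> i - \<beta> i) * W (\<lambda>i. \<gamma> i - \<beta> i)))"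
      unfolding sum_distrib_right
    proof (rule sum_mono)
      fix \<beta> assume "\<beta> \<in> {..\<gamma>}"
      then have "(\<lambda>i. \<beta> i + (\<gamma> i - \<beta> i)) = \<gamma>" using le_funD[of \<beta> \<gamma>] by auto
      moreover have "W (\<lambda>i. \<beta> i + (\<gamma> i - \<beta> i)) \<le> W \<beta> * W (\<lambda>i. \<gamma> i - \<beta> i)"
        using W by (auto simp: submult_def)
      ultimately have "W \<gamma> \<le> W \<beta> * W (\<lambda>i. \<gamma> i - \<beta> i)" by simp
      then have "?F \<beta> * ?G (\<lambda>i. \<gamma> i - \<beta> i) * W \<gamma> \<le> ?F \<beta> * ?G (\<lambda>i. \<gamma> i - \<beta> i) * (W \<beta> * W (\<lambda>i. \<gamma> i - \<beta> i))"
        by (intro mult_left_mono) auto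
      then show "?F \<beta> * ?G (\<lambda>i. \<gamma> i - \<beta> i) * W \<gamma> \<le> (?F \<beta> * W \<beta>) * (?G (\<lambda>i. \<gamma> i - \<beta> i) * W (\<lambda>i. \<gamma> i - \<beta> i))"
        by (simp add: ac_simps)
    qed
    finally show "norm (mfps_coeff (f * g) \<gamma>) * W \<gamma> \<le> (\<Sum>\<beta>\<in>{..\<gamma>}. (?F \<beta> * W \<beta>) * (?G (\<lambda>i. \<gamma> i - \<beta> i) * W (\<lambda>i. \<gamma> i - \<beta> i)))" .
  qed
  also have "\<dots> = (\<Sum>(\<beta>,\<beta>')\<in>?\<phi> ` ?P. (?F \<beta> * W \<beta>) * (?G \<beta>' * W \<beta>'))"
    by (subst sum.reindex[OF inj]) (simp add: sum.Sigma S finite_atMost_multi case_prod_unfold)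
  also have "\<dots> \<le> (\<Sum>(\<beta>,\<beta>')\<in>fst ` ?\<phi> ` ?P \<times> snd ` ?\<phi> ` ?P. (?F \<beta> * W \<beta>) * (?G \<beta>' * W \<beta>'))"
  proof (rule sum_mono2)
    show "?\<phi> ` ?P \<subseteq> fst ` ?\<phi> ` ?P \<times> snd ` ?\<phi> ` ?P" by (rule subset_fst_snd)
    show "finite (fst ` ?\<phi> ` ?P \<times> snd ` ?\<phi> ` ?P)" using finP by blast
  qed (auto intro!: mult_nonneg_nonneg W0)
  also have "\<dots> = (\<Sum>\<beta>\<in>fst ` ?\<phi> ` ?P. ?F \<beta> * W \<beta>) * (\<Sum>\<beta>'\<in>snd ` ?\<phi> ` ?P. ?G \<beta>' * W \<beta>')"
    by (simp add: sum_product sum.cartesian_product)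
  also have "\<dots> \<le> A * B"
    using finP by (intro mult_mono mfps_bndD[OF f] mfps_bndD[OF g] mfps_bnd_nonneg[OF f] sum_nonneg mult_nonneg_nonneg W0) auto
  finally show "(\<Sum>\<gamma>\<in>S. norm (mfps_coeff (f * g) \<gamma>) * W \<gamma>) \<le> A * B" .
qed

lemma mfps_bnd_power: "submult W \<Longrightarrow> mfps_bnd W f A \<Longrightarrow> mfps_bnd W (f ^ n) (A ^ n)"
  by (induction n) (auto intro: mfps_bnd_1 mfps_bnd_mult)

lemma mfps_bnd_prod:
  assumes W: "submult W" and f: "\<And>x. x \<in> I \<Longrightarrow> mfps_bnd W (f x) (B x)"
  shows "mfps_bnd W (\<Prod>x\<in>I. f x) (\<Prod>x\<in>I. B x)"
  using f by (induction I rule: infinite_finite_induct) (auto intro: mfps_bnd_1[OF W] mfps_bnd_mult[OF W])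

lemma mfps_bnd_mono_power:
  assumes W: "submult W" and f: "\<And>i. mfps_bnd W (g i) (B i)"
  shows "mfps_bnd W (mfps_mono g \<beta>) (\<Prod>i\<in>UNIV. B i ^ \<beta> i)"
  unfolding mfps_mono_def by (intro mfps_bnd_prod mfps_bnd_power assms)

text \<open>Majorant principle: replacing each coefficient of \<open>F\<close> by its modulus and
  each \<open>g i\<close> by its norm bound dominates the norm of the substitution. The weight
  required of \<open>F\<close> is exactly the norm bound for the monomial in the
  \<open>g i\<close>.\<close>

lemma mfps_bnd_subst:
  fixes F :: "(complex, 'a::finite) mfps" and g :: "'a \<Rightarrow> (complex, 'b::finite) mfps"
  assumes W: "submult W" and g: "mfps_vanish g" and gB: "\<And>i. mfps_bnd W (g i) (B i)"
    and F: "mfps_bnd (\<lambda>\<beta>. \<Prod>i\<in>UNIV. B i ^ \<beta> i) F C"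
  shows "mfps_bnd W (mfps_subst F g) C"
proof (rule mfps_bndI)
  fix S :: "('b \<Rightarrow> nat) set" assume S: "finite S"
  define N where "N = (if S = {} then 0 else Max (mdeg ` S))"
  have N: "mdeg \<alpha> \<le> N" if "\<alpha> \<in> S" for \<alpha> using that S by (auto simp: N_def)
  let ?A = "{\<beta>. mdeg \<beta> \<le> N}"
  have "(\<Sum>\<alpha>\<in>S. norm (mfps_coeff (mfps_subst F g) \<alpha>) * W \<alpha>)
     \<le> (\<Sum>\<alpha>\<in>S. \<Sum>\<beta>\<in>?A. norm (mfps_coeff F \<beta>) * (norm (mfps_coeff (mfps_mono g \<beta>) \<alpha>) * W \<alpha>))"
  proof (rule sum_mono)
    fix \<alpha> assume "\<alpha> \<in> S"
    from N[OF this] have "norm (mfps_coeff (mfps_subst F g) \<alpha>) \<le> (\<Sum>\<beta>\<in>?A. norm (mfps_coeff F \<beta>) * norm (mfps_coeff (mfps_mono g \<beta>) \<alpha>))"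
      by (subst mfps_coeff_subst[OF g]) (auto intro!: order_trans[OF norm_sum] sum_mono simp: norm_mult)
    from mult_right_mono[OF this submult_nonneg[OF W, of \<alpha>]]
    show "norm (mfps_coeff (mfps_subst F g) \<alpha>) * W \<alpha> \<le> (\<Sum>\<beta>\<in>?A. norm (mfps_coeff F \<beta>) * (norm (mfps_coeff (mfps_mono g \<beta>) \<alpha>) * W \<alpha>))"
      by (simp add: sum_distrib_right mult.assoc)
  qed
  also have "\<dots> = (\<Sum>\<beta>\<in>?A. norm (mfps_coeff F \<beta>) * (\<Sum>\<alpha>\<in>S. norm (mfps_coeff (mfps_mono g \<beta>) \<alpha>) * W \<alpha>))"
    by (subst sum.swap) (simp add: sum_distrib_left)
  also have "\<dots> \<le> (\<Sum>\<beta>\<in>?A. norm (mfps_coeff F \<beta>) * (\<Prod>i\<in>UNIV. B i ^ \<beta> i))"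
    by (intro sum_mono mult_left_mono mfps_bndD[OF mfps_bnd_mono_power[OF W gB] S]) auto
  also have "\<dots> \<le> C" by (rule mfps_bndD[OF F finite_mdeg_le])
  finally show "(\<Sum>\<alpha>\<in>S. norm (mfps_coeff (mfps_subst F g) \<alpha>) * W \<alpha>) \<le> C" .
qed

subsection \<open>Convergent series\<close>

definition mfps_conv :: "(complex, 'i::finite) mfps \<Rightarrow> bool" where
  "mfps_conv f \<longleftrightarrow> (\<exists>r>0. \<exists>B. mfps_bnd (\<lambda>\<alpha>. r ^ mdeg \<alpha>) f B)"

lemma mfps_convI: "0 < r \<Longrightarrow> mfps_bnd (\<lambda>\<alpha>. r ^ mdeg \<alpha>) f B \<Longrightarrow> mfps_conv f"
  unfolding mfps_conv_def by (intro exI[of _ r] exI[of _ B] conjI)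

lemma mfps_convE:
  assumes "mfps_conv f"
  obtains r B where "0 < r" "mfps_bnd (\<lambda>\<alpha>. r ^ mdeg \<alpha>) f B"
proof -
  show ?thesis
    using assms unfolding mfps_conv_def
  proof (elim exE conjE)
    fix r B assume "0 < r" "mfps_bnd (\<lambda>\<alpha>. r ^ mdeg \<alpha>) f B"
    then show thesis by (rule that)
  qed
qed

lemma submult_power: "0 \<le> r \<Longrightarrow> submult (\<lambda>\<alpha>. r ^ mdeg \<alpha>)"
  by (auto simp: submult_def mdeg_add power_add)

lemma mfps_bnd_power_le:
  assumes "mfps_bnd (\<lambda>\<alpha>. r ^ mdeg \<alpha>) f B" "0 \<le> s" "s \<le> r"
  shows "mfps_bnd (\<lambda>\<alpha>. s ^ mdeg \<alpha>) f B"
  using mfps_bnd_weight_mono[OF assms(1), of "\<lambda>\<alpha>. s ^ mdeg \<alpha>" 1] assms(2,3) by (simp add: power_mono)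

lemma mfps_conv_obtain2:
  assumes "mfps_conv f" "mfps_conv g"
  obtains r A B where "0 < r" "mfps_bnd (\<lambda>\<alpha>. r ^ mdeg \<alpha>) f A" "mfps_bnd (\<lambda>\<alpha>. r ^ mdeg \<alpha>) g B"
proof -
  obtain r A where r: "0 < r" "mfps_bnd (\<lambda>\<alpha>. r ^ mdeg \<alpha>) f A" by (rule mfps_convE[OF assms(1)])
  obtain s B where s: "0 < s" "mfps_bnd (\<lambda>\<alpha>. s ^ mdeg \<alpha>) g B" by (rule mfps_convE[OF assms(2)])
  show ?thesis
  proof (rule that)
    show "0 < min r s" using r s by simp
    show "mfps_bnd (\<lambda>\<alpha>. min r s ^ mdeg \<alpha>) f A" using r s by (intro mfps_bnd_power_le[OF r(2)]) auto
    show "mfps_bnd (\<lambda>\<alpha>. min r s ^ mdeg \<alpha>) g B" using r s by (intro mfps_bnd_power_le[OF s(2)]) auto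
  qed
qed

lemma mfps_conv_mult: "mfps_conv f \<Longrightarrow> mfps_conv g \<Longrightarrow> mfps_conv (f * g)"
proof (erule (1) mfps_conv_obtain2)
  fix r A B :: real assume r: "0 < r" and fg: "mfps_bnd (\<lambda>\<alpha>. r ^ mdeg \<alpha>) f A" "mfps_bnd (\<lambda>\<alpha>. r ^ mdeg \<alpha>) g B"
  show ?thesis by (rule mfps_convI[OF r mfps_bnd_mult[OF submult_power[OF less_imp_le[OF r]] fg]])
qed

lemma mfps_conv_add: "mfps_conv f \<Longrightarrow> mfps_conv g \<Longrightarrow> mfps_conv (f + g)"
proof (erule (1) mfps_conv_obtain2)
  fix r A B :: real assume r: "0 < r" and fg: "mfps_bnd (\<lambda>\<alpha>. r ^ mdeg \<alpha>) f A" "mfps_bnd (\<lambda>\<alpha>. r ^ mdeg \<alpha>) g B"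
  show ?thesis by (rule mfps_convI[OF r mfps_bnd_add[OF submult_power[OF less_imp_le[OF r]] fg]])
qed

lemma mfps_conv_0: "mfps_conv 0"
  by (rule mfps_convI[OF zero_less_one mfps_bnd_0])

lemma mfps_conv_sum: "(\<And>x. x \<in> I \<Longrightarrow> mfps_conv (f x)) \<Longrightarrow> mfps_conv (\<Sum>x\<in>I. f x)"
  by (induction I rule: infinite_finite_induct) (auto intro: mfps_conv_0 mfps_conv_add)

lemma mfps_conv_1: "mfps_conv 1"
  by (rule mfps_convI[OF zero_less_one mfps_bnd_1[OF submult_power[OF zero_le_one]]])

lemma mfps_conv_power: "mfps_conv f \<Longrightarrow> mfps_conv (f ^ n)"
  by (induction n) (auto intro: mfps_conv_1 mfps_conv_mult)

lemma mfps_conv_mono: "(\<And>i. mfps_conv (g i)) \<Longrightarrow> mfps_conv (mfps_mono g \<beta>)"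
proof -
  assume g: "\<And>i. mfps_conv (g i)"
  have "mfps_conv (\<Prod>i\<in>I. g i ^ \<beta> i)" for I
    by (induction I rule: infinite_finite_induct) (auto intro: mfps_conv_1 mfps_conv_mult mfps_conv_power g)
  then show ?thesis by (simp add: mfps_mono_def)
qed

lemma mfps_conv_const: "mfps_conv (mfps_const c)"
proof -
  have "mfps_bnd (\<lambda>\<alpha>. 1 ^ mdeg \<alpha>) (mfps_const c :: (complex, 'a) mfps) (norm c * 1)"
    by (rule mfps_bnd_reindex[OF mfps_bnd_1[OF submult_power[of 1]], where \<phi> = id and A = UNIV])
       (auto simp: mfps_coeff_1 mfps_const_def)
  then show ?thesis by (rule mfps_convI[OF zero_less_one])
qed

lemma mfps_conv_X: "mfps_conv (mfps_X i)"
proof -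
  have "mfps_bnd (\<lambda>\<alpha>. 1 ^ mdeg \<alpha>) (mfps_X i) (1 * 1)"
    by (rule mfps_bnd_reindex[OF mfps_bnd_1[OF submult_power[of 1]], where \<phi> = "\<lambda>_. \<lambda>_. 0" and A = "{munit i}"])
       (auto simp: mfps_coeff_1 mfps_X_def)
  then show ?thesis by (rule mfps_convI[OF zero_less_one])
qed

text \<open>Halving the radius leaves a factor \<open>2 ^ mdeg \<alpha>\<close> to spare, which
  dominates the factor \<open>Suc (\<alpha> i)\<close> from the derivative.\<close>

lemma mfps_conv_D:
  fixes f :: "(complex, 'i::finite) mfps"
  shows "mfps_conv f \<Longrightarrow> mfps_conv (mfps_D i f)"
proof -
  assume "mfps_conv f"
  then obtain r B where r: "0 < r" and f: "mfps_bnd (\<lambda>\<alpha>. r ^ mdeg \<alpha>) f B" by (rule mfps_convE)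
  have "mfps_bnd (\<lambda>\<alpha>. (r / 2) ^ mdeg \<alpha>) (mfps_D i f) (1 / r * B)"
  proof (rule mfps_bnd_reindex[OF f _ inj_upd_Suc])
    fix \<alpha> :: "'i \<Rightarrow> nat"
    have "Suc (mdeg \<alpha>) \<le> 2 ^ mdeg \<alpha>" by (rule Suc_leI) simp
    then have "Suc (\<alpha> i) \<le> 2 ^ mdeg \<alpha>" using le_mdeg[of \<alpha> i] by linarith
    then have "real (Suc (\<alpha> i)) \<le> 2 ^ mdeg \<alpha>" by (metis of_nat_le_iff of_nat_numeral of_nat_power)
    then have "real (Suc (\<alpha> i)) * (norm (mfps_coeff f (\<alpha>(i := Suc (\<alpha> i)))) * (r / 2) ^ mdeg \<alpha>)
       \<le> 2 ^ mdeg \<alpha> * (norm (mfps_coeff f (\<alpha>(i := Suc (\<alpha> i)))) * (r / 2) ^ mdeg \<alpha>)"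
      using r by (intro mult_right_mono) auto
    then show "norm (mfps_coeff (mfps_D i f) \<alpha>) * (r / 2) ^ mdeg \<alpha>
       \<le> 1 / r * (norm (mfps_coeff f (\<alpha>(i := Suc (\<alpha> i)))) * r ^ mdeg (\<alpha>(i := Suc (\<alpha> i))))"
      unfolding mfps_coeff_deriv_single mdeg_upd_Suc norm_mult norm_of_nat using r
      by (simp add: power_divide mult.assoc del: of_nat_Suc)
  qed (use r in auto)
  then show ?thesis by (rule mfps_convI[rotated]) (use r in simp)
qed

subsection \<open>Lifting to series in one more variable\<close>

text \<open>In the index type \<open>'i option\<close>, \<open>None\<close> stands for the extra
  variable \<open>t\<close> and \<open>Some i\<close> for \<open>x_i\<close>. A lifted series is
  free of \<open>t\<close>.\<close>

definition mfps_lift :: "('a::comm_ring_1, 'i::finite) mfps \<Rightarrow> ('a, 'i option) mfps" where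
  "mfps_lift f = mfps_subst f (\<lambda>i. mfps_X (Some i))"

definition mfps_eval :: "('a::comm_ring_1, 'i::finite) mfps \<Rightarrow> ('a, 'i option) mfps \<Rightarrow> ('a, 'i) mfps" where
  "mfps_eval p Y = mfps_subst Y (case_option p mfps_X)"

lemma mfps_coeff_X_0: "mfps_coeff (mfps_X i) (\<lambda>_. 0) = 0"
  by (rule mfps_vanish_X[unfolded mfps_vanish_def, rule_format])

lemma mfps_vanish_XSome: "mfps_vanish (\<lambda>i. mfps_X (f i))"
  by (simp add: mfps_vanish_def mfps_coeff_X_0)

lemma mfps_vanish_case: "mfps_coeff p (\<lambda>_. 0) = 0 \<Longrightarrow> mfps_vanish (case_option p mfps_X)"
  by (simp add: mfps_vanish_def mfps_coeff_X_0 split: option.split)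

lemma mfps_lift_mult: "mfps_lift (f * g) = mfps_lift f * mfps_lift g"
  unfolding mfps_lift_def by (rule mfps_subst_mult[OF mfps_vanish_XSome])

lemma UNIV_option_sum:
  fixes f :: "'i::finite option \<Rightarrow> 'b::comm_monoid_add"
  shows "(\<Sum>x\<in>UNIV. f x) = f None + (\<Sum>i\<in>UNIV. f (Some i))"
  unfolding UNIV_option_conv by (subst sum.insert) (auto simp: sum.reindex)

lemma UNIV_option_prod:
  fixes f :: "'i::finite option \<Rightarrow> 'b::comm_monoid_mult"
  shows "(\<Prod>x\<in>UNIV. f x) = f None * (\<Prod>i\<in>UNIV. f (Some i))"
  unfolding UNIV_option_conv by (subst prod.insert) (auto simp: prod.reindex)

lemma mfps_D_None_lift: "mfps_D None (mfps_lift f) = 0"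
  unfolding mfps_lift_def mfps_D_subst[OF mfps_vanish_XSome] mfps_D_X by simp

lemma mfps_D_Some_lift: "mfps_D (Some i) (mfps_lift f) = mfps_lift (mfps_D i f)"
proof -
  have "mfps_D (Some i) (mfps_lift f) = (\<Sum>m\<in>UNIV. mfps_lift (mfps_D m f) * mfps_D (Some i) (mfps_X (Some m)))"
    unfolding mfps_lift_def mfps_D_subst[OF mfps_vanish_XSome] ..
  also have "\<dots> = (\<Sum>m\<in>UNIV. if i = m then mfps_lift (mfps_D m f) else 0)"
    unfolding mfps_D_X option.inject by (rule sum.cong) auto
  also have "\<dots> = mfps_lift (mfps_D i f)"
    by (subst sum.delta') auto
  finally show ?thesis .
qed

context
  fixes p :: "('a::field_char_0, 'i::finite) mfps"
  assumes p0: "mfps_coeff p (\<lambda>_. 0) = 0"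
begin

lemma mfps_eval_mult: "mfps_eval p (f * g) = mfps_eval p f * mfps_eval p g"
  unfolding mfps_eval_def by (rule mfps_subst_mult[OF mfps_vanish_case[OF p0]])

lemma mfps_eval_power: "mfps_eval p (f ^ n) = mfps_eval p f ^ n"
  unfolding mfps_eval_def by (rule mfps_subst_power[OF mfps_vanish_case[OF p0]])

lemma mfps_eval_X_None: "mfps_eval p (mfps_X None) = p"
  unfolding mfps_eval_def by (simp add: mfps_subst_X[OF mfps_vanish_case[OF p0]])

lemma mfps_eval_X_Some: "mfps_eval p (mfps_X (Some i)) = mfps_X i"
  unfolding mfps_eval_def by (simp add: mfps_subst_X[OF mfps_vanish_case[OF p0]])

lemma mfps_eval_lift: "mfps_eval p (mfps_lift f) = f"
proof -
  have "mfps_eval p (mfps_lift f) = mfps_subst f (\<lambda>i. mfps_eval p (mfps_X (Some i)))"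
    unfolding mfps_lift_def mfps_eval_def by (rule mfps_subst_subst[OF mfps_vanish_XSome mfps_vanish_case[OF p0]])
  then show ?thesis unfolding mfps_eval_X_Some by simp
qed

lemma mfps_D_eval:
  "mfps_D i (mfps_eval p Y) = mfps_eval p (mfps_D (Some i) Y + mfps_lift (mfps_D i p) * mfps_D None Y)"
proof -
  have "mfps_D i (mfps_eval p Y) = mfps_eval p (mfps_D None Y) * mfps_D i p
     + (\<Sum>m\<in>UNIV. mfps_eval p (mfps_D (Some m) Y) * mfps_D i (mfps_X m))"
    unfolding mfps_eval_def mfps_D_subst[OF mfps_vanish_case[OF p0]] UNIV_option_sum option.case ..
  also have "(\<Sum>m\<in>UNIV. mfps_eval p (mfps_D (Some m) Y) * mfps_D i (mfps_X m))
     = (\<Sum>m\<in>UNIV. if i = m then mfps_eval p (mfps_D (Some m) Y) else 0)"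
    unfolding mfps_D_X by (rule sum.cong) auto
  also have "\<dots> = mfps_eval p (mfps_D (Some i) Y)"
    by (subst sum.delta') auto
  also have "mfps_eval p (mfps_D None Y) * mfps_D i p = mfps_eval p (mfps_lift (mfps_D i p) * mfps_D None Y)"
    unfolding mfps_eval_mult mfps_eval_lift by (rule mult.commute)
  finally show ?thesis unfolding mfps_eval_def mfps_subst_add by (simp only: add.commute)
qed

end

lemma mfps_eval_add: "mfps_eval p (f + g) = mfps_eval p f + mfps_eval p g"
  by (simp add: mfps_eval_def)

lemma mfps_eval_diff: "mfps_eval p (f - g) = mfps_eval p f - mfps_eval p g"
  by (simp add: mfps_eval_def)

lemma mfps_eval_sum: "mfps_eval p (sum f S) = (\<Sum>x\<in>S. mfps_eval p (f x))"
  by (simp add: mfps_eval_def mfps_subst_sum)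

lemma mfps_eval_const: "mfps_eval p (mfps_const c) = mfps_const c"
  by (simp add: mfps_eval_def)

subsection \<open>The weighted order\<close>

definition pdeg :: "('i::finite option \<Rightarrow> nat) \<Rightarrow> nat" where
  "pdeg \<beta> = mdeg (\<lambda>i. \<beta> (Some i))"

text \<open>Giving \<open>t\<close> weight 2 makes \<open>t\<^sup>l \<partial>\<^sub>\<gamma>\<close> raise the order for all \<open>|\<gamma>| \<le> l\<close>, \<open>l \<ge> 1\<close>.\<close>

definition wdeg :: "('i::finite option \<Rightarrow> nat) \<Rightarrow> nat" where
  "wdeg \<beta> = pdeg \<beta> + 2 * \<beta> None"

lemma mdeg_option: "mdeg \<beta> = \<beta> None + pdeg \<beta>"
  by (simp add: mdeg_def pdeg_def UNIV_option_sum)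

lemma pdeg_add: "pdeg (\<lambda>i. \<alpha> i + \<beta> i) = pdeg \<alpha> + pdeg \<beta>"
  by (simp add: pdeg_def mdeg_add)

lemma pdeg_0 [simp]: "pdeg (\<lambda>_. 0) = 0"
  by (simp add: pdeg_def)

lemma wdeg_add: "wdeg (\<lambda>i. \<alpha> i + \<beta> i) = wdeg \<alpha> + wdeg \<beta>"
  by (simp add: wdeg_def pdeg_add)

lemma wdeg_eq_0_iff: "wdeg \<beta> = 0 \<longleftrightarrow> \<beta> = (\<lambda>_. 0)"
proof -
  have "wdeg \<beta> = 0 \<longleftrightarrow> mdeg \<beta> = 0" by (auto simp: wdeg_def mdeg_option)
  then show ?thesis by (simp add: mdeg_eq_0_iff)
qed

definition wge :: "nat \<Rightarrow> ('a::comm_ring_1, 'i::finite option) mfps \<Rightarrow> bool" where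
  "wge s f \<longleftrightarrow> (\<forall>\<beta>. wdeg \<beta> < s \<longrightarrow> mfps_coeff f \<beta> = 0)"

lemma wge_0 [simp]: "wge 0 f" by (simp add: wge_def)

lemma wge_zero [simp]: "wge s 0" by (simp add: wge_def)

lemma wge_le: "wge s f \<Longrightarrow> t \<le> s \<Longrightarrow> wge t f" by (auto simp: wge_def)

lemma wge_add: "wge s f \<Longrightarrow> wge s g \<Longrightarrow> wge s (f + g)" by (auto simp: wge_def)

lemma wge_diff: "wge s f \<Longrightarrow> wge s g \<Longrightarrow> wge s (f - g)" by (auto simp: wge_def)

lemma wge_sum: "(\<And>x. x \<in> S \<Longrightarrow> wge s (f x)) \<Longrightarrow> wge s (\<Sum>x\<in>S. f x)"
  by (induction S rule: infinite_finite_induct) (auto intro: wge_add)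

lemma wge_1_iff: "wge (Suc 0) f \<longleftrightarrow> mfps_coeff f (\<lambda>_. 0) = 0"
  by (auto simp: wge_def wdeg_eq_0_iff)

lemma wge_mult:
  assumes f: "wge s f" and g: "wge t g" shows "wge (s + t) (f * g)"
  unfolding wge_def
proof (intro allI impI)
  fix \<gamma> :: "'b option \<Rightarrow> nat" assume \<gamma>: "wdeg \<gamma> < s + t"
  have "mfps_coeff f \<beta> * mfps_coeff g (\<lambda>i. \<gamma> i - \<beta> i) = 0" if "\<beta> \<le> \<gamma>" for \<beta>
  proof -
    have "(\<lambda>i. \<beta> i + (\<gamma> i - \<beta> i)) = \<gamma>" using le_funD[OF that] by simp
    then have "wdeg \<beta> + wdeg (\<lambda>i. \<gamma> i - \<beta> i) = wdeg \<gamma>" by (simp flip: wdeg_add)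
    with \<gamma> have "wdeg \<beta> < s \<or> wdeg (\<lambda>i. \<gamma> i - \<beta> i) < t" by linarith
    then show ?thesis using f g by (auto simp: wge_def)
  qed
  then show "mfps_coeff (f * g) \<gamma> = 0" by (simp add: mfps_coeff_mult)
qed

text \<open>Bookkeeping for differences of monomials: \<open>f\<close> and \<open>g\<close> are products of \<open>a\<close> factors of
  positive order that agree pairwise up to order \<open>s\<close>.\<close>

definition wcong :: "nat \<Rightarrow> nat \<Rightarrow> ('a::comm_ring_1, 'i::finite option) mfps \<Rightarrow> ('a, 'i option) mfps \<Rightarrow> bool" where
  "wcong s a f g \<longleftrightarrow> wge a f \<and> wge a g \<and> wge (s + a) (f - g)"

lemma wcong_1: "wcong s 0 1 1" by (simp add: wcong_def)

lemma wcong_mult: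
  assumes "wcong s a f f'" "wcong s b g g'"
  shows "wcong s (a + b) (f * g) (f' * g')"
proof -
  have "f * g - f' * g' = f * (g - g') + (f - f') * g'" by (simp add: algebra_simps)
  moreover have "wge (a + (s + b)) (f * (g - g'))" "wge (s + a + b) ((f - f') * g')"
    using assms by (auto simp: wcong_def intro: wge_mult)
  ultimately show ?thesis
    using assms unfolding wcong_def by (auto intro: wge_mult wge_add simp: ac_simps)
qed

lemma wcong_power: "wcong s a f f' \<Longrightarrow> wcong s (n * a) (f ^ n) (f' ^ n)"
  by (induction n) (auto intro: wcong_1 wcong_mult)

lemma wcong_mono:
  assumes "\<And>i. wcong s 1 (g i) (g' i)"
  shows "wcong s (mdeg \<beta>) (mfps_mono g \<beta>) (mfps_mono g' \<beta>)"
proof -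
  have "wcong s (\<Sum>i\<in>I. \<beta> i) (\<Prod>i\<in>I. g i ^ \<beta> i) (\<Prod>i\<in>I. g' i ^ \<beta> i)" if "finite I" for I
    using that
  proof (induction I rule: finite_induct)
    case (insert i I)
    then show ?case using wcong_mult[OF wcong_power[OF assms[of i], of "\<beta> i"] insert(3)] by simp
  qed (simp add: wcong_1)
  then show ?thesis by (simp add: mfps_mono_def mdeg_def)
qed

text \<open>The factor 2 is lost because \<open>t\<close> counts twice in \<open>wdeg\<close>, while
  \<open>p\<close> is only known to have order at least 1.\<close>

lemma mfps_eval_wge:
  assumes p0: "mfps_coeff p (\<lambda>_. 0) = 0" and Y: "wge s Y" and \<gamma>: "2 * mdeg \<gamma> < s"
  shows "mfps_coeff (mfps_eval p Y) \<gamma> = 0"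
  unfolding mfps_eval_def mfps_coeff_subst[OF mfps_vanish_case[OF p0] order_refl]
proof (rule sum.neutral, rule ballI)
  fix \<beta> :: "'b option \<Rightarrow> nat" assume "\<beta> \<in> {\<beta>. mdeg \<beta> \<le> mdeg \<gamma>}"
  then have "wdeg \<beta> < s" using \<gamma> by (auto simp: wdeg_def mdeg_option)
  then show "mfps_coeff Y \<beta> * mfps_coeff (mfps_mono (case_option p mfps_X) \<beta>) \<gamma> = 0"
    using Y by (simp add: wge_def)
qed

subsection \<open>The Gevrey weight\<close>

text \<open>The denominator of the norm. The quotient of factorials pays for derivatives in
  \<open>x\<close>, the power of \<open>fact n\<close> for those in \<open>t\<close>; up to
  geometric factors the product has size \<open>n!^k\<close>.\<close>

definition gevrey_fact :: "nat \<Rightarrow> nat \<Rightarrow> nat \<Rightarrow> real" where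
  "gevrey_fact k p n = fact (p + n) / fact p * fact n ^ (k - 1)"

definition gwt :: "nat \<Rightarrow> real \<Rightarrow> real \<Rightarrow> ('i::finite option \<Rightarrow> nat) \<Rightarrow> real" where
  "gwt k \<rho> \<tau> \<beta> = \<rho> ^ pdeg \<beta> * \<tau> ^ \<beta> None / gevrey_fact k (pdeg \<beta>) (\<beta> None)"

lemma gevrey_fact_pos: "0 < gevrey_fact k p n"
  by (simp add: gevrey_fact_def)

text \<open>The left side is a single term of Vandermonde's sum. This is what makes the Gevrey
  weight submultiplicative.\<close>

lemma binomial_mult_le: "(a + b choose b) * (c + d choose d) \<le> (a + c + (b + d) choose (b + d))"
proof -
  have "(a + b choose b) * (c + d choose (b + d - b)) \<le> (\<Sum>j\<le>b + d. (a + b choose j) * (c + d choose (b + d - j)))"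
    by (rule member_le_sum[of b]) auto
  also have "\<dots> = (a + b + (c + d) choose (b + d))" by (rule vandermonde)
  finally show ?thesis by (simp add: ac_simps)
qed

lemma gevrey_fact_eq: "gevrey_fact k p n = real (p + n choose n) * fact n * fact n ^ (k - 1)"
proof -
  have "real (p + n choose n) = fact (p + n) / (fact n * fact p)"
    using binomial_fact[of n "p + n", where 'a = real] by simp
  then show ?thesis by (simp add: gevrey_fact_def)
qed

lemma gevrey_fact_mult_le:
  "gevrey_fact k p n * gevrey_fact k q m \<le> gevrey_fact k (p + q) (n + m)"
proof -
  have f: "fact n * fact m \<le> (fact (n + m) :: real)"
  proof -
    have "fact n * fact m \<le> (fact (n + m) :: nat)" by (rule dvd_imp_le[OF fact_fact_dvd_fact]) simp
    then show ?thesis by (metis of_nat_fact of_nat_le_iff of_nat_mult)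
  qed
  have b: "real (p + n choose n) * real (q + m choose m) \<le> real (p + q + (n + m) choose (n + m))"
    using binomial_mult_le[of p n q m] by (metis of_nat_le_iff of_nat_mult)
  have "gevrey_fact k p n * gevrey_fact k q m
      = (real (p + n choose n) * real (q + m choose m)) * (fact n * fact m) * (fact n * fact m) ^ (k - 1)"
    by (simp add: gevrey_fact_eq power_mult_distrib)
  also have "\<dots> \<le> real (p + q + (n + m) choose (n + m)) * fact (n + m) * fact (n + m) ^ (k - 1)"
    by (intro mult_mono b f power_mono) auto
  also have "\<dots> = gevrey_fact k (p + q) (n + m)" by (simp add: gevrey_fact_eq)
  finally show ?thesis .
qed

lemma submult_gwt:
  assumes "0 \<le> \<rho>" "0 \<le> \<tau>" shows "submult (gwt k \<rho> \<tau>)"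
  unfolding submult_def
proof (intro conjI allI)
  fix \<alpha> \<beta> :: "'a option \<Rightarrow> nat"
  show "0 \<le> gwt k \<rho> \<tau> \<alpha>"
    using assms gevrey_fact_pos[of k "pdeg \<alpha>" "\<alpha> None"] by (simp add: gwt_def)
  let ?P = "pdeg \<alpha> + pdeg \<beta>" and ?N = "\<alpha> None + \<beta> None"
  have "gwt k \<rho> \<tau> (\<lambda>i. \<alpha> i + \<beta> i) = \<rho> ^ ?P * \<tau> ^ ?N / gevrey_fact k ?P ?N"
    by (simp add: gwt_def pdeg_add)
  also have "\<dots> \<le> \<rho> ^ ?P * \<tau> ^ ?N / (gevrey_fact k (pdeg \<alpha>) (\<alpha> None) * gevrey_fact k (pdeg \<beta>) (\<beta> None))"
    using assms by (intro divide_left_mono gevrey_fact_mult_le mult_pos_pos gevrey_fact_pos) auto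
  also have "\<dots> = gwt k \<rho> \<tau> \<alpha> * gwt k \<rho> \<tau> \<beta>" by (simp add: gwt_def power_add)
  finally show "gwt k \<rho> \<tau> (\<lambda>i. \<alpha> i + \<beta> i) \<le> gwt k \<rho> \<tau> \<alpha> * gwt k \<rho> \<tau> \<beta>" .
qed (simp add: gwt_def gevrey_fact_def)

lemma fact_quot_mono: "a \<le> b \<Longrightarrow> fact (a + c) / fact a \<le> (fact (b + c) / fact b :: real)"
proof (induction c)
  case (Suc c)
  have "fact (a + Suc c) / fact a = real (a + c + 1) * (fact (a + c) / fact a)" by simp
  also have "\<dots> \<le> real (b + c + 1) * (fact (b + c) / fact b)"
    using Suc by (intro mult_mono) auto
  also have "\<dots> = fact (b + Suc c) / fact b" by simp
  finally show ?case .
qed simp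

text \<open>A mixed derivative in several variables costs no more than the same number of
  derivatives in one variable at the total degree, so that weights depending on the total degree
  suffice.\<close>

lemma prod_fact_quot_le:
  assumes "finite I"
  shows "(\<Prod>i\<in>I. fact (\<alpha> i + \<gamma> i) / fact (\<alpha> i)) \<le> (fact (sum \<alpha> I + sum \<gamma> I) / fact (sum \<alpha> I) :: real)"
  using assms
proof (induction I rule: finite_induct)
  case (insert i I)
  let ?a = "\<alpha> i" and ?c = "\<gamma> i" and ?p = "sum \<alpha> I" and ?g = "sum \<gamma> I"
  have "(\<Prod>i\<in>insert i I. fact (\<alpha> i + \<gamma> i) / fact (\<alpha> i)) \<le> fact (?a + ?c) / fact ?a * (fact (?p + ?g) / fact ?p :: real)"
    unfolding prod.insert[OF insert(1,2)] by (intro mult_left_mono insert(3)) auto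
  \<comment> \<open>Both quotients are enlarged by raising their bases, chosen so that they
    telescope to the quotient for the total degrees.\<close>
  also have "\<dots> \<le> fact ((?a + ?p + ?g) + ?c) / fact (?a + ?p + ?g) * (fact (?a + ?p + ?g) / fact (?a + ?p))"
    by (intro mult_mono fact_quot_mono) auto
  also have "\<dots> = fact (sum \<alpha> (insert i I) + sum \<gamma> (insert i I)) / fact (sum \<alpha> (insert i I))"
    using insert by (simp add: ac_simps)
  finally show ?case .
qed simp

text \<open>The choice of weight: this inequality makes multiplication by \<open>t\<^sup>l\<close> after \<open>l\<close>
  differentiations in \<open>x\<close> bounded, at the cost of a power of \<open>n\<close> that \<open>n!\<^sup>k\<^sup>-\<^sup>1\<close> absorbs.\<close>

lemma gevrey_fact_shift:
  assumes l: "1 \<le> l" "g \<le> l" and m: "m \<le> n" and k: "m < k \<or> m = k \<and> g = 0" "1 \<le> k"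
  shows "fact n / fact (n - m) * (fact (p + g) / fact p) * gevrey_fact k (p + g) n \<le> gevrey_fact k p (n + l)"
proof -
  have "(fact n / fact (n - m) :: real) = real (fact n div fact (n - m))"
    by (simp add: fact_dvd real_of_nat_div)
  also have "\<dots> \<le> real n ^ m"
    using fact_div_fact_le_pow[OF m] by (metis of_nat_le_iff of_nat_power)
  finally have fall: "(fact n / fact (n - m) :: real) \<le> real n ^ m" .
  have fn: "real (n + l) * fact n \<le> fact (n + l)"
  proof -
    obtain l' where l': "l = Suc l'" using l by (cases l) auto
    have "real (n + l) * fact n \<le> real (n + l) * fact (n + l')" by (intro mult_left_mono fact_mono) auto
    also have "\<dots> = fact (n + l)" unfolding l' by simp
    finally show ?thesis .
  qed
  have "fact n / fact (n - m) * (fact (p + g) / fact p) * gevrey_fact k (p + g) n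
      = fact n / fact (n - m) * (fact (p + g + n) / fact p) * fact n ^ (k - 1)"
    by (simp add: gevrey_fact_def)
  also have "\<dots> \<le> real n ^ m * (fact (p + g + n) / fact p) * fact n ^ (k - 1)"
    by (intro mult_right_mono fall) auto
  also have "\<dots> \<le> fact (p + (n + l)) / fact p * fact (n + l) ^ (k - 1)"
  proof (cases "m < k")
    case True
    \<comment> \<open>Each of these \<open>k - 1\<close> powers of \<open>n + l\<close> later
      combines with one \<open>fact n\<close> to give at most \<open>fact (n + l)\<close>, by
      \<open>fn\<close>.\<close>
    have "real n ^ m \<le> real (n + l) ^ (k - 1)"
    proof -
      have "real n ^ m \<le> real (n + l) ^ m" by (intro power_mono) auto
      also have "\<dots> \<le> real (n + l) ^ (k - 1)" using True l by (intro power_increasing) auto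
      finally show ?thesis .
    qed
    then have "real n ^ m * (fact (p + g + n) / fact p) * fact n ^ (k - 1)
       \<le> real (n + l) ^ (k - 1) * (fact (p + (n + l)) / fact p) * fact n ^ (k - 1)"
      using l by (intro mult_mono divide_right_mono fact_mono) auto
    also have "\<dots> = fact (p + (n + l)) / fact p * (real (n + l) * fact n) ^ (k - 1)"
      by (simp add: power_mult_distrib)
    also have "\<dots> \<le> fact (p + (n + l)) / fact p * fact (n + l) ^ (k - 1)"
      by (intro mult_left_mono power_mono fn) auto
    finally show ?thesis .
  next
    case False
    \<comment> \<open>The borderline case of \<open>k\<close> derivatives in \<open>t\<close> and
      none in \<open>x\<close>: one factor \<open>n\<close> is absorbed by
      \<open>fact (p + n)\<close>, the other \<open>k - 1\<close> by the copies of
      \<open>fact n\<close>.\<close>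
    then have m: "m = k" "g = 0" using k by auto
    obtain k' where k': "k = Suc k'" using k by (cases k) auto
    have e: "real n ^ m * (fact (p + g + n) / fact p) * fact n ^ (k - 1)
       = (real n * fact (p + n)) / fact p * (real n * fact n) ^ (k - 1)"
      by (simp add: m k' power_mult_distrib)
    have "real n * fact (p + n) \<le> fact (p + (n + l))"
    proof -
      have "real n * fact (p + n) \<le> real (Suc (p + n)) * fact (p + n)" by (intro mult_right_mono) auto
      also have "\<dots> = fact (Suc (p + n))" by simp
      also have "\<dots> \<le> fact (p + (n + l))" using l by (intro fact_mono) auto
      finally show ?thesis .
    qed
    moreover have "real n * fact n \<le> fact (n + l)"
      by (rule order_trans[OF mult_right_mono fn]) auto
    ultimately show ?thesis unfolding e
      by (intro mult_mono divide_right_mono power_mono) auto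
  qed
  also have "\<dots> = gevrey_fact k p (n + l)" by (simp add: gevrey_fact_def)
  finally show ?thesis .
qed

subsection \<open>Contracting operators\<close>

text \<open>\<open>C\<close> is uniform in \<open>\<tau>\<close>, so the explicit factor
  \<open>\<tau>\<close> makes the operator as small as desired.\<close>

definition gwt_bounded ::
  "nat \<Rightarrow> real \<Rightarrow> real \<Rightarrow> ((complex, 'i::finite option) mfps \<Rightarrow> (complex, 'i option) mfps) \<Rightarrow> bool" where
  "gwt_bounded k \<rho> C T \<longleftrightarrow> 0 \<le> C \<and> (\<forall>\<tau> Y B. 0 < \<tau> \<longrightarrow> \<tau> \<le> 1 \<longrightarrow>
     mfps_bnd (gwt k \<rho> \<tau>) Y B \<longrightarrow> mfps_bnd (gwt k \<rho> \<tau>) (T Y) (C * \<tau> * B))"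

text \<open>The radius \<open>r\<close> reflects that coefficients converge only near 0. The
  constant \<open>C\<close> may depend on \<open>\<rho>\<close>, so \<open>\<rho>\<close> has to be
  fixed before \<open>\<tau>\<close> is chosen.\<close>

definition contracting :: "nat \<Rightarrow> ((complex, 'i::finite option) mfps \<Rightarrow> (complex, 'i option) mfps) \<Rightarrow> bool" where
  "contracting k T \<longleftrightarrow> (\<forall>Y Z. T (Y - Z) = T Y - T Z) \<and> (\<forall>s Y. wge s Y \<longrightarrow> wge (Suc s) (T Y)) \<and>
     (\<exists>r>0. \<forall>\<rho>. 0 < \<rho> \<longrightarrow> \<rho> \<le> r \<longrightarrow> (\<exists>C. gwt_bounded k \<rho> C T))"

lemma gwt_boundedI:
  assumes "0 \<le> C" and "\<And>\<tau> Y B. \<lbrakk>0 < \<tau>; \<tau> \<le> 1; mfps_bnd (gwt k \<rho> \<tau>) Y B\<rbrakk> \<Longrightarrow> mfps_bnd (gwt k \<rho> \<tau>) (T Y) (C * \<tau> * B)"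
  shows "gwt_bounded k \<rho> C T"
  unfolding gwt_bounded_def by (intro conjI allI impI assms)

lemma gwt_boundedD:
  assumes "gwt_bounded k \<rho> C T"
  shows "0 \<le> C" and "\<lbrakk>0 < \<tau>; \<tau> \<le> 1; mfps_bnd (gwt k \<rho> \<tau>) Y B\<rbrakk> \<Longrightarrow> mfps_bnd (gwt k \<rho> \<tau>) (T Y) (C * \<tau> * B)"
  using assms unfolding gwt_bounded_def by simp_all

lemma contractingI:
  assumes "\<And>Y Z. T (Y - Z) = T Y - T Z" and "\<And>s Y. wge s Y \<Longrightarrow> wge (Suc s) (T Y)"
    and "0 < r" and "\<And>\<rho>. 0 < \<rho> \<Longrightarrow> \<rho> \<le> r \<Longrightarrow> \<exists>C. gwt_bounded k \<rho> C T"
  shows "contracting k T"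
  unfolding contracting_def by (intro conjI allI impI exI[of _ r] assms)

lemma
  assumes "contracting k T"
  shows contracting_diff: "T (Y - Z) = T Y - T Z" and contracting_wge: "wge s Y \<Longrightarrow> wge (Suc s) (T Y)"
    and contracting_bounded: "\<exists>r>0. \<forall>\<rho>. 0 < \<rho> \<longrightarrow> \<rho> \<le> r \<longrightarrow> (\<exists>C. gwt_bounded k \<rho> C T)"
  using assms unfolding contracting_def by blast+

lemma contracting_0: "contracting k (\<lambda>_. 0)"
proof (rule contractingI[where r = 1])
  fix \<rho> :: real
  have "gwt_bounded k \<rho> 0 (\<lambda>_. 0 :: (complex, 'a option) mfps)"
    by (rule gwt_boundedI) (simp_all add: mfps_bnd_0)
  then show "\<exists>C. gwt_bounded k \<rho> C (\<lambda>_. 0 :: (complex, 'a option) mfps)" by (rule exI)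
qed auto

lemma contracting_add:
  fixes S T :: "(complex, 'a::finite option) mfps \<Rightarrow> (complex, 'a option) mfps"
  assumes S: "contracting k S" and T: "contracting k T"
  shows "contracting k (\<lambda>Y. S Y + T Y)"
proof -
  obtain r where r: "0 < r" and rS: "\<forall>\<rho>. 0 < \<rho> \<longrightarrow> \<rho> \<le> r \<longrightarrow> (\<exists>C. gwt_bounded k \<rho> C S)"
    using contracting_bounded[OF S] by blast
  obtain r' where r': "0 < r'" and rT: "\<forall>\<rho>. 0 < \<rho> \<longrightarrow> \<rho> \<le> r' \<longrightarrow> (\<exists>C. gwt_bounded k \<rho> C T)"
    using contracting_bounded[OF T] by blast
  show ?thesis
  proof (rule contractingI[where r = "min r r'"])
    fix \<rho> :: real assume \<rho>: "0 < \<rho>" "\<rho> \<le> min r r'"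
    obtain C where C: "gwt_bounded k \<rho> C S" using rS \<rho> by auto
    obtain D where D: "gwt_bounded k \<rho> D T" using rT \<rho> by auto
    have "gwt_bounded k \<rho> (C + D) (\<lambda>Y. S Y + T Y)"
    proof (rule gwt_boundedI)
      fix \<tau> B :: real and Y :: "(complex, 'a option) mfps"
      assume h: "0 < \<tau>" "\<tau> \<le> 1" "mfps_bnd (gwt k \<rho> \<tau>) Y B"
      have "mfps_bnd (gwt k \<rho> \<tau>) (S Y + T Y) (C * \<tau> * B + D * \<tau> * B)"
        using h \<rho> by (intro mfps_bnd_add submult_gwt gwt_boundedD(2)[OF C h] gwt_boundedD(2)[OF D h]) auto
      then show "mfps_bnd (gwt k \<rho> \<tau>) (S Y + T Y) ((C + D) * \<tau> * B)" by (simp add: algebra_simps)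
    qed (use gwt_boundedD(1)[OF C] gwt_boundedD(1)[OF D] in simp)
    then show "\<exists>C. gwt_bounded k \<rho> C (\<lambda>Y. S Y + T Y)" by (rule exI)
  qed (use r r' S T in \<open>auto simp: contracting_diff intro: wge_add contracting_wge\<close>)
qed

lemma contracting_sum:
  "(\<And>x. x \<in> I \<Longrightarrow> contracting k (T x)) \<Longrightarrow> contracting k (\<lambda>Y. \<Sum>x\<in>I. T x Y)"
  by (induction I rule: infinite_finite_induct) (auto intro: contracting_0 contracting_add)

lemma mfps_bnd_gwt_X:
  assumes "0 \<le> \<rho>" "0 \<le> \<tau>"
  shows "mfps_bnd (gwt k \<rho> \<tau>) (mfps_X (Some i)) \<rho>"
proof (rule mfps_bndI)
  fix S :: "('a option \<Rightarrow> nat) set" assume S: "finite S"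
  have p: "pdeg (munit (Some i)) = 1"
    by (simp add: pdeg_def mdeg_def)
  have "(\<Sum>\<alpha>\<in>S. norm (mfps_coeff (mfps_X (Some i) :: (complex, _) mfps) \<alpha>) * gwt k \<rho> \<tau> \<alpha>)
     = (\<Sum>\<alpha>\<in>S. if \<alpha> = munit (Some i) then gwt k \<rho> \<tau> (munit (Some i)) else 0)"
  proof (rule sum.cong[OF refl])
    fix \<alpha> :: "'a option \<Rightarrow> nat"
    show "norm (mfps_coeff (mfps_X (Some i) :: (complex, _) mfps) \<alpha>) * gwt k \<rho> \<tau> \<alpha> = (if \<alpha> = munit (Some i) then gwt k \<rho> \<tau> (munit (Some i)) else 0)"
      by (cases "\<alpha> = munit (Some i)") (simp_all only: mfps_X_def mfps_coeff_Abs if_True if_False, simp_all)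
  qed
  also have "\<dots> \<le> gwt k \<rho> \<tau> (munit (Some i))"
    using S submult_nonneg[OF submult_gwt[OF assms]] by (subst sum.delta) auto
  also have "\<dots> = \<rho>" unfolding gwt_def p by (simp add: gevrey_fact_def)
  finally show "(\<Sum>\<alpha>\<in>S. norm (mfps_coeff (mfps_X (Some i) :: (complex, _) mfps) \<alpha>) * gwt k \<rho> \<tau> \<alpha>) \<le> \<rho>" .
qed

lemma mfps_bnd_lift:
  assumes b: "mfps_bnd (\<lambda>\<alpha>. r ^ mdeg \<alpha>) b B" and \<rho>: "0 \<le> \<rho>" "\<rho> \<le> r" and \<tau>: "0 \<le> \<tau>"
  shows "mfps_bnd (gwt k \<rho> \<tau>) (mfps_lift b) B"
  unfolding mfps_lift_def
proof (rule mfps_bnd_subst[OF submult_gwt[OF \<rho>(1) \<tau>] mfps_vanish_XSome])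
  show "mfps_bnd (\<lambda>\<beta>. \<Prod>i\<in>UNIV. \<rho> ^ \<beta> i) b B"
    using mfps_bnd_power_le[OF b \<rho>] by (simp add: mdeg_def power_sum)
qed (rule mfps_bnd_gwt_X[OF \<rho>(1) \<tau>])

lemma contracting_lift_mult:
  fixes T :: "(complex, 'a::finite option) mfps \<Rightarrow> (complex, 'a option) mfps"
  assumes b: "mfps_conv b" and T: "contracting k T"
  shows "contracting k (\<lambda>Y. mfps_lift b * T Y)"
proof -
  obtain r' A where r': "0 < r'" and bA: "mfps_bnd (\<lambda>\<alpha>. r' ^ mdeg \<alpha>) b A"
    using b by (rule mfps_convE)
  obtain r where r: "0 < r" and rT: "\<forall>\<rho>. 0 < \<rho> \<longrightarrow> \<rho> \<le> r \<longrightarrow> (\<exists>C. gwt_bounded k \<rho> C T)"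
    using contracting_bounded[OF T] by blast
  show ?thesis
  proof (rule contractingI[where r = "min r r'"])
    fix \<rho> :: real assume \<rho>: "0 < \<rho>" "\<rho> \<le> min r r'"
    obtain C where C: "gwt_bounded k \<rho> C T" using rT \<rho> by auto
    have "gwt_bounded k \<rho> (A * C) (\<lambda>Y. mfps_lift b * T Y)"
    proof (rule gwt_boundedI)
      fix \<tau> B :: real and Y :: "(complex, 'a option) mfps"
      assume h: "0 < \<tau>" "\<tau> \<le> 1" "mfps_bnd (gwt k \<rho> \<tau>) Y B"
      have "mfps_bnd (gwt k \<rho> \<tau>) (mfps_lift b * T Y) (A * (C * \<tau> * B))"
        using h \<rho> by (intro mfps_bnd_mult submult_gwt gwt_boundedD(2)[OF C h] mfps_bnd_lift[OF bA]) auto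
      then show "mfps_bnd (gwt k \<rho> \<tau>) (mfps_lift b * T Y) (A * C * \<tau> * B)" by (simp add: mult.assoc)
    qed (use gwt_boundedD(1)[OF C] mfps_bnd_nonneg[OF bA] in simp)
    then show "\<exists>C. gwt_bounded k \<rho> C (\<lambda>Y. mfps_lift b * T Y)" by (rule exI)
  next
    fix s and Y :: "(complex, 'a option) mfps" assume "wge s Y"
    then show "wge (Suc s) (mfps_lift b * T Y)"
      using wge_mult[of 0 "mfps_lift b" "Suc s" "T Y"] contracting_wge[OF T] by simp
  qed (use r r' in \<open>auto simp: contracting_diff[OF T] right_diff_distrib\<close>)
qed

lemma mfps_coeff_X_power_mult:
  "mfps_coeff (mfps_X i ^ r * f) \<beta> = (if r \<le> \<beta> i then mfps_coeff f (\<beta>(i := \<beta> i - r)) else 0)"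
proof (induction r arbitrary: \<beta>)
  case (Suc r)
  have "mfps_coeff (mfps_X i ^ Suc r * f) \<beta> = mfps_coeff (mfps_X i * (mfps_X i ^ r * f)) \<beta>"
    by (simp add: mult.assoc)
  then show ?case unfolding mfps_coeff_X_mult Suc by (auto simp: fun_upd_def cong: if_cong intro!: arg_cong[where f = "mfps_coeff f"])
qed simp

text \<open>The estimate on which all operator bounds rest. With \<open>m\<close> derivatives in
  \<open>t\<close> and \<open>g\<close> in \<open>x\<close>, the degree in \<open>t\<close> rises by
  \<open>l = r - m\<close>. The combinatorial cost is covered by \<open>gevrey_fact_shift\<close>,
  and since \<open>1 \<le> l\<close> and \<open>\<tau> \<le> 1\<close>, the surplus power
  \<open>\<tau> ^ l\<close> yields the factor \<open>\<tau>\<close>.\<close>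

lemma contracting_basic:
  fixes \<gamma> :: "'a::finite option \<Rightarrow> nat"
  assumes r: "\<gamma> None < r" "pdeg \<gamma> \<le> r - \<gamma> None" and k: "\<gamma> None < k \<or> \<gamma> None = k \<and> pdeg \<gamma> = 0" "1 \<le> k"
  shows "contracting k (\<lambda>Y. mfps_X None ^ r * mfps_deriv \<gamma> Y)"
proof -
  define m where "m = \<gamma> None"
  define g where "g = pdeg \<gamma>"
  define l where "l = r - m"
  let ?A = "{\<beta> :: 'a option \<Rightarrow> nat. r \<le> \<beta> None}"
  \<comment> \<open>The exponent of \<open>Y\<close> that feeds the coefficient at
    \<open>\<beta>\<close>: the power of \<open>t\<close> is taken off, and the exponents consumed
    by differentiation are restored. On \<open>?A\<close> the subtraction is exact, hence the map is
    injective there.\<close>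
  let ?\<phi> = "\<lambda>\<beta> x. (\<beta>(None := \<beta> None - r)) x + \<gamma> x"
  have l: "1 \<le> l" "g \<le> l" "r = l + m" using r by (auto simp: l_def g_def m_def)
  have \<phi>: "pdeg (?\<phi> \<beta>) = pdeg \<beta> + g" "?\<phi> \<beta> None = \<beta> None - r + m" for \<beta>
    by (auto simp: pdeg_def mdeg_add g_def m_def)
  have coeff: "mfps_coeff (mfps_X None ^ r * mfps_deriv \<gamma> Y) \<beta> = (if r \<le> \<beta> None then
      (fact (\<beta> None - r + m) / fact (\<beta> None - r) * (\<Prod>i\<in>UNIV. fact (\<beta> (Some i) + \<gamma> (Some i)) / fact (\<beta> (Some i)))) *
      mfps_coeff Y (?\<phi> \<beta>) else 0)" for Y :: "(complex, 'a option) mfps" and \<beta>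
    unfolding mfps_coeff_X_power_mult mfps_deriv_def mfps_coeff_Abs UNIV_option_prod by (simp add: m_def)
  show ?thesis
  proof (rule contractingI[where r = 1])
    fix s and Y :: "(complex, 'a option) mfps" assume Y: "wge s Y"
    show "wge (Suc s) (mfps_X None ^ r * mfps_deriv \<gamma> Y)"
      unfolding wge_def
    proof (intro allI impI)
      fix \<beta> :: "'a option \<Rightarrow> nat" assume b: "wdeg \<beta> < Suc s"
      show "mfps_coeff (mfps_X None ^ r * mfps_deriv \<gamma> Y) \<beta> = 0"
      proof (cases "r \<le> \<beta> None")
        case True
        from le_Suc_ex[OF True] obtain n where n: "\<beta> None = r + n" by blast
        then have "\<beta> None - r = n" by simp
        \<comment> \<open>The order drops by \<open>2 * l - g\<close>, which is at least
          \<open>l\<close> and hence at least 1; the weight 2 of \<open>t\<close> is used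
          here.\<close>
        then have "wdeg (?\<phi> \<beta>) < s" using b l n unfolding wdeg_def \<phi> by simp
        then have "mfps_coeff Y (?\<phi> \<beta>) = 0" using Y by (simp only: wge_def)
        then show ?thesis unfolding coeff by simp
      qed (simp add: coeff)
    qed
  next
    fix \<rho> :: real assume \<rho>: "0 < \<rho>" "\<rho> \<le> 1"
    show "\<exists>C. gwt_bounded k \<rho> C (\<lambda>Y. mfps_X None ^ r * mfps_deriv \<gamma> Y)"
    \<comment> \<open>The \<open>g\<close> derivatives in \<open>x\<close> lose
      \<open>\<rho> ^ g\<close>, and \<open>\<rho> ^ r\<close> is smaller because
      \<open>g \<le> r\<close> and \<open>\<rho> \<le> 1\<close>.\<close>
    proof (rule exI[of _ "1 / \<rho> ^ r"], rule gwt_boundedI)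
      fix \<tau> B :: real and Y :: "(complex, 'a option) mfps"
      assume \<tau>: "0 < \<tau>" "\<tau> \<le> 1" and Y: "mfps_bnd (gwt k \<rho> \<tau>) Y B"
      show "mfps_bnd (gwt k \<rho> \<tau>) (mfps_X None ^ r * mfps_deriv \<gamma> Y) (1 / \<rho> ^ r * \<tau> * B)"
      proof (rule mfps_bnd_reindex[OF Y, where A = ?A and \<phi> = ?\<phi>])
        show "inj_on ?\<phi> ?A"
        proof (rule inj_onI)
          fix x y assume x: "x \<in> ?A" "y \<in> ?A" and e: "?\<phi> x = ?\<phi> y"
          have "x z = y z" for z using fun_cong[OF e, of z] x by (cases z) auto
          then show "x = y" by (rule ext)
        qed
        fix \<beta> :: "'a option \<Rightarrow> nat"
        show "\<beta> \<notin> ?A \<Longrightarrow> mfps_coeff (mfps_X None ^ r * mfps_deriv \<gamma> Y) \<beta> = 0" by (simp add: coeff)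
        assume b: "\<beta> \<in> ?A"
        define n where "n = \<beta> None - r + m"
        define p where "p = pdeg \<beta>"
        have n: "\<beta> None = n + l" "m \<le> n" "\<beta> None - r = n - m" using b l by (auto simp: n_def)
        let ?Q = "\<Prod>i\<in>UNIV. fact (\<beta> (Some i) + \<gamma> (Some i)) / fact (\<beta> (Some i)) :: real"
        let ?F = "fact n / fact (n - m) * ?Q"
        let ?y = "norm (mfps_coeff Y (?\<phi> \<beta>))"
        have co: "norm (mfps_coeff (mfps_X None ^ r * mfps_deriv \<gamma> Y) \<beta>) = ?F * ?y"
          using b n(2) unfolding coeff n(3)
          by (simp add: norm_mult norm_divide norm_fact prod_norm[symmetric])
        have "?Q \<le> fact (p + g) / fact p"
          unfolding p_def g_def pdeg_def mdeg_def by (rule prod_fact_quot_le) simp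
        then have "?F * gevrey_fact k (p + g) n \<le> fact n / fact (n - m) * (fact (p + g) / fact p) * gevrey_fact k (p + g) n"
          by (intro mult_left_mono mult_right_mono) (auto intro: less_imp_le gevrey_fact_pos)
        also have "\<dots> \<le> gevrey_fact k p (n + l)"
          by (rule gevrey_fact_shift) (use l n k in \<open>auto simp: m_def g_def\<close>)
        finally have F: "?F / gevrey_fact k p (n + l) \<le> 1 / gevrey_fact k (p + g) n"
          using gevrey_fact_pos[of k] by (simp add: field_simps)
        have pw: "\<rho> ^ p * \<tau> ^ (n + l) \<le> 1 / \<rho> ^ r * \<tau> * (\<rho> ^ (p + g) * \<tau> ^ n)"
        proof -
          have "\<tau> ^ l \<le> \<tau> ^ 1" using l \<tau> by (intro power_decreasing) auto
          moreover have "\<rho> ^ r \<le> \<rho> ^ g" using l \<rho> by (intro power_decreasing) auto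
          ultimately have "\<tau> ^ l * \<rho> ^ r \<le> \<tau> * \<rho> ^ g" using \<tau> \<rho> by (intro mult_mono) auto
          then have "(\<rho> ^ p * \<tau> ^ n) * (\<tau> ^ l * \<rho> ^ r) \<le> (\<rho> ^ p * \<tau> ^ n) * (\<tau> * \<rho> ^ g)"
            using \<tau> \<rho> by (intro mult_left_mono) auto
          then show ?thesis using \<rho> by (simp add: field_simps power_add)
        qed
        then have "?F / gevrey_fact k p (n + l) * (\<rho> ^ p * \<tau> ^ (n + l))
           \<le> 1 / gevrey_fact k (p + g) n * (1 / \<rho> ^ r * \<tau> * (\<rho> ^ (p + g) * \<tau> ^ n))"
          using \<rho> \<tau> by (intro mult_mono[OF F pw]) (auto intro: less_imp_le gevrey_fact_pos)
        then have "?F / gevrey_fact k p (n + l) * (\<rho> ^ p * \<tau> ^ (n + l)) * ?y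
           \<le> 1 / gevrey_fact k (p + g) n * (1 / \<rho> ^ r * \<tau> * (\<rho> ^ (p + g) * \<tau> ^ n)) * ?y"
          by (rule mult_right_mono) simp
        moreover have w: "gwt k \<rho> \<tau> \<beta> = \<rho> ^ p * \<tau> ^ (n + l) / gevrey_fact k p (n + l)"
          unfolding gwt_def n(1) p_def ..
        moreover have w': "gwt k \<rho> \<tau> (?\<phi> \<beta>) = \<rho> ^ (p + g) * \<tau> ^ n / gevrey_fact k (p + g) n"
          unfolding gwt_def \<phi> n_def p_def ..
        ultimately show "norm (mfps_coeff (mfps_X None ^ r * mfps_deriv \<gamma> Y) \<beta>) * gwt k \<rho> \<tau> \<beta>
          \<le> 1 / \<rho> ^ r * \<tau> * (norm (mfps_coeff Y (?\<phi> \<beta>)) * gwt k \<rho> \<tau> (?\<phi> \<beta>))"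
          unfolding co w w' by (simp add: ac_simps)
      qed (use \<rho> \<tau> in auto)
    qed (use \<rho> in auto)
  qed (simp_all add: right_diff_distrib)
qed

subsection \<open>Lifting differential operators\<close>

text \<open>The remainder terms of a lifted operator of order \<open>j\<close>. The strict
  inequality for \<open>\<gamma> None\<close> ensures that multiplying by \<open>t^j\<close> leaves
  a positive surplus of \<open>t\<close>, with no divisibility involved.\<close>

inductive lowop :: "nat \<Rightarrow> ((complex, 'i::finite option) mfps \<Rightarrow> (complex, 'i option) mfps) \<Rightarrow> bool" for j where
  lowop_0: "lowop j (\<lambda>_. 0)"
| lowop_term: "mfps_conv b \<Longrightarrow> mdeg \<gamma> \<le> j \<Longrightarrow> \<gamma> None < j \<Longrightarrow> lowop j (\<lambda>Y. mfps_lift b * mfps_deriv \<gamma> Y)"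
| lowop_add: "lowop j S \<Longrightarrow> lowop j T \<Longrightarrow> lowop j (\<lambda>Y. S Y + T Y)"

text \<open>A lifted coefficient is free of \<open>t\<close>, so \<open>mfps_D None\<close> acts on
  \<open>Y\<close> alone. It raises the order in \<open>t\<close> by one, exactly as much as the
  bound \<open>j\<close>, and the strict inequality survives.\<close>

lemma lowop_D:
  assumes "lowop j T" and b: "mfps_conv b"
  shows "lowop (Suc j) (\<lambda>Y. mfps_D (Some i) (T Y) + mfps_lift b * mfps_D None (T Y))"
  using assms(1)
proof (induction rule: lowop.induct)
  case lowop_0
  show ?case using lowop.lowop_0[of "Suc j"] by simp
next
  case (lowop_term c \<gamma>)
  have "lowop (Suc j) (\<lambda>Y. mfps_lift (mfps_D i c) * mfps_deriv \<gamma> Y + (mfps_lift c * mfps_deriv (\<lambda>x. munit (Some i) x + \<gamma> x) Y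
     + mfps_lift (b * c) * mfps_deriv (\<lambda>x. munit None x + \<gamma> x) Y))"
  proof (intro lowop.lowop_add lowop.lowop_term)
    show "mdeg (\<lambda>x. munit (Some i) x + \<gamma> x) \<le> Suc j" "mdeg (\<lambda>x. munit None x + \<gamma> x) \<le> Suc j"
      unfolding mdeg_add mdeg_munit using lowop_term by simp_all
  qed (use lowop_term b in \<open>auto intro: mfps_conv_D mfps_conv_mult\<close>)
  then show ?case
    by (simp only: mfps_D_mult mfps_D_None_lift mfps_D_Some_lift mfps_deriv_mfps_deriv mfps_lift_mult mult_zero_left
        add_0_left mult.assoc add.assoc)
next
  case (lowop_add S T)
  have "lowop (Suc j) (\<lambda>Y. (mfps_D (Some i) (S Y) + mfps_lift b * mfps_D None (S Y))
     + (mfps_D (Some i) (T Y) + mfps_lift b * mfps_D None (T Y)))"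
    by (rule lowop.lowop_add) fact+
  then show ?case by (simp only: mfps_deriv_add distrib_left ac_simps)
qed

text \<open>For a term with multi-index \<open>\<gamma>\<close> the surplus of \<open>t\<close> is
  \<open>j - \<gamma> None\<close>. It is positive, and it bounds the number of derivatives in
  \<open>x\<close> because \<open>mdeg \<gamma> \<le> j\<close>.\<close>

lemma lowop_contracting:
  assumes "lowop j T" and "j \<le> k"
  shows "contracting k (\<lambda>Y. mfps_X None ^ j * T Y)"
  using assms(1)
proof (induction rule: lowop.induct)
  case lowop_0
  show ?case using contracting_0 by simp
next
  case (lowop_term c \<gamma>)
  have "contracting k (\<lambda>Y. mfps_lift c * (mfps_X None ^ j * mfps_deriv \<gamma> Y))"
    using lowop_term assms(2) by (intro contracting_lift_mult contracting_basic) (auto simp: mdeg_option)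
  then show ?case by (simp only: mult.left_commute)
next
  case (lowop_add S T)
  then show ?case using contracting_add[of k "\<lambda>Y. mfps_X None ^ j * S Y" "\<lambda>Y. mfps_X None ^ j * T Y"]
    by (simp only: distrib_left)
qed

text \<open>Induction on the order with the chain rule. Only differentiating in \<open>t\<close> at
  every step gives the full \<open>t\<close>-order, and each such step contributes one factor
  \<open>mfps_D i p\<close>; summed against the coefficients of the operator, these products form
  the series of \<open>L_star\<close>.\<close>

lemma mfps_deriv_eval:
  fixes p :: "(complex, 'i::finite) mfps"
  assumes p0: "mfps_coeff p (\<lambda>_. 0) = 0" and p: "mfps_conv p"
  shows "\<exists>T. lowop (mdeg \<alpha>) T \<and> (\<forall>Y. mfps_deriv \<alpha> (mfps_eval p Y) =
     mfps_eval p (mfps_lift (mfps_mono (\<lambda>i. mfps_D i p) \<alpha>) * mfps_deriv (\<lambda>x. if x = None then mdeg \<alpha> else 0) Y + T Y))"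
proof (induction "mdeg \<alpha>" arbitrary: \<alpha>)
  case 0
  then have [simp]: "\<alpha> = (\<lambda>_. 0)" by (simp add: mdeg_eq_0_iff)
  have "mfps_lift 1 = (1 :: (complex, 'i option) mfps)" by (simp add: mfps_lift_def)
  moreover have "(\<lambda>x :: 'i option. if x = None then mdeg \<alpha> else 0) = (\<lambda>_. 0)" by auto
  ultimately show ?case by (intro exI[of _ "\<lambda>_. 0"]) (simp add: lowop_0)
next
  case (Suc n)
  then obtain i where i: "\<alpha> i \<noteq> 0" by (metis Zero_not_Suc mdeg_eq_0_iff)
  define \<beta> where "\<beta> = \<alpha>(i := \<alpha> i - 1)"
  have \<alpha>: "\<alpha> = \<beta>(i := Suc (\<beta> i))" using i by (auto simp: \<beta>_def)
  then have n: "n = mdeg \<beta>" using Suc(2) by (metis mdeg_upd_Suc nat.inject)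
  from Suc(1)[OF n] obtain T where T: "lowop n T" and
    e: "\<And>Y. mfps_deriv \<beta> (mfps_eval p Y) = mfps_eval p (mfps_lift (mfps_mono (\<lambda>i. mfps_D i p) \<beta>) * mfps_deriv (\<lambda>x. if x = None then n else 0) Y + T Y)"
    unfolding n by metis
  let ?c = "mfps_mono (\<lambda>i. mfps_D i p) \<beta>" and ?t = "\<lambda>n (x :: 'i option). if x = None then n else (0::nat)"
  have c: "mfps_conv ?c" by (intro mfps_conv_mono mfps_conv_D p)
  \<comment> \<open>What does not raise the leading \<open>t\<close>-derivative: the derivative
    falling on the coefficient, the one falling in \<open>x\<close> direction on \<open>Y\<close>,
    and the image of the old remainder.\<close>
  define S where "S = (\<lambda>Y. (mfps_lift (mfps_D i ?c) * mfps_deriv (?t n) Y + mfps_lift ?c * mfps_deriv (\<lambda>x. munit (Some i) x + ?t n x) Y)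
     + (mfps_D (Some i) (T Y) + mfps_lift (mfps_D i p) * mfps_D None (T Y)))"
  have "mdeg (?t n) = n" by (simp add: mdeg_option pdeg_def)
  then have mt: "mdeg (\<lambda>x :: 'i option. munit (Some i) x + ?t n x) \<le> Suc n" "mdeg (?t n) \<le> Suc n"
    unfolding mdeg_add mdeg_munit by simp_all
  have "lowop (Suc n) (\<lambda>Y. mfps_lift (mfps_D i ?c) * mfps_deriv (?t n) Y)"
    by (intro lowop_term mfps_conv_D c mt) simp
  moreover have "lowop (Suc n) (\<lambda>Y. mfps_lift ?c * mfps_deriv (\<lambda>x. munit (Some i) x + ?t n x) Y)"
    by (intro lowop_term c mt) simp
  ultimately have "lowop (Suc n) S"
    unfolding S_def by (intro lowop.lowop_add[OF lowop.lowop_add] lowop_D[OF T mfps_conv_D[OF p]])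
  moreover have "mfps_deriv \<alpha> (mfps_eval p Y) = mfps_eval p (mfps_lift (mfps_mono (\<lambda>i. mfps_D i p) \<alpha>) * mfps_deriv (?t (Suc n)) Y + S Y)" for Y
  proof -
    have "\<alpha> = (\<lambda>x. munit i x + \<beta> x)" unfolding \<alpha> by auto
    then have "mfps_deriv \<alpha> (mfps_eval p Y) = mfps_D i (mfps_deriv \<beta> (mfps_eval p Y))"
      by (simp only: mfps_deriv_mfps_deriv)
    also have "\<dots> = mfps_eval p (mfps_D (Some i) (mfps_lift ?c * mfps_deriv (?t n) Y + T Y)
        + mfps_lift (mfps_D i p) * mfps_D None (mfps_lift ?c * mfps_deriv (?t n) Y + T Y))"
      unfolding e by (rule mfps_D_eval[OF p0])
    also have "mfps_D (Some i) (mfps_lift ?c * mfps_deriv (?t n) Y + T Y)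
        + mfps_lift (mfps_D i p) * mfps_D None (mfps_lift ?c * mfps_deriv (?t n) Y + T Y)
      = mfps_lift (mfps_mono (\<lambda>i. mfps_D i p) \<alpha>) * mfps_deriv (\<lambda>x. munit None x + ?t n x) Y + S Y"
      unfolding \<alpha> mfps_mono_upd_Suc S_def
      by (simp only: mfps_deriv_add mfps_D_mult mfps_D_None_lift mfps_D_Some_lift mfps_deriv_mfps_deriv mfps_lift_mult)
         (simp add: algebra_simps)
    also have "(\<lambda>x. munit None x + ?t n x) = ?t (Suc n)" by auto
    finally show ?thesis .
  qed
  ultimately show ?case unfolding Suc(2)[symmetric] by (intro exI[of _ S]) simp
qed

text \<open>The leading parts of all terms of order \<open>j\<close> share the same
  \<open>t\<close>-derivative, so only the sum of their coefficients matters. Divisibility of that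
  sum by \<open>p\<close> provides the extra \<open>t\<close> without which the leading term would
  have no surplus.\<close>

lemma operator_lift:
  fixes p q :: "(complex, 'i::finite) mfps"
  assumes p0: "mfps_coeff p (\<lambda>_. 0) = 0" and p: "mfps_conv p" and j: "j \<le> k" "1 \<le> k"
    and A: "\<And>\<alpha>. mdeg \<alpha> = j \<Longrightarrow> mfps_conv (A \<alpha>)" and q: "mfps_conv q"
    and dvd: "(\<Sum>\<alpha> | mdeg \<alpha> = j. A \<alpha> * mfps_mono (\<lambda>i. mfps_D i p) \<alpha>) = p * q"
  shows "\<exists>G. contracting k G \<and> (\<forall>Y. mfps_eval p (G Y) = p ^ j * (\<Sum>\<alpha> | mdeg \<alpha> = j. A \<alpha> * mfps_deriv \<alpha> (mfps_eval p Y)))"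
proof -
  define t where "t = (\<lambda>x :: 'i option. if x = None then j else 0)"
  have "\<forall>\<alpha>. \<exists>T. lowop (mdeg \<alpha>) T \<and> (\<forall>Y. mfps_deriv \<alpha> (mfps_eval p Y) =
     mfps_eval p (mfps_lift (mfps_mono (\<lambda>i. mfps_D i p) \<alpha>) * mfps_deriv (\<lambda>x. if x = None then mdeg \<alpha> else 0) Y + T Y))"
    using mfps_deriv_eval[OF p0 p] by (intro allI)
  from choice[OF this] obtain T where T': "\<forall>\<alpha>. lowop (mdeg \<alpha>) (T \<alpha>) \<and> (\<forall>Y. mfps_deriv \<alpha> (mfps_eval p Y) =
     mfps_eval p (mfps_lift (mfps_mono (\<lambda>i. mfps_D i p) \<alpha>) * mfps_deriv (\<lambda>x. if x = None then mdeg \<alpha> else 0) Y + T \<alpha> Y))" ..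
  note T = T'[rule_format, THEN conjunct1] and e = T'[rule_format, THEN conjunct2, rule_format]
  \<comment> \<open>The last summand stands for \<open>p q t\<^sup>j \<partial>\<^sub>t\<^sup>j\<close>: it has the same evaluation at \<open>t = p\<close>.\<close>
  define G where "G = (\<lambda>Y. (\<Sum>\<alpha> | mdeg \<alpha> = j. mfps_lift (A \<alpha>) * (mfps_X None ^ j * T \<alpha> Y))
      + mfps_lift q * (mfps_X None ^ Suc j * mfps_deriv t Y))"
  have "contracting k G"
    unfolding G_def
  proof (intro contracting_add contracting_sum contracting_lift_mult A q)
    fix \<alpha> :: "'i \<Rightarrow> nat" assume "\<alpha> \<in> {\<alpha>. mdeg \<alpha> = j}"
    then show "contracting k (\<lambda>Y. mfps_X None ^ j * T \<alpha> Y)" "mdeg \<alpha> = j"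
      using lowop_contracting[OF T[of \<alpha>], of k] j by auto
  next
    show "contracting k (\<lambda>Y. mfps_X None ^ Suc j * mfps_deriv t Y)"
      using j by (intro contracting_basic) (auto simp: t_def pdeg_def)
  qed
  moreover have "mfps_eval p (G Y) = p ^ j * (\<Sum>\<alpha> | mdeg \<alpha> = j. A \<alpha> * mfps_deriv \<alpha> (mfps_eval p Y))" for Y
  proof -
    let ?c = "\<lambda>\<alpha>. mfps_mono (\<lambda>i. mfps_D i p) \<alpha>" and ?d = "mfps_eval p (mfps_deriv t Y)"
    note ev = mfps_eval_mult[OF p0] mfps_eval_lift[OF p0] mfps_eval_X_None[OF p0] mfps_eval_power[OF p0]
      mfps_eval_add mfps_eval_sum
    have "mfps_deriv \<alpha> (mfps_eval p Y) = ?c \<alpha> * ?d + mfps_eval p (T \<alpha> Y)" if "mdeg \<alpha> = j" for \<alpha>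
      unfolding e ev that t_def ..
    then have "p ^ j * (\<Sum>\<alpha> | mdeg \<alpha> = j. A \<alpha> * mfps_deriv \<alpha> (mfps_eval p Y))
       = p ^ j * (\<Sum>\<alpha> | mdeg \<alpha> = j. A \<alpha> * (?c \<alpha> * ?d + mfps_eval p (T \<alpha> Y)))"
      by (intro arg_cong2[where f = "(*)"] sum.cong) auto
    also have "\<dots> = p ^ j * ((\<Sum>\<alpha> | mdeg \<alpha> = j. A \<alpha> * ?c \<alpha>) * ?d + (\<Sum>\<alpha> | mdeg \<alpha> = j. A \<alpha> * mfps_eval p (T \<alpha> Y)))"
      by (simp only: distrib_left sum.distrib sum_distrib_right mult.assoc)
    also have "\<dots> = (\<Sum>\<alpha> | mdeg \<alpha> = j. A \<alpha> * (p ^ j * mfps_eval p (T \<alpha> Y))) + q * (p ^ Suc j * ?d)"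
      unfolding dvd by (simp add: distrib_left sum_distrib_left ac_simps)
    also have "\<dots> = mfps_eval p (G Y)" unfolding G_def ev ..
    finally show ?thesis ..
  qed
  ultimately show ?thesis by (intro exI[of _ G] conjI allI)
qed

subsection \<open>The fixed point\<close>

text \<open>Contraction for the metric given by the weighted order, on tuples without constant term,
  where substitution is legitimate. Agreement below order \<open>Suc s\<close> improves by one
  order.\<close>

definition wcontraction ::
  "(('n \<Rightarrow> ('a::comm_ring_1, 'i::finite option) mfps) \<Rightarrow> 'n \<Rightarrow> ('a, 'i option) mfps) \<Rightarrow> bool" where
  "wcontraction \<Phi> \<longleftrightarrow> (\<forall>Y. (\<forall>l. wge (Suc 0) (Y l)) \<longrightarrow> (\<forall>l. wge (Suc 0) (\<Phi> Y l))) \<and>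
     (\<forall>s Y Z. (\<forall>l. wge (Suc 0) (Y l)) \<longrightarrow> (\<forall>l. wge (Suc 0) (Z l)) \<longrightarrow> (\<forall>l. wge (Suc s) (Y l - Z l))
       \<longrightarrow> (\<forall>l. wge (Suc (Suc s)) (\<Phi> Y l - \<Phi> Z l)))"

lemma wcontraction_pres: "wcontraction \<Phi> \<Longrightarrow> \<forall>l. wge (Suc 0) (Y l) \<Longrightarrow> \<forall>l. wge (Suc 0) (\<Phi> Y l)"
  unfolding wcontraction_def by (elim conjE allE[of _ Y]) (rule mp)

lemma wcontraction_contr:
  "\<lbrakk>wcontraction \<Phi>; \<forall>l. wge (Suc 0) (Y l); \<forall>l. wge (Suc 0) (Z l); \<forall>l. wge (Suc s) (Y l - Z l)\<rbrakk>
    \<Longrightarrow> \<forall>l. wge (Suc (Suc s)) (\<Phi> Y l - \<Phi> Z l)"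
  unfolding wcontraction_def by (elim conjE allE[of _ s] allE[of _ Y] allE[of _ Z]) simp

lemma
  fixes \<Phi> :: "('n \<Rightarrow> ('a::comm_ring_1, 'i::finite option) mfps) \<Rightarrow> 'n \<Rightarrow> ('a, 'i option) mfps"
  assumes \<Phi>: "wcontraction \<Phi>"
    and Y: "\<forall>l. wge (Suc 0) (Y l)"
  shows wge_iterate_pres: "\<forall>l. wge (Suc 0) ((\<Phi> ^^ n) Y l)"
    and wge_iterate_contr: "\<forall>l. wge (Suc 0) (Z l) \<Longrightarrow> \<forall>l. wge (Suc n) ((\<Phi> ^^ n) Y l - (\<Phi> ^^ n) Z l)"
proof -
  have a: "\<forall>l. wge (Suc 0) ((\<Phi> ^^ n) Y l)" if Y: "\<forall>l. wge (Suc 0) (Y l)" for n Y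
  proof (induction n)
    case (Suc n)
    show ?case using wcontraction_pres[OF \<Phi> Suc] by simp
  qed (simp add: Y)
  then show "\<forall>l. wge (Suc 0) ((\<Phi> ^^ n) Y l)" using Y .
  assume Z: "\<forall>l. wge (Suc 0) (Z l)"
  show "\<forall>l. wge (Suc n) ((\<Phi> ^^ n) Y l - (\<Phi> ^^ n) Z l)"
  proof (induction n)
    case 0
    show ?case using Y Z by (simp add: wge_diff)
  next
    case (Suc n)
    show ?case using wcontraction_contr[OF \<Phi> a[OF Y] a[OF Z] Suc] by simp
  qed
qed

text \<open>Banach's argument for the weighted order. The rate of convergence of the iterates of 0
  is kept in the conclusion because norm bounds are later carried from these iterates to the
  limit.\<close>

lemma wge_fixed_point:
  fixes \<Phi> :: "('n \<Rightarrow> ('a::comm_ring_1, 'i::finite option) mfps) \<Rightarrow> 'n \<Rightarrow> ('a, 'i option) mfps"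
  assumes \<Phi>: "wcontraction \<Phi>"
  shows "\<exists>Y. (\<forall>l. wge (Suc 0) (Y l)) \<and> \<Phi> Y = Y \<and> (\<forall>n l. wge (Suc n) (Y l - (\<Phi> ^^ n) (\<lambda>_. 0) l))"
proof -
  define U where "U = (\<lambda>n. (\<Phi> ^^ n) (\<lambda>_. 0))"
  have z: "\<forall>l. wge (Suc 0) ((\<lambda>_. 0) l :: ('a, 'i option) mfps)" by simp
  have U1: "\<forall>l. wge (Suc 0) (U n l)" for n
    unfolding U_def by (rule wge_iterate_pres[OF \<Phi> z])
  have step: "\<forall>l. wge (Suc n) (U (Suc n) l - U n l)" for n
  proof -
    have "\<forall>l. wge (Suc n) ((\<Phi> ^^ n) (U 1) l - (\<Phi> ^^ n) (\<lambda>_. 0) l)"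
      by (rule wge_iterate_contr[OF \<Phi> U1 z])
    then show ?thesis by (simp add: U_def funpow_swap1)
  qed
  have le: "wge (Suc n) (U (n + m) l - U n l)" for n m l
  proof (induction m)
    case (Suc m)
    have "wge (Suc n) (U (Suc (n + m)) l - U (n + m) l)" by (rule wge_le[OF step[rule_format]]) simp
    from wge_add[OF this Suc] show ?case by simp
  qed simp
  \<comment> \<open>The iterates from number \<open>wdeg \<alpha>\<close> on agree at
    \<open>\<alpha>\<close>, so the coefficient is read off where it has stabilised.\<close>
  define Y where "Y = (\<lambda>l. Abs_mfps (\<lambda>\<alpha>. mfps_coeff (U (wdeg \<alpha>) l) \<alpha>))"
  have lim: "\<forall>l. wge (Suc n) (Y l - U n l)" for n
    unfolding wge_def
  proof (intro allI impI)
    fix l and \<beta> :: "'i option \<Rightarrow> nat" assume "wdeg \<beta> < Suc n"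
    then have "wge (Suc (wdeg \<beta>)) (U n l - U (wdeg \<beta>) l)" using le[of "wdeg \<beta>" "n - wdeg \<beta>" l] by simp
    then show "mfps_coeff (Y l - U n l) \<beta> = 0" by (simp add: wge_def Y_def)
  qed
  have Y1: "\<forall>l. wge (Suc 0) (Y l)"
    using lim[of 0] by (simp add: U_def)
  have "\<Phi> Y l = Y l" for l
  proof (rule mfps_eqI)
    fix \<alpha> :: "'i option \<Rightarrow> nat"
    have "wge (Suc (Suc (wdeg \<alpha>))) (\<Phi> Y l - U (Suc (wdeg \<alpha>)) l)"
      using wcontraction_contr[OF \<Phi> Y1 U1 lim[of "wdeg \<alpha>"]] by (simp add: U_def)
    moreover have "wge (Suc (Suc (wdeg \<alpha>))) (Y l - U (Suc (wdeg \<alpha>)) l)" by (rule lim[rule_format])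
    ultimately have "wge (Suc (Suc (wdeg \<alpha>))) (\<Phi> Y l - U (Suc (wdeg \<alpha>)) l - (Y l - U (Suc (wdeg \<alpha>)) l))"
      by (rule wge_diff)
    then show "mfps_coeff (\<Phi> Y l) \<alpha> = mfps_coeff (Y l) \<alpha>" by (simp add: wge_def)
  qed
  then have "\<Phi> Y = Y" by (rule ext)
  then show ?thesis
    using Y1 lim[unfolded U_def] by (intro exI[of _ Y] conjI allI) (simp_all del: wge_0)
qed

text \<open>A monomial of degree at least 2 keeps a spare factor of positive order when the
  difference is telescoped. Monomials of degree 0 and 1 have no such spare factor, so they must
  agree exactly.\<close>

lemma wge_subst_diff:
  fixes F :: "('a::comm_ring_1, 'm::finite) mfps" and g g' :: "'m \<Rightarrow> ('a, 'i::finite option) mfps"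
  assumes g: "\<And>i. wcong s 1 (g i) (g' i)"
    and low: "\<And>\<beta>. mdeg \<beta> \<le> 1 \<Longrightarrow> mfps_coeff F \<beta> \<noteq> 0 \<Longrightarrow> mfps_mono g \<beta> = mfps_mono g' \<beta>"
  shows "wge (s + 2) (mfps_subst F g - mfps_subst F g')"
proof -
  have v: "mfps_vanish g" "mfps_vanish g'"
    using g by (auto simp: mfps_vanish_def wcong_def wge_1_iff)
  show ?thesis unfolding wge_def
  proof (intro allI impI)
    fix \<gamma> :: "'i option \<Rightarrow> nat" assume \<gamma>: "wdeg \<gamma> < s + 2"
    have "mfps_coeff F \<beta> * (mfps_coeff (mfps_mono g \<beta>) \<gamma> - mfps_coeff (mfps_mono g' \<beta>) \<gamma>) = 0" for \<beta>
    proof (cases "mdeg \<beta> \<le> 1")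
      case True
      with low[of \<beta>] show ?thesis by (cases "mfps_coeff F \<beta> = 0") auto
    next
      case False
      have "wge (s + mdeg \<beta>) (mfps_mono g \<beta> - mfps_mono g' \<beta>)"
        using wcong_mono[of s g g', OF g] by (simp add: wcong_def)
      then have "mfps_coeff (mfps_mono g \<beta> - mfps_mono g' \<beta>) \<gamma> = 0"
        unfolding wge_def using False \<gamma> by simp
      then show ?thesis by simp
    qed
    then show "mfps_coeff (mfps_subst F g - mfps_subst F g') \<gamma> = 0"
      unfolding mfps_coeff_diff mfps_coeff_subst[OF v(1) order_refl] mfps_coeff_subst[OF v(2) order_refl]
        sum_subtractf[symmetric] right_diff_distrib[symmetric] by simp
  qed
qed

lemma mfps_bnd_const_mult:
  assumes "mfps_bnd W f B" shows "mfps_bnd W (mfps_const c * f) (norm c * B)"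
  by (rule mfps_bnd_reindex[OF assms, where \<phi> = id and A = UNIV]) (auto simp: norm_mult)

lemma mfps_conv_common:
  fixes H :: "'n::finite \<Rightarrow> (complex, 'i::finite) mfps"
  assumes "\<And>l. mfps_conv (H l)"
  shows "\<exists>r>0. \<exists>C. \<forall>l. mfps_bnd (\<lambda>\<alpha>. r ^ mdeg \<alpha>) (H l) C"
proof -
  have "\<forall>l. \<exists>x. 0 < fst x \<and> mfps_bnd (\<lambda>\<alpha>. fst x ^ mdeg \<alpha>) (H l) (snd x)"
  proof
    fix l
    obtain r B where "0 < r" "mfps_bnd (\<lambda>\<alpha>. r ^ mdeg \<alpha>) (H l) B" by (rule mfps_convE[OF assms])
    then show "\<exists>x. 0 < fst x \<and> mfps_bnd (\<lambda>\<alpha>. fst x ^ mdeg \<alpha>) (H l) (snd x)"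
      by (intro exI[of _ "(r, B)"]) simp
  qed
  from choice[OF this] obtain x where x': "\<forall>l. 0 < fst (x l) \<and> mfps_bnd (\<lambda>\<alpha>. fst (x l) ^ mdeg \<alpha>) (H l) (snd (x l))" ..
  note x = x'[rule_format, THEN conjunct1] x'[rule_format, THEN conjunct2]
  define r where "r = Min (range (\<lambda>l. fst (x l)))"
  define C where "C = Max (range (\<lambda>l. snd (x l)))"
  have "0 < r" unfolding r_def by (subst Min_gr_iff) (auto simp: x)
  moreover have "mfps_bnd (\<lambda>\<alpha>. r ^ mdeg \<alpha>) (H l) C" for l
  proof -
    have "r \<le> fst (x l)" unfolding r_def by (rule Min_le) auto
    moreover have "snd (x l) \<le> C" unfolding C_def by (rule Max_ge) auto
    ultimately show ?thesis
      using mfps_bnd_mono[OF mfps_bnd_power_le[OF x(2)[of l]]] \<open>0 < r\<close> by auto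
  qed
  ultimately show ?thesis by (intro exI[of _ r] conjI exI[of _ C] allI)
qed

lemma sum_UNIV_Plus: "(\<Sum>x\<in>UNIV. f x) = (\<Sum>i\<in>UNIV. f (Inl i)) + (\<Sum>i\<in>UNIV. f (Inr i))"
  for f :: "'a::finite + 'b::finite \<Rightarrow> 'c::comm_monoid_add"
  unfolding UNIV_Plus_UNIV[symmetric] by (subst sum.Plus) auto

lemma prod_UNIV_Plus: "(\<Prod>x\<in>UNIV. f x) = (\<Prod>i\<in>UNIV. f (Inl i)) * (\<Prod>i\<in>UNIV. f (Inr i))"
  for f :: "'a::finite + 'b::finite \<Rightarrow> 'c::comm_monoid_mult"
  unfolding UNIV_Plus_UNIV[symmetric] by (subst prod.Plus) auto

text \<open>Every monomial that occurs contains an \<open>x\<close>-variable or at least two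
  \<open>y\<close>-variables. Shrinking the radii from \<open>r\<close> to \<open>\<rho>\<close> and
  \<open>\<delta>\<close> therefore gains \<open>\<rho> / r\<close> or
  \<open>(\<delta> / r)\<^sup>2\<close>.\<close>

lemma mfps_bnd_small:
  fixes H :: "(complex, 'i::finite + 'n::finite) mfps"
  assumes H: "mfps_bnd (\<lambda>\<alpha>. r ^ mdeg \<alpha>) H C" and H0: "mfps_coeff H (\<lambda>_. 0) = 0"
    and H1: "\<And>m. mfps_coeff H (munit (Inr m)) = 0"
    and le: "0 < \<rho>" "\<rho> \<le> r" "0 < \<delta>" "\<delta> \<le> r"
  shows "mfps_bnd (\<lambda>\<beta>. \<Prod>i\<in>UNIV. (case i of Inl _ \<Rightarrow> \<rho> | Inr _ \<Rightarrow> \<delta>) ^ \<beta> i) H ((\<rho> / r + (\<delta> / r)\<^sup>2) * C)"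
proof (rule mfps_bnd_weight_mono[OF H])
  fix \<beta> :: "'i + 'n \<Rightarrow> nat" assume nz: "mfps_coeff H \<beta> \<noteq> 0"
  define a where "a = (\<Sum>i\<in>UNIV. \<beta> (Inl i))"
  define b where "b = (\<Sum>i\<in>UNIV. \<beta> (Inr i))"
  have ab: "mdeg \<beta> = a + b" by (simp add: mdeg_def a_def b_def sum_UNIV_Plus)
  have e: "(\<Prod>i\<in>UNIV. (case i of Inl _ \<Rightarrow> \<rho> | Inr _ \<Rightarrow> \<delta>) ^ \<beta> i) = \<rho> ^ a * \<delta> ^ b"
    by (simp add: prod_UNIV_Plus a_def b_def power_sum)
  have r: "0 < r" using le by linarith
  consider a' where "a = Suc a'" | b' where "a = 0" "b = Suc (Suc b')"
  proof -
    have "mdeg \<beta> \<noteq> 0" using nz H0 by (auto simp: mdeg_eq_0_iff)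
    have "mdeg \<beta> \<noteq> 1" if "a = 0"
    proof
      assume "mdeg \<beta> = 1"
      then obtain i where i: "\<beta> = munit i" using mdeg_eq_Suc_0_iff[of \<beta>] by auto
      show False
      proof (cases i)
        case (Inl x)
        then have "\<beta> (Inl x) = 1" by (simp add: i)
        moreover have "\<beta> (Inl x) \<le> a" unfolding a_def by (rule member_le_sum) auto
        ultimately show False using \<open>a = 0\<close> by simp
      next
        case (Inr x)
        then show False using nz H1[of x] i by simp
      qed
    qed
    with \<open>mdeg \<beta> \<noteq> 0\<close> have "a \<noteq> 0 \<or> a = 0 \<and> 2 \<le> b" unfolding ab by linarith
    then show ?thesis
      using that(1)[of "a - 1"] that(2)[of "b - 2"] by force
  qed
  then show "(\<Prod>i\<in>UNIV. (case i of Inl _ \<Rightarrow> \<rho> | Inr _ \<Rightarrow> \<delta>) ^ \<beta> i) \<le> (\<rho> / r + (\<delta> / r)\<^sup>2) * r ^ mdeg \<beta>"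
    unfolding e ab
  proof cases
    case 1
    have "\<rho> ^ a * \<delta> ^ b \<le> \<rho> * r ^ a' * r ^ b"
      unfolding 1 using le r by (intro mult_mono power_mono) (auto intro!: mult_mono power_mono)
    also have "\<dots> = \<rho> / r * r ^ (a + b)" unfolding 1 using r by (simp add: power_add)
    also have "\<dots> \<le> (\<rho> / r + (\<delta> / r)\<^sup>2) * r ^ (a + b)" using r by (intro mult_right_mono) auto
    finally show "\<rho> ^ a * \<delta> ^ b \<le> (\<rho> / r + (\<delta> / r)\<^sup>2) * r ^ (a + b)" .
  next
    case 2
    have "\<rho> ^ a * \<delta> ^ b = \<delta>\<^sup>2 * \<delta> ^ b'" unfolding 2 by (simp add: power2_eq_square)
    also have "\<dots> \<le> \<delta>\<^sup>2 * r ^ b'" using le by (intro mult_left_mono power_mono) auto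
    also have "\<dots> = (\<delta> / r)\<^sup>2 * r ^ (a + b)" unfolding 2 using r by (simp add: power2_eq_square)
    also have "\<dots> \<le> (\<rho> / r + (\<delta> / r)\<^sup>2) * r ^ (a + b)" using r le by (intro mult_right_mono) auto
    finally show "\<rho> ^ a * \<delta> ^ b \<le> (\<rho> / r + (\<delta> / r)\<^sup>2) * r ^ (a + b)" .
  qed
qed (use le in \<open>auto intro!: add_nonneg_nonneg divide_nonneg_nonneg\<close>)

text \<open>A finite set of coefficients of \<open>Y\<close> coincides with that of a single,
  sufficiently late \<open>U N\<close>.\<close>

lemma mfps_bnd_limit:
  assumes W: "\<And>n. mfps_bnd W (U n) B" and lim: "\<And>n. wge (Suc n) (Y - U n)"
  shows "mfps_bnd W Y B"
proof (rule mfps_bndI)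
  fix S :: "('a option \<Rightarrow> nat) set" assume S: "finite S"
  define N where "N = (if S = {} then 0 else Max (wdeg ` S))"
  have "mfps_coeff Y \<alpha> = mfps_coeff (U N) \<alpha>" if "\<alpha> \<in> S" for \<alpha>
  proof -
    have "wdeg \<alpha> < Suc N" using that S by (auto simp: N_def less_Suc_eq_le)
    then show ?thesis using lim[of N] by (simp add: wge_def)
  qed
  then have "(\<Sum>\<alpha>\<in>S. norm (mfps_coeff Y \<alpha>) * W \<alpha>) = (\<Sum>\<alpha>\<in>S. norm (mfps_coeff (U N) \<alpha>) * W \<alpha>)"
    by (intro sum.cong) auto
  also have "\<dots> \<le> B" by (rule mfps_bndD[OF W S])
  finally show "(\<Sum>\<alpha>\<in>S. norm (mfps_coeff Y \<alpha>) * W \<alpha>) \<le> B" .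
qed

text \<open>Stated for any map \<open>R\<close> that has a contracting lift \<open>G\<close>, which
  separates the fixed point argument from the differential operators. The lifted \<open>Y\<close>
  comes with its norm bound and describes the one solution.\<close>

theorem formal_fixed_point:
  fixes H :: "'n::finite \<Rightarrow> (complex, 'i::finite + 'n) mfps" and p :: "(complex, 'i) mfps"
    and R :: "(complex, 'i) mfps \<Rightarrow> (complex, 'i) mfps" and B :: "'n \<Rightarrow> 'n \<Rightarrow> complex"
  assumes p0: "mfps_coeff p (\<lambda>_. 0) = 0" and G: "contracting k G"
    and GR: "\<And>Y. mfps_eval p (G Y) = R (mfps_eval p Y)"
    and H: "\<And>l. mfps_conv (H l)" and H0: "\<And>l. mfps_coeff (H l) (\<lambda>_. 0) = 0"
    and H1: "\<And>l m. mfps_coeff (H l) (munit (Inr m)) = 0"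
  shows "\<exists>Y \<rho> \<tau> \<delta>. 0 < \<rho> \<and> 0 < \<tau> \<and> (\<forall>l. mfps_coeff (Y l) (\<lambda>_. 0) = 0) \<and>
    (\<forall>l. mfps_bnd (gwt k \<rho> \<tau>) (Y l) \<delta>) \<and>
    (\<forall>y. (\<forall>l. mfps_coeff (y l) (\<lambda>_. 0) = 0) \<longrightarrow>
      ((\<forall>l. y l = mfps_subst (H l) (case_sum mfps_X y) + (\<Sum>m\<in>UNIV. mfps_const (B l m) * R (y m)))
        \<longleftrightarrow> y = (\<lambda>l. mfps_eval p (Y l))))"
proof -
  define g where "g = (\<lambda>Y :: 'n \<Rightarrow> (complex, 'i option) mfps. case_sum (\<lambda>i. mfps_X (Some i)) Y)"
  define \<Phi> where "\<Phi> = (\<lambda>Y l. mfps_subst (H l) (g Y) + (\<Sum>m\<in>UNIV. mfps_const (B l m) * G (Y m)))"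
  define \<Psi> where "\<Psi> = (\<lambda>y l. mfps_subst (H l) (case_sum mfps_X y) + (\<Sum>m\<in>UNIV. mfps_const (B l m) * R (y m)))"
  have vg: "mfps_vanish (g Y)" if "\<forall>l. wge (Suc 0) (Y l)" for Y
    using that by (auto simp: mfps_vanish_def g_def wge_1_iff mfps_coeff_X_0 split: sum.split)
  have GL: "wge s (\<Sum>m\<in>UNIV. mfps_const (B l m) * X m)" if "\<And>m. wge s (X m)" for s l and X :: "'n \<Rightarrow> (complex, 'i option) mfps"
    using wge_mult[OF wge_0 that] by (intro wge_sum) simp
  have pres: "\<forall>l. wge (Suc 0) (\<Phi> Y l)" if Y: "\<forall>l. wge (Suc 0) (Y l)" for Y
  proof
    fix l
    have "wge (Suc 0) (mfps_subst (H l) (g Y))" by (simp add: wge_1_iff H0)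
    moreover have "wge (Suc 0) (\<Sum>m\<in>UNIV. mfps_const (B l m) * G (Y m))"
      by (intro GL wge_le[OF contracting_wge[OF G wge_0]]) simp
    ultimately show "wge (Suc 0) (\<Phi> Y l)" unfolding \<Phi>_def by (rule wge_add)
  qed
  have contr: "\<forall>l. wge (Suc (Suc s)) (\<Phi> Y l - \<Phi> Z l)"
    if Y: "\<forall>l. wge (Suc 0) (Y l)" and Z: "\<forall>l. wge (Suc 0) (Z l)" and YZ: "\<forall>l. wge (Suc s) (Y l - Z l)" for s Y Z
  proof
    fix l
    have "wge (s + 2) (mfps_subst (H l) (g Y) - mfps_subst (H l) (g Z))"
    proof (rule wge_subst_diff)
      fix x
      show "wcong s 1 (g Y x) (g Z x)"
        using Y Z YZ by (cases x) (auto simp: wcong_def g_def wge_1_iff mfps_coeff_X_0)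
    next
      fix \<beta> :: "'i + 'n \<Rightarrow> nat" assume "mdeg \<beta> \<le> 1" and nz: "mfps_coeff (H l) \<beta> \<noteq> 0"
      then consider "mdeg \<beta> = 0" | "mdeg \<beta> = Suc 0" by linarith
      then show "mfps_mono (g Y) \<beta> = mfps_mono (g Z) \<beta>"
      proof cases
        case 2
        then obtain x where x: "\<beta> = munit x" unfolding mdeg_eq_Suc_0_iff by (elim exE)
        show ?thesis
        proof (cases x)
          case (Inl i)
          show ?thesis unfolding x mfps_mono_munit by (simp add: g_def Inl)
        next
          case (Inr m)
          show ?thesis using nz H1[of l m] unfolding x Inr by (elim notE)
        qed
      qed (simp add: mdeg_eq_0_iff)
    qed
    moreover have "wge (s + 2) (\<Sum>m\<in>UNIV. mfps_const (B l m) * (G (Y m) - G (Z m)))"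
      using contracting_wge[OF G YZ[rule_format]] by (intro GL) (simp add: contracting_diff[OF G])
    ultimately have "wge (s + 2) (mfps_subst (H l) (g Y) - mfps_subst (H l) (g Z)
        + (\<Sum>m\<in>UNIV. mfps_const (B l m) * (G (Y m) - G (Z m))))"
      by (rule wge_add)
    then show "wge (Suc (Suc s)) (\<Phi> Y l - \<Phi> Z l)"
      by (simp add: \<Phi>_def right_diff_distrib sum_subtractf algebra_simps)
  qed
  have \<Phi>: "wcontraction \<Phi>"
    unfolding wcontraction_def by (intro conjI allI impI pres[rule_format] contr[rule_format]) blast+
  obtain Y where Y: "\<forall>l. wge (Suc 0) (Y l)" and fp: "\<Phi> Y = Y"
    and lim: "\<forall>n l. wge (Suc n) (Y l - (\<Phi> ^^ n) (\<lambda>_. 0) l)"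
    using wge_fixed_point[OF \<Phi>] by (elim exE conjE)

  have eval: "mfps_eval p (\<Phi> Z l) = \<Psi> (\<lambda>l. mfps_eval p (Z l)) l" if Z: "\<forall>l. wge (Suc 0) (Z l)" for Z l
  proof -
    have "mfps_eval p (mfps_subst (H l) (g Z)) = mfps_subst (H l) (\<lambda>x. mfps_eval p (g Z x))"
      unfolding mfps_eval_def by (rule mfps_subst_subst[OF vg[OF Z] mfps_vanish_case[OF p0]])
    also have "(\<lambda>x. mfps_eval p (g Z x)) = case_sum mfps_X (\<lambda>l. mfps_eval p (Z l))"
      by (rule ext) (simp add: g_def mfps_eval_X_Some[OF p0] split: sum.split)
    finally show ?thesis
      by (simp add: \<Phi>_def \<Psi>_def mfps_eval_add mfps_eval_sum mfps_eval_mult[OF p0] mfps_eval_const GR)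
  qed
  have ex: "\<Psi> (\<lambda>l. mfps_eval p (Y l)) l = mfps_eval p (Y l)" for l
    using eval[OF Y, of l] unfolding fp by simp
  have uniq: "y = (\<lambda>l. mfps_eval p (Y l))" if y0: "\<forall>l. mfps_coeff (y l) (\<lambda>_. 0) = 0" and y: "\<forall>l. y l = \<Psi> y l" for y
  proof (rule ext)
    fix l
    \<comment> \<open>\<open>Z\<close> need not be near a fixed point of \<open>\<Phi>\<close>, but
      evaluation turns \<open>\<Phi>\<close> into \<open>\<Psi>\<close>, so every iterate of
      \<open>Z\<close> still evaluates to \<open>y\<close>.\<close>
    define Z where "Z = (\<lambda>l. mfps_lift (y l))"
    have Z: "\<forall>l. wge (Suc 0) (Z l)" using y0 by (simp add: Z_def wge_1_iff mfps_lift_def)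
    have EZ: "(\<lambda>l. mfps_eval p ((\<Phi> ^^ n) Z l)) = y" for n
    proof (induction n)
      case 0
      show ?case by (simp add: Z_def mfps_eval_lift[OF p0])
    next
      case (Suc n)
      have Zn: "\<forall>l. wge (Suc 0) ((\<Phi> ^^ n) Z l)" by (rule wge_iterate_pres[OF \<Phi> Z])
      have "mfps_eval p ((\<Phi> ^^ Suc n) Z l) = y l" for l
        using eval[OF Zn, of l] unfolding Suc using y by simp
      then show ?case by (rule ext)
    qed
    have Yn: "(\<Phi> ^^ n) Y = Y" for n by (induction n) (simp_all add: fp)
    show "y l = mfps_eval p (Y l)"
    proof (rule mfps_eqI)
      fix \<gamma> :: "'i \<Rightarrow> nat"
      \<comment> \<open>The factor 2 compensates the loss in \<open>mfps_eval_wge\<close>: order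
        \<open>Suc n\<close> exceeds \<open>2 * mdeg \<gamma>\<close>.\<close>
      define n where "n = 2 * mdeg \<gamma>"
      have "wge (Suc n) ((\<Phi> ^^ n) Z l - (\<Phi> ^^ n) Y l)"
        using wge_iterate_contr[OF \<Phi> Z Y] by blast
      then have "mfps_coeff (mfps_eval p ((\<Phi> ^^ n) Z l - (\<Phi> ^^ n) Y l)) \<gamma> = 0"
        by (rule mfps_eval_wge[OF p0]) (simp add: n_def)
      then show "mfps_coeff (y l) \<gamma> = mfps_coeff (mfps_eval p (Y l)) \<gamma>"
        using fun_cong[OF EZ, of n l] by (simp add: mfps_eval_diff Yn)
    qed
  qed

  obtain r0 where r0: "0 < r0" "\<forall>\<rho>. 0 < \<rho> \<longrightarrow> \<rho> \<le> r0 \<longrightarrow> (\<exists>C. gwt_bounded k \<rho> C G)"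
    using contracting_bounded[OF G] by (elim exE conjE)
  obtain r C' where r: "0 < r" and C': "\<forall>l. mfps_bnd (\<lambda>\<alpha>. r ^ mdeg \<alpha>) (H l) C'"
    using mfps_conv_common[of H, OF H] by (elim exE conjE)
  define C where "C = max C' 1"
  have C: "1 \<le> C" "mfps_bnd (\<lambda>\<alpha>. r ^ mdeg \<alpha>) (H l) C" for l
    using mfps_bnd_mono[OF C'[rule_format, of l], of C] by (auto simp: C_def)
  \<comment> \<open>The bound on \<open>\<delta>\<close> makes the part of \<open>H\<close> at least
    quadratic in \<open>y\<close> contribute at most \<open>\<delta> / 4\<close>. Then
    \<open>\<rho>\<close> is chosen in terms of \<open>\<delta>\<close> so that the part containing
    \<open>x\<close> also stays below \<open>\<delta> / 4\<close>.\<close>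
  define \<delta> where "\<delta> = min r (r\<^sup>2 / (4 * C))"
  define \<rho> where "\<rho> = min r0 (min r (\<delta> * r / (4 * C)))"
  have \<delta>: "0 < \<delta>" "\<delta> \<le> r" "\<delta> \<le> r\<^sup>2 / (4 * C)" using r C(1) by (auto simp: \<delta>_def)
  have \<rho>: "0 < \<rho>" "\<rho> \<le> r0" "\<rho> \<le> r" "\<rho> \<le> \<delta> * r / (4 * C)" using r r0 \<delta> C(1) by (auto simp: \<rho>_def)
  have small: "(\<rho> / r + (\<delta> / r)\<^sup>2) * C \<le> \<delta> / 2"
  proof -
    have "\<rho> / r * C \<le> \<delta> / 4" using \<rho>(4) r C(1) by (simp add: field_simps)
    moreover have "(\<delta> / r)\<^sup>2 * C \<le> \<delta> / 4"
    proof -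
      have "(\<delta> / r)\<^sup>2 * C = \<delta> * \<delta> * (C / r\<^sup>2)" by (simp add: power2_eq_square)
      also have "\<dots> \<le> \<delta> * (r\<^sup>2 / (4 * C)) * (C / r\<^sup>2)" using \<delta> C(1) by (intro mult_right_mono mult_left_mono) auto
      also have "\<dots> = \<delta> / 4" using r C(1) by (simp add: field_simps)
      finally show ?thesis .
    qed
    ultimately show ?thesis unfolding distrib_right by linarith
  qed
  obtain D where DG: "gwt_bounded k \<rho> D G" using r0(2)[rule_format, OF \<rho>(1,2)] ..
  note D = gwt_boundedD(1)[OF DG]
  \<comment> \<open>A common bound for the row sums of \<open>B\<close>; the added 1 keeps it
    positive.\<close>
  define K where "K = 1 + (\<Sum>l\<in>UNIV. \<Sum>m\<in>UNIV. norm (B l m))"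
  have K: "1 \<le> K" "(\<Sum>m\<in>UNIV. norm (B l m)) \<le> K" for l
  proof -
    show "1 \<le> K" unfolding K_def by (simp add: sum_nonneg)
    have "(\<Sum>m\<in>UNIV. norm (B l m)) \<le> (\<Sum>l\<in>UNIV. \<Sum>m\<in>UNIV. norm (B l m))"
      by (rule member_le_sum[of l UNIV "\<lambda>l. \<Sum>m\<in>UNIV. norm (B l m)"]) (auto intro: sum_nonneg)
    then show "(\<Sum>m\<in>UNIV. norm (B l m)) \<le> K" by (simp add: K_def)
  qed
  \<comment> \<open>Leaves the second half \<open>\<delta> / 2\<close> of the ball to the operator
    part. \<open>D + 1\<close> avoids dividing by zero and forces
    \<open>\<tau> \<le> 1\<close>.\<close>
  define \<tau> where "\<tau> = 1 / (2 * (D + 1) * K)"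
  have \<tau>: "0 < \<tau>" "\<tau> \<le> 1" "K * (D * \<tau> * \<delta>) \<le> \<delta> / 2"
  proof -
    show "0 < \<tau>" using D K(1) by (simp add: \<tau>_def)
    have "1 \<le> 2 * (D + 1) * K" using D K(1) mult_mono[of 1 "2 * (D + 1)" 1 K] by simp
    then show "\<tau> \<le> 1" by (simp add: \<tau>_def)
    have "K * D * (1 / (2 * E * K)) = D / E / 2" if "E \<noteq> 0" for E
      using that K(1) by (simp add: field_simps)
    from this[of "D + 1"] have "K * D * \<tau> = D / (D + 1) / 2" unfolding \<tau>_def using D by simp
    also have "\<dots> \<le> 1 / 2" using D by simp
    finally have "K * D * \<tau> * \<delta> \<le> 1 / 2 * \<delta>" using \<delta> by (intro mult_right_mono) auto
    then show "K * (D * \<tau> * \<delta>) \<le> \<delta> / 2" by (simp add: mult.assoc)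
  qed
  have W: "submult (gwt k \<rho> \<tau> :: ('i option \<Rightarrow> nat) \<Rightarrow> real)" using \<rho>(1) \<tau>(1) by (intro submult_gwt) auto
  have ball: "mfps_bnd (gwt k \<rho> \<tau>) (\<Phi> Z l) \<delta>" if Z: "\<forall>l. wge (Suc 0) (Z l)" and bZ: "\<forall>l. mfps_bnd (gwt k \<rho> \<tau>) (Z l) \<delta>" for Z l
  proof -
    have "mfps_bnd (gwt k \<rho> \<tau>) (mfps_subst (H l) (g Z)) (\<delta> / 2)"
    proof (rule mfps_bnd_subst[OF W vg[OF Z]])
      show "mfps_bnd (gwt k \<rho> \<tau>) (g Z x) (case x of Inl _ \<Rightarrow> \<rho> | Inr _ \<Rightarrow> \<delta>)" for x
        using bZ mfps_bnd_gwt_X[of \<rho> \<tau> k] \<rho>(1) \<tau>(1) by (cases x) (simp_all add: g_def)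
      show "mfps_bnd (\<lambda>\<beta>. \<Prod>i\<in>UNIV. (case i of Inl _ \<Rightarrow> \<rho> | Inr _ \<Rightarrow> \<delta>) ^ \<beta> i) (H l) (\<delta> / 2)"
        by (rule mfps_bnd_mono[OF mfps_bnd_small[OF C(2) H0 H1 \<rho>(1,3) \<delta>(1,2)] small])
    qed
    moreover have "mfps_bnd (gwt k \<rho> \<tau>) (\<Sum>m\<in>UNIV. mfps_const (B l m) * G (Z m)) (\<delta> / 2)"
    proof (rule mfps_bnd_mono)
      show "mfps_bnd (gwt k \<rho> \<tau>) (\<Sum>m\<in>UNIV. mfps_const (B l m) * G (Z m)) (\<Sum>m\<in>UNIV. norm (B l m) * (D * \<tau> * \<delta>))"
        by (intro mfps_bnd_sum[OF W] mfps_bnd_const_mult gwt_boundedD(2)[OF DG] \<tau>(1,2) bZ[rule_format])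
      have "(\<Sum>m\<in>UNIV. norm (B l m) * (D * \<tau> * \<delta>)) \<le> K * (D * \<tau> * \<delta>)"
        unfolding sum_distrib_right[symmetric] using D \<tau>(1) \<delta>(1) by (intro mult_right_mono K(2)) auto
      with \<tau>(3) show "(\<Sum>m\<in>UNIV. norm (B l m) * (D * \<tau> * \<delta>)) \<le> \<delta> / 2" by linarith
    qed
    ultimately have "mfps_bnd (gwt k \<rho> \<tau>) (\<Phi> Z l) (\<delta> / 2 + \<delta> / 2)"
      unfolding \<Phi>_def by (rule mfps_bnd_add[OF W])
    then show ?thesis by simp
  qed
  have z: "\<forall>l. wge (Suc 0) ((\<lambda>_. 0) l :: (complex, 'i option) mfps)" by simp
  have Un: "\<forall>l. mfps_bnd (gwt k \<rho> \<tau>) ((\<Phi> ^^ n) (\<lambda>_. 0) l) \<delta>" for n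
  proof (induction n)
    case 0
    show ?case using mfps_bnd_mono[OF mfps_bnd_0] \<delta>(1) by (auto intro: less_imp_le)
  next
    case (Suc n)
    show ?case using ball[OF wge_iterate_pres[OF \<Phi> z] Suc] by simp
  qed
  have YB: "mfps_bnd (gwt k \<rho> \<tau>) (Y l) \<delta>" for l
    by (rule mfps_bnd_limit[OF Un[rule_format] lim[rule_format]])
  have iff: "(\<forall>l. y l = \<Psi> y l) \<longleftrightarrow> y = (\<lambda>l. mfps_eval p (Y l))" if y0: "\<forall>l. mfps_coeff (y l) (\<lambda>_. 0) = 0" for y
  proof
    assume e: "y = (\<lambda>l. mfps_eval p (Y l))"
    show "\<forall>l. y l = \<Psi> y l" unfolding e by (intro allI ex[symmetric])
  qed (rule uniq[OF y0])
  have Y0: "\<forall>l. mfps_coeff (Y l) (\<lambda>_. 0) = 0" using Y unfolding wge_1_iff .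
  show ?thesis
    by (rule exI[of _ Y], rule exI[of _ \<rho>], rule exI[of _ \<tau>], rule exI[of _ \<delta>], intro conjI \<rho>(1) \<tau>(1) Y0)
       (intro allI YB, intro allI impI, rule iff[unfolded \<Psi>_def])
qed

subsection \<open>Separately holomorphic functions\<close>

text \<open>By Osgood's lemma this is again holomorphy in several variables. In this form it passes
  to partial derivatives by one-variable arguments on slices.\<close>

definition sepholo :: "(complex ^ 'i::finite \<Rightarrow> complex) \<Rightarrow> (complex ^ 'i) set \<Rightarrow> bool" where
  "sepholo f U \<longleftrightarrow> open U \<and> continuous_on U f \<and>
     (\<forall>x\<in>U. \<forall>i. (\<lambda>z. f (x + axis i z)) holomorphic_on {z. x + axis i z \<in> U})"

lemma axis_add: "axis i (a + b) = axis i a + (axis i b :: complex ^ 'i)"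
  by (simp add: vec_eq_iff axis_def)

lemma axis_0 [simp]: "axis i 0 = (0 :: complex ^ 'i)"
  by (simp add: vec_eq_iff axis_def)

lemma norm_axis_complex [simp]: "norm (axis i z :: complex ^ 'i::finite) = norm z"
proof -
  have "norm (axis i z :: complex ^ 'i) = L2_set (\<lambda>j. if j = i then norm z else 0) UNIV"
    unfolding norm_vec_def by (intro L2_set_cong) (auto simp: axis_def)
  also have "\<dots> = norm z" by (simp add: L2_set_def if_distrib[of "\<lambda>x. x\<^sup>2"] cong: if_cong)
  finally show ?thesis .
qed

lemma bounded_linear_axis: "bounded_linear (axis i :: complex \<Rightarrow> complex ^ 'i::finite)"
proof (rule bounded_linear_intro[where K = 1])
  show "axis i (r *\<^sub>R z) = r *\<^sub>R (axis i z :: complex ^ 'i)" for r z by (simp add: vec_eq_iff axis_def)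
qed (simp_all add: axis_add)

lemmas continuous_on_axis [continuous_intros] = bounded_linear.continuous_on[OF bounded_linear_axis]

lemma open_slice: "open U \<Longrightarrow> open {z. x + axis i z \<in> U}" for x :: "complex ^ 'i::finite"
proof -
  assume "open U"
  moreover have "continuous_on UNIV (\<lambda>z. x + axis i z)" by (intro continuous_intros)
  ultimately show ?thesis using continuous_open_vimage[of U "\<lambda>z. x + axis i z"]
    by (simp add: vimage_def continuous_on_eq_continuous_at)
qed

lemma sepholo_subset:
  assumes "sepholo f U" "open V" "V \<subseteq> U" shows "sepholo f V"
  unfolding sepholo_def
proof (intro conjI ballI allI)
  show "continuous_on V f" using assms continuous_on_subset by (auto simp: sepholo_def)
  fix x i assume "x \<in> V"
  then have "(\<lambda>z. f (x + axis i z)) holomorphic_on {z. x + axis i z \<in> U}"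
    using assms by (auto simp: sepholo_def)
  then show "(\<lambda>z. f (x + axis i z)) holomorphic_on {z. x + axis i z \<in> V}"
    by (rule holomorphic_on_subset) (use assms in auto)
qed (rule assms)

lemma sepholo_open: "sepholo f U \<Longrightarrow> open U"
  by (simp add: sepholo_def)

lemma sepholo_cont: "sepholo f U \<Longrightarrow> continuous_on U f"
  by (simp add: sepholo_def)

lemma sepholo_slice: "sepholo f U \<Longrightarrow> x \<in> U \<Longrightarrow> S \<subseteq> {z. x + axis i z \<in> U} \<Longrightarrow> (\<lambda>z. f (x + axis i z)) holomorphic_on S"
  unfolding sepholo_def by (blast intro: holomorphic_on_subset)

lemma sepholo_differentiable:
  assumes "sepholo f U" "x \<in> U"
  shows "(\<lambda>z. f (x + axis i z)) field_differentiable (at 0)"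
proof (rule holomorphic_on_imp_differentiable_at)
  show "(\<lambda>z. f (x + axis i z)) holomorphic_on {z. x + axis i z \<in> U}"
    using assms by (rule sepholo_slice) simp
qed (use assms open_slice[OF sepholo_open] in auto)

lemma mholomorphic_on_derivative:
  fixes f :: "complex ^ 'i::finite \<Rightarrow> complex"
  assumes D: "(f has_derivative D) (at (x + axis i z))" and lin: "\<And>c v. D (c *s v) = c * D v"
  shows "((\<lambda>z. f (x + axis i z)) has_field_derivative D (axis i 1)) (at z)"
proof -
  have "((\<lambda>z. x + axis i z) has_derivative (\<lambda>h. 0 + axis i h)) (at z)"
    by (intro has_derivative_add has_derivative_const bounded_linear_imp_has_derivative bounded_linear_axis)
  from diff_chain_at[OF this] D have "((\<lambda>z. f (x + axis i z)) has_derivative (\<lambda>h. D (axis i h))) (at z)"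
    by (simp add: o_def)
  moreover have "D (axis i h) = D (axis i 1) * h" for h
  proof -
    have "axis i h = h *s (axis i 1 :: complex ^ 'i)" by (simp add: vec_eq_iff axis_def)
    then show ?thesis by (simp add: lin)
  qed
  then have "(\<lambda>h. D (axis i h)) = (*) (D (axis i 1))" by (rule ext)
  ultimately show ?thesis by (simp only: has_field_derivative_def)
qed

lemma mholomorphic_imp_sepholo:
  assumes "mholomorphic_on f U" shows "sepholo f U"
  unfolding sepholo_def
proof (intro conjI ballI allI)
  show "open U" using assms by (simp add: mholomorphic_on_def)
  show "continuous_on U f"
    using assms unfolding mholomorphic_on_def
    by (intro continuous_at_imp_continuous_on ballI) (blast intro: has_derivative_continuous)
  fix x i
  show "(\<lambda>z. f (x + axis i z)) holomorphic_on {z. x + axis i z \<in> U}"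
    unfolding holomorphic_on_def
  proof
    fix z assume "z \<in> {z. x + axis i z \<in> U}"
    then obtain D where "(f has_derivative D) (at (x + axis i z))" "\<And>c v. D (c *s v) = c * D v"
      using assms unfolding mholomorphic_on_def by blast
    from mholomorphic_on_derivative[OF this]
    show "(\<lambda>z. f (x + axis i z)) field_differentiable at z within {z. x + axis i z \<in> U}"
      by (meson field_differentiable_at_within field_differentiable_def)
  qed
qed

text \<open>First-order Taylor expansion along a slice, with the second derivative bounded by
  Cauchy's inequality. The point is that \<open>e\<close> and \<open>C\<close> serve all
  \<open>x\<close> near \<open>x0\<close> at once.\<close>

lemma cpartial_quotient_bound:
  fixes f :: "complex ^ 'i::finite \<Rightarrow> complex"
  assumes f: "sepholo f U" and x0: "x0 \<in> U"
  shows "\<exists>e>0. \<exists>C. ball x0 e \<subseteq> U \<and> (\<forall>x\<in>ball x0 e. \<forall>h. 0 < norm h \<longrightarrow> norm h < e \<longrightarrow>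
    x + axis i h \<in> U \<and> norm ((f (x + axis i h) - f x) / h - cpartial i f x) \<le> C * norm h)"
proof -
  obtain e' where e': "0 < e'" "cball x0 e' \<subseteq> U"
    using sepholo_open[OF f] x0 by (meson open_contains_cball)
  \<comment> \<open>One third each for the distance of \<open>x\<close> from \<open>x0\<close>, the
    increment along the slice, and the radius in Cauchy's inequality.\<close>
  define e where "e = e' / 3"
  have e: "0 < e" "cball x0 (3 * e) \<subseteq> U" using e' by (auto simp: e_def)
  have "compact (f ` cball x0 (3 * e))"
    by (intro compact_continuous_image continuous_on_subset[OF sepholo_cont[OF f] e(2)]) auto
  then have "bounded (f ` cball x0 (3 * e))" by (rule compact_imp_bounded)
  then obtain M where "\<forall>y\<in>f ` cball x0 (3 * e). norm y \<le> M" unfolding bounded_iff by (elim exE)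
  then have M: "norm (f y) \<le> M" if "y \<in> cball x0 (3 * e)" for y using that by simp
  have "x + axis i h \<in> U \<and> norm ((f (x + axis i h) - f x) / h - cpartial i f x) \<le> 2 * M / e ^ 2 * norm h"
    if x: "x \<in> ball x0 e" and h: "0 < norm h" "norm h < e" for x h
  proof -
    define \<phi> where "\<phi> = (\<lambda>z. f (x + axis i z))"
    have in3: "x + axis i z \<in> cball x0 (3 * e)" if "norm z \<le> 2 * e" for z
    proof -
      have "dist x0 (x + axis i z) \<le> dist x0 x + dist x (x + axis i z)" by (rule dist_triangle)
      moreover have "dist x (x + axis i z) = norm z" by (simp add: dist_norm)
      moreover have "dist x0 x < e" using x by simp
      ultimately show ?thesis using that by simp
    qed
    have hol: "\<phi> holomorphic_on ball 0 (2 * e)"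
      unfolding \<phi>_def
    proof (rule sepholo_slice[OF f])
      show "x \<in> U" using in3[of 0] e by auto
      show "ball 0 (2 * e) \<subseteq> {z. x + axis i z \<in> U}" using in3 e(2) by fastforce
    qed
    have d2: "norm ((deriv ^^ 2) \<phi> w) \<le> 2 * M / e ^ 2" if w: "w \<in> ball 0 e" for w
    proof -
      have sub: "cball w e \<subseteq> ball 0 (2 * e)"
      proof
        fix z assume "z \<in> cball w e"
        then have "norm (z - w) \<le> e" by (simp add: dist_norm norm_minus_commute)
        moreover have "norm z \<le> norm w + norm (z - w)" using norm_triangle_ineq[of w "z - w"] by simp
        ultimately show "z \<in> ball 0 (2 * e)" using w by simp
      qed
      have "norm ((deriv ^^ 2) \<phi> w) \<le> fact 2 * M / e ^ 2"
      proof (rule Cauchy_inequality)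
        show "\<phi> holomorphic_on ball w e" by (rule holomorphic_on_subset[OF hol order_trans[OF ball_subset_cball sub]])
        show "continuous_on (cball w e) \<phi>" by (rule holomorphic_on_imp_continuous_on[OF holomorphic_on_subset[OF hol sub]])
        fix z assume "norm (w - z) = e"
        then have "z \<in> cball w e" by (simp add: dist_norm)
        from subsetD[OF sub this] have "norm z \<le> 2 * e" by simp
        then show "norm (\<phi> z) \<le> M" unfolding \<phi>_def by (intro M in3)
      qed (use e in auto)
      then show ?thesis by (simp add: fact_numeral)
    qed
    have "norm ((deriv ^^ 0) \<phi> h - (\<Sum>i\<le>1. (deriv ^^ i) \<phi> 0 * (h - 0) ^ i / fact i)) \<le> (2 * M / e ^ 2) * norm (h - 0) ^ Suc 1 / fact 1"
    proof (rule complex_Taylor[where S = "ball 0 e"])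
      fix j z assume z: "z \<in> ball (0::complex) e"
      have "((deriv ^^ j) \<phi> has_field_derivative deriv ((deriv ^^ j) \<phi>) z) (at z)"
        using z e by (intro holomorphic_derivI[OF holomorphic_higher_deriv[OF hol]]) auto
      then show "((deriv ^^ j) \<phi> has_field_derivative (deriv ^^ Suc j) \<phi> z) (at z within ball 0 e)"
        by (simp add: has_field_derivative_at_within)
    next
      fix z assume "z \<in> ball (0::complex) e"
      from d2[OF this] show "norm ((deriv ^^ Suc 1) \<phi> z) \<le> 2 * M / e ^ 2" by (simp add: numeral_2_eq_2)
    qed (simp_all add: e(1) h(2))
    then have T: "norm (\<phi> h - \<phi> 0 - deriv \<phi> 0 * h) \<le> 2 * M / e ^ 2 * norm h ^ 2"
      by (simp add: power2_eq_square diff_diff_eq)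
    have "(\<phi> h - \<phi> 0) / h - deriv \<phi> 0 = (\<phi> h - \<phi> 0 - deriv \<phi> 0 * h) / h"
      using h by (auto simp: field_simps)
    then have "norm ((\<phi> h - \<phi> 0) / h - deriv \<phi> 0) \<le> 2 * M / e ^ 2 * norm h ^ 2 / norm h"
      using divide_right_mono[OF T norm_ge_zero[of h]] by (simp only: norm_divide)
    also have "\<dots> = 2 * M / e ^ 2 * norm h" using h by (simp add: power2_eq_square)
    finally have "norm ((f (x + axis i h) - f x) / h - cpartial i f x) \<le> 2 * M / e ^ 2 * norm h"
      unfolding cpartial_def \<phi>_def by simp
    moreover have "x + axis i h \<in> U" using in3[of h] h e by auto
    ultimately show ?thesis by blast
  qed
  moreover have "ball x0 e \<subseteq> U" using e ball_subset_cball[of x0 "3 * e"] by (auto simp: subset_iff)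
  ultimately show ?thesis using e(1) by blast
qed

text \<open>Writes the partial derivative as a locally uniform limit of difference quotients, from
  which it inherits continuity and holomorphy.\<close>

lemma cpartial_uniform_limit:
  fixes f :: "complex ^ 'i::finite \<Rightarrow> complex"
  assumes f: "sepholo f U" and x0: "x0 \<in> U"
  shows "\<exists>e h. 0 < e \<and> ball x0 e \<subseteq> U \<and> (\<forall>n. h n \<noteq> (0::complex)) \<and> h \<longlonglongrightarrow> 0 \<and>
    (\<forall>n. \<forall>x\<in>ball x0 e. x + axis i (h n) \<in> U) \<and>
    uniform_limit (ball x0 e) (\<lambda>n x. (f (x + axis i (h n)) - f x) / h n) (cpartial i f) sequentially"
proof -
  from cpartial_quotient_bound[OF assms] obtain e C where e: "0 < e" "ball x0 e \<subseteq> U"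
    and C: "\<And>x h. x \<in> ball x0 e \<Longrightarrow> 0 < norm h \<Longrightarrow> norm h < e \<Longrightarrow>
      x + axis i h \<in> U \<and> norm ((f (x + axis i h) - f x) / h - cpartial i f x) \<le> C * norm h"
    by blast
  \<comment> \<open>The shift by 2 keeps the increments below \<open>e\<close> from
    \<open>n = 0\<close> on.\<close>
  define h where "h = (\<lambda>n. complex_of_real (e / real (n + 2)))"
  have h: "0 < norm (h n)" "norm (h n) < e" for n
  proof -
    have "norm (h n) = e / real (n + 2)" unfolding h_def norm_of_real using e(1) by simp
    moreover have "e / real (n + 2) < e / 1" using e(1) by (intro divide_strict_left_mono) auto
    ultimately show "0 < norm (h n)" "norm (h n) < e" using e(1) by auto
  qed
  have h0: "h \<longlonglongrightarrow> 0"
  proof -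
    have "(\<lambda>n. e / real (n + 2)) \<longlonglongrightarrow> 0"
      by (rule LIMSEQ_ignore_initial_segment[OF lim_const_over_n])
    then show ?thesis unfolding h_def by (metis of_real_0 tendsto_of_real)
  qed
  have "uniform_limit (ball x0 e) (\<lambda>n x. (f (x + axis i (h n)) - f x) / h n) (cpartial i f) sequentially"
  proof (rule uniform_limitI)
    fix d :: real assume d: "0 < d"
    have "(\<lambda>n. C * norm (h n)) \<longlonglongrightarrow> C * norm (0 :: complex)" by (intro tendsto_intros h0)
    then have "\<forall>\<^sub>F n in sequentially. C * norm (h n) < d" using d by (intro order_tendstoD(2)[where y = "C * norm (0::complex)"]) auto
    then show "\<forall>\<^sub>F n in sequentially. \<forall>x\<in>ball x0 e. dist ((f (x + axis i (h n)) - f x) / h n) (cpartial i f x) < d"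
    proof eventually_elim
      case (elim n)
      show ?case
      proof
        fix x assume "x \<in> ball x0 e"
        from C[OF this h[of n]] elim show "dist ((f (x + axis i (h n)) - f x) / h n) (cpartial i f x) < d"
          by (simp add: dist_norm)
      qed
    qed
  qed
  moreover have "x + axis i (h n) \<in> U" if "x \<in> ball x0 e" for n x using C[OF that h] by blast
  moreover have "h n \<noteq> 0" for n using h(1)[of n] by auto
  ultimately show ?thesis
    by (intro exI[of _ e] exI[of _ h] conjI allI ballI e h0)
qed

text \<open>Restricted to direction \<open>j\<close> the difference quotients are holomorphic in one
  variable, so Weierstrass' theorem on limits applies. This serves both the holomorphy of partial
  derivatives and their commutation.\<close>

lemma cpartial_slice_uniform_limit:
  fixes f :: "complex ^ 'i::finite \<Rightarrow> complex"
  assumes f: "sepholo f U" and x: "x \<in> U"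
  shows "\<exists>e h. 0 < e \<and> (\<forall>n. h n \<noteq> (0::complex)) \<and> h \<longlonglongrightarrow> 0 \<and> (\<forall>n. x + axis i (h n) \<in> U) \<and>
    (\<forall>n. (\<lambda>w. (f (x + axis i (h n) + axis j w) - f (x + axis j w)) / h n) holomorphic_on ball 0 e) \<and>
    uniform_limit (ball 0 e) (\<lambda>n w. (f (x + axis i (h n) + axis j w) - f (x + axis j w)) / h n)
      (\<lambda>w. cpartial i f (x + axis j w)) sequentially"
proof -
  obtain e h where e: "0 < e" "ball x e \<subseteq> U" "\<forall>n. h n \<noteq> (0::complex)" "h \<longlonglongrightarrow> 0"
      "\<forall>n. \<forall>y\<in>ball x e. y + axis i (h n) \<in> U"
      "uniform_limit (ball x e) (\<lambda>n x. (f (x + axis i (h n)) - f x) / h n) (cpartial i f) sequentially"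
    using cpartial_uniform_limit[OF f x, of i] by (elim exE conjE)
  have inb: "x + axis j w \<in> ball x e" if "w \<in> ball 0 e" for w
    using that by (simp add: dist_norm)
  have xh: "x + axis i (h n) \<in> U" for n using e by simp
  have s: "x + axis j w + axis i (h n) = x + axis i (h n) + axis j w" for w n by (simp add: add_ac)
  have hol: "(\<lambda>w. (f (x + axis i (h n) + axis j w) - f (x + axis j w)) / h n) holomorphic_on ball 0 e" for n
  proof (intro holomorphic_intros sepholo_slice[OF f xh] sepholo_slice[OF f x])
    show "ball 0 e \<subseteq> {w. x + axis i (h n) + axis j w \<in> U}"
      using e(5)[rule_format, OF inb, of _ n] unfolding s by auto
    show "ball 0 e \<subseteq> {w. x + axis j w \<in> U}" using inb e(2) by auto
  qed (use e in simp)
  have "uniform_limit (ball 0 e) (\<lambda>n w. (f (x + axis i (h n) + axis j w) - f (x + axis j w)) / h n)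
      (\<lambda>w. cpartial i f (x + axis j w)) sequentially"
  proof (rule uniform_limitI)
    fix d :: real assume "0 < d"
    from uniform_limitD[OF e(6) this]
    show "\<forall>\<^sub>F n in sequentially. \<forall>w\<in>ball 0 e.
        dist ((f (x + axis i (h n) + axis j w) - f (x + axis j w)) / h n) (cpartial i f (x + axis j w)) < d"
      by eventually_elim (use inb in \<open>auto simp flip: s\<close>)
  qed
  then show ?thesis
    by (intro exI[of _ e] exI[of _ h] conjI allI e(1,4) e(3)[rule_format] xh hol)
qed

lemma sepholo_cpartial:
  fixes f :: "complex ^ 'i::finite \<Rightarrow> complex"
  assumes f: "sepholo f U" shows "sepholo (cpartial i f) U"
  unfolding sepholo_def
proof (intro conjI ballI allI)
  show U: "open U" by (rule sepholo_open[OF f])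
  show "continuous_on U (cpartial i f)"
  proof (rule continuous_at_imp_continuous_on, rule ballI)
    fix x0 assume x0: "x0 \<in> U"
    obtain e h where e: "0 < e" "ball x0 e \<subseteq> U" "\<forall>n. h n \<noteq> (0::complex)" "h \<longlonglongrightarrow> 0"
      "\<forall>n. \<forall>x\<in>ball x0 e. x + axis i (h n) \<in> U"
      "uniform_limit (ball x0 e) (\<lambda>n x. (f (x + axis i (h n)) - f x) / h n) (cpartial i f) sequentially"
      using cpartial_uniform_limit[OF f x0, of i] by (elim exE conjE)
    have "continuous_on (ball x0 e) (cpartial i f)"
    proof (rule uniform_limit_theorem[OF _ e(6)], rule always_eventually, rule allI)
      fix n
      have "continuous_on (ball x0 e) (\<lambda>x. f (x + axis i (h n)))"
        by (rule continuous_on_compose2[OF sepholo_cont[OF f]]) (use e in \<open>auto intro!: continuous_intros\<close>)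
      then show "continuous_on (ball x0 e) (\<lambda>x. (f (x + axis i (h n)) - f x) / h n)"
        by (intro continuous_intros continuous_on_subset[OF sepholo_cont[OF f] e(2)]) (use e in auto)
    qed simp
    then show "isCont (cpartial i f) x0" using e(1) by (auto simp: continuous_on_eq_continuous_at)
  qed
  fix x j
  show "(\<lambda>z. cpartial i f (x + axis j z)) holomorphic_on {z. x + axis j z \<in> U}"
    unfolding holomorphic_on_def
  proof
    fix z0 assume "z0 \<in> {z. x + axis j z \<in> U}"
    then have x0: "x + axis j z0 \<in> U" by simp
    let ?g = "\<lambda>w. cpartial i f (x + axis j z0 + axis j w)"
    obtain e h where e: "0 < e"
      and hol: "\<forall>n. (\<lambda>w. (f (x + axis j z0 + axis i (h n) + axis j w) - f (x + axis j z0 + axis j w)) / h n) holomorphic_on ball 0 e"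
      and ul: "uniform_limit (ball 0 e) (\<lambda>n w. (f (x + axis j z0 + axis i (h n) + axis j w) - f (x + axis j z0 + axis j w)) / h n) ?g sequentially"
      using cpartial_slice_uniform_limit[OF f x0, of i j] by (elim exE conjE)
    have "?g holomorphic_on ball 0 e"
    proof (rule holomorphic_uniform_sequence[OF open_ball hol[rule_format]])
      fix z :: complex assume "z \<in> ball 0 e"
      then obtain d where d: "0 < d" "cball z d \<subseteq> ball 0 e" by (meson open_ball open_contains_cball)
      show "\<exists>d>0. cball z d \<subseteq> ball 0 e \<and> uniform_limit (cball z d)
        (\<lambda>n w. (f (x + axis j z0 + axis i (h n) + axis j w) - f (x + axis j z0 + axis j w)) / h n) ?g sequentially"
        by (intro exI[of _ d] conjI d uniform_limit_on_subset[OF ul])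
    qed
    then have "?g field_differentiable at (z0 - z0)"
      using e by (intro holomorphic_on_imp_differentiable_at[of _ "ball 0 e"]) auto
    then have "(?g \<circ> (\<lambda>z. z - z0)) field_differentiable at z0"
      by (intro field_differentiable_compose) (auto intro!: derivative_intros)
    moreover have "x + axis j z0 + axis j (z - z0) = x + axis j z" for z
      using axis_add[of j z0 "z - z0"] by (simp add: add.assoc)
    ultimately have "(\<lambda>z. cpartial i f (x + axis j z)) field_differentiable at z0" by (simp add: o_def)
    then show "(\<lambda>z. cpartial i f (x + axis j z)) field_differentiable at z0 within {z. x + axis j z \<in> U}"
      by (rule field_differentiable_at_within)
  qed
qed

text \<open>The \<open>j\<close>-derivatives of the difference quotients in direction
  \<open>i\<close> have a limit that is computed twice: by uniform convergence, and as the
  difference quotients of \<open>cpartial j f\<close>.\<close>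

lemma cpartial_commute:
  fixes f :: "complex ^ 'i::finite \<Rightarrow> complex"
  assumes f: "sepholo f U" and x: "x \<in> U"
  shows "cpartial j (cpartial i f) x = cpartial i (cpartial j f) x"
proof -
  obtain e h where e: "0 < e" "\<forall>n. h n \<noteq> (0::complex)" "h \<longlonglongrightarrow> 0" and xh: "\<forall>n. x + axis i (h n) \<in> U"
    and hol: "\<forall>n. (\<lambda>w. (f (x + axis i (h n) + axis j w) - f (x + axis j w)) / h n) holomorphic_on ball 0 e"
    and ul: "uniform_limit (ball 0 e) (\<lambda>n w. (f (x + axis i (h n) + axis j w) - f (x + axis j w)) / h n)
      (\<lambda>w. cpartial i f (x + axis j w)) sequentially"
    using cpartial_slice_uniform_limit[OF f x, of i j] by (elim exE conjE)
  define G where "G = (\<lambda>n w. (f (x + axis i (h n) + axis j w) - f (x + axis j w)) / h n)"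
  have D: "((\<lambda>z. g (y + axis l z)) has_field_derivative cpartial l g y) (at 0)" if "sepholo g U" "y \<in> U" for g y l
    unfolding cpartial_def by (rule DERIV_deriv_iff_field_differentiable[THEN iffD2, OF sepholo_differentiable[OF that]])
  have "(\<lambda>n. (deriv ^^ 1) (G n) 0) \<longlonglongrightarrow> (deriv ^^ 1) (\<lambda>w. cpartial i f (x + axis j w)) 0"
    by (rule higher_deriv_complex_uniform_limit[OF ul[folded G_def]]) (use e hol in \<open>auto simp: G_def\<close>)
  then have lim1: "(\<lambda>n. deriv (G n) 0) \<longlonglongrightarrow> cpartial j (cpartial i f) x"
    by (simp add: cpartial_def[of j])
  have dG: "deriv (G n) 0 = (cpartial j f (x + axis i (h n)) - cpartial j f x) / h n" for n
    unfolding G_def by (intro DERIV_imp_deriv DERIV_cdivide DERIV_diff D f x xh[rule_format])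
  have "((\<lambda>z. (cpartial j f (x + axis i z) - cpartial j f x) / z) \<longlongrightarrow> cpartial i (cpartial j f) x) (at 0)"
    using D[OF sepholo_cpartial[OF f] x, of j i] by (simp add: has_field_derivative_iff)
  moreover have "filterlim h (at 0) sequentially" using e by (auto simp: filterlim_at)
  ultimately have "(\<lambda>n. deriv (G n) 0) \<longlonglongrightarrow> cpartial i (cpartial j f) x"
    unfolding dG by (rule filterlim_compose)
  with lim1 show ?thesis by (rule LIMSEQ_unique)
qed

section \<open>Cauchy estimates for iterated partial derivatives\<close>

lemma higher_cpartial: "(cpartial i ^^ n) f x = (deriv ^^ n) (\<lambda>z. f (x + axis i z)) 0"
proof -
  have "(cpartial i ^^ n) f (x + axis i w) = (deriv ^^ n) (\<lambda>z. f (x + axis i z)) w" for w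
  proof (induction n arbitrary: w)
    case (Suc n)
    have "(cpartial i ^^ Suc n) f (x + axis i w) = deriv (\<lambda>z. (cpartial i ^^ n) f (x + axis i (w + z))) 0"
      by (simp add: cpartial_def axis_add add.assoc)
    also have "\<dots> = deriv ((deriv ^^ n) (\<lambda>z. f (x + axis i z)) \<circ> (\<lambda>z. w + z)) 0"
      unfolding Suc o_def ..
    also have "\<dots> = (deriv ^^ Suc n) (\<lambda>z. f (x + axis i z)) w"
      by (simp add: deriv_shift_0[symmetric])
    finally show ?case .
  qed simp
  from this[of 0] show ?thesis by simp
qed

lemma sepholo_cpartial_power: "sepholo f U \<Longrightarrow> sepholo ((cpartial i ^^ n) f) U"
  by (induction n) (auto intro: sepholo_cpartial)

text \<open>Cauchy's inequality in the variable \<open>i\<close>. Coordinates outside the current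
  index set are kept at 0; a bound with \<open>i\<close> free yields a bound for the derivative at
  points where coordinate \<open>i\<close> is 0.\<close>

lemma cpartial_power_bound:
  fixes g :: "complex ^ 'i::finite \<Rightarrow> complex"
  assumes g: "sepholo g U" and r: "0 < r" and i: "i \<notin> J"
    and sub: "{x. \<forall>i. norm (x $ i) \<le> r} \<subseteq> U"
    and M: "\<And>x. \<forall>l. norm (x $ l) \<le> (if l \<in> insert i J then r else 0) \<Longrightarrow> norm (g x) \<le> M"
    and x: "\<forall>l. norm (x $ l) \<le> (if l \<in> J then r else 0)"
  shows "norm ((cpartial i ^^ n) g x) \<le> fact n * M / r ^ n"
proof -
  have xi: "x $ i = 0" using x[rule_format, of i] i by simp
  have z: "\<forall>l. norm ((x + axis i z) $ l) \<le> (if l \<in> insert i J then r else 0)" if "norm z \<le> r" for z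
  proof
    fix l show "norm ((x + axis i z) $ l) \<le> (if l \<in> insert i J then r else 0)"
      using x[rule_format, of l] that xi by (cases "l = i") (auto simp: axis_def)
  qed
  have zU: "x + axis i z \<in> U" if "norm z \<le> r" for z
  proof -
    have "norm ((x + axis i z) $ l) \<le> r" for l
      using z[OF that, rule_format, of l] r by (auto split: if_splits)
    then show ?thesis using sub by blast
  qed
  have hol: "(\<lambda>z. g (x + axis i z)) holomorphic_on cball 0 r"
    using zU zU[of 0] r by (intro sepholo_slice[OF g]) auto
  show ?thesis unfolding higher_cpartial
  proof (rule Cauchy_inequality)
    show "(\<lambda>z. g (x + axis i z)) holomorphic_on ball 0 r" by (rule holomorphic_on_subset[OF hol ball_subset_cball])
    show "continuous_on (cball 0 r) (\<lambda>z. g (x + axis i z))" by (rule holomorphic_on_imp_continuous_on[OF hol])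
    fix w :: complex assume "norm (0 - w) = r"
    then show "norm (g (x + axis i w)) \<le> M" by (intro M z) simp
  qed (rule r)
qed

text \<open>Each derivative uses up the freedom of its own coordinate, so the full radius
  \<open>r\<close> is available in every variable and no shrinking accumulates.\<close>

lemma fold_cpartial_bound:
  fixes g :: "complex ^ 'i::finite \<Rightarrow> complex"
  assumes "sepholo g U" "0 < r" "distinct is" "{x. \<forall>i. norm (x $ i) \<le> r} \<subseteq> U"
    "\<And>x. \<forall>l. norm (x $ l) \<le> (if l \<in> set is then r else 0) \<Longrightarrow> norm (g x) \<le> M"
  shows "norm (fold (\<lambda>i. cpartial i ^^ \<alpha> i) is g 0) \<le> M * (\<Prod>i\<in>set is. fact (\<alpha> i) / r ^ \<alpha> i)"
  using assms
proof (induction "is" arbitrary: g M)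
  case Nil
  then show ?case by simp
next
  case (Cons i "is")
  have "norm (fold (\<lambda>i. cpartial i ^^ \<alpha> i) is ((cpartial i ^^ \<alpha> i) g) 0)
      \<le> (fact (\<alpha> i) * M / r ^ \<alpha> i) * (\<Prod>i\<in>set is. fact (\<alpha> i) / r ^ \<alpha> i)"
  proof (rule Cons.IH)
    fix x :: "complex ^ 'i" assume x: "\<forall>l. norm (x $ l) \<le> (if l \<in> set is then r else 0)"
    show "norm ((cpartial i ^^ \<alpha> i) g x) \<le> fact (\<alpha> i) * M / r ^ \<alpha> i"
      by (rule cpartial_power_bound[OF Cons.prems(1,2) _ Cons.prems(4) _ x]) (use Cons.prems in auto)
  qed (use Cons.prems in \<open>auto intro: sepholo_cpartial_power\<close>)
  then show ?case using Cons.prems(3) by (simp add: ac_simps)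
qed

subsection \<open>Germs and their Taylor series\<close>

definition hgerm :: "(complex ^ 'i::finite \<Rightarrow> complex) \<Rightarrow> bool" where
  "hgerm f \<longleftrightarrow> (\<exists>U. 0 \<in> U \<and> sepholo f U)"

lemma hgermE:
  assumes "hgerm f" obtains U where "0 \<in> U" "sepholo f U"
  using assms unfolding hgerm_def by blast

lemma hgerm_holomorphic_near_0: "holomorphic_near_0 f \<Longrightarrow> hgerm f"
  unfolding holomorphic_near_0_def hgerm_def using mholomorphic_imp_sepholo by blast

lemma hgermE2:
  assumes "hgerm f" "hgerm g" obtains U where "0 \<in> U" "sepholo f U" "sepholo g U"
proof -
  obtain U where U: "0 \<in> U" "sepholo f U" by (rule hgermE[OF assms(1)])
  obtain V where V: "0 \<in> V" "sepholo g V" by (rule hgermE[OF assms(2)])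
  have o: "open (U \<inter> V)" using sepholo_open[OF U(2)] sepholo_open[OF V(2)] by (rule open_Int)
  show ?thesis
    by (rule that[of "U \<inter> V", OF _ sepholo_subset[OF U(2) o] sepholo_subset[OF V(2) o]]) (use U V in auto)
qed

lemma sepholo_add: "sepholo f U \<Longrightarrow> sepholo g U \<Longrightarrow> sepholo (\<lambda>x. f x + g x) U"
  unfolding sepholo_def by (auto intro!: continuous_intros holomorphic_intros)

lemma sepholo_mult: "sepholo f U \<Longrightarrow> sepholo g U \<Longrightarrow> sepholo (\<lambda>x. f x * g x) U"
  unfolding sepholo_def by (auto intro!: continuous_intros holomorphic_intros)

lemma hgerm_add: "hgerm f \<Longrightarrow> hgerm g \<Longrightarrow> hgerm (\<lambda>x. f x + g x)"
  by (erule (1) hgermE2) (auto simp: hgerm_def intro: sepholo_add)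

lemma hgerm_mult: "hgerm f \<Longrightarrow> hgerm g \<Longrightarrow> hgerm (\<lambda>x. f x * g x)"
  by (erule (1) hgermE2) (auto simp: hgerm_def intro: sepholo_mult)

lemma hgerm_const: "hgerm (\<lambda>_. c)"
  unfolding hgerm_def sepholo_def by (intro exI[of _ UNIV]) auto

lemma hgerm_cpartial: "hgerm f \<Longrightarrow> hgerm (cpartial i f)"
  unfolding hgerm_def using sepholo_cpartial by blast

lemma hgerm_power: "hgerm f \<Longrightarrow> hgerm (\<lambda>x. f x ^ n)"
  by (induction n) (auto intro: hgerm_const hgerm_mult)

lemma hgerm_sum: "(\<And>x. x \<in> I \<Longrightarrow> hgerm (f x)) \<Longrightarrow> hgerm (\<lambda>y. \<Sum>x\<in>I. f x y)"
  by (induction I rule: infinite_finite_induct) (auto intro: hgerm_const hgerm_add)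

lemma hgerm_prod: "(\<And>x. x \<in> I \<Longrightarrow> hgerm (f x)) \<Longrightarrow> hgerm (\<lambda>y. \<Prod>x\<in>I. f x y)"
  by (induction I rule: infinite_finite_induct) (auto intro: hgerm_const hgerm_mult)

lemma cpartial_cong:
  assumes "open V" "\<forall>x\<in>V. f x = g x" "x \<in> V"
  shows "cpartial i f x = cpartial i g x"
  unfolding cpartial_def
proof (rule deriv_cong_ev)
  have "0 \<in> {z. x + axis i z \<in> V}" using assms(3) by simp
  then show "\<forall>\<^sub>F z in nhds 0. f (x + axis i z) = g (x + axis i z)"
    using open_slice[OF assms(1)] assms(2) by (intro eventually_nhds[THEN iffD2] exI[of _ "{z. x + axis i z \<in> V}"]) auto
qed simp

lemma cpartial_power_cong:
  "open V \<Longrightarrow> \<forall>x\<in>V. f x = g x \<Longrightarrow> \<forall>x\<in>V. (cpartial i ^^ n) f x = (cpartial i ^^ n) g x"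
  by (induction n) (auto intro: cpartial_cong)

lemma fold_cpartial_cong:
  assumes "open V" "\<forall>x\<in>V. f x = g x"
  shows "\<forall>x\<in>V. fold (\<lambda>i. cpartial i ^^ \<alpha> i) is f x = fold (\<lambda>i. cpartial i ^^ \<alpha> i) is g x"
  using assms(2)
proof (induction "is" arbitrary: f g)
  case (Cons i "is")
  have "\<forall>x\<in>V. (cpartial i ^^ \<alpha> i) f x = (cpartial i ^^ \<alpha> i) g x"
    by (rule cpartial_power_cong[OF assms(1) Cons.prems])
  from Cons.IH[OF this] show ?case by simp
qed simp

lemma taylor_cong:
  assumes "\<forall>\<^sub>F x in nhds 0. f x = g x" shows "taylor f = taylor g"
proof -
  obtain V where V: "open V" "0 \<in> V" "\<forall>x\<in>V. f x = g x" using assms unfolding eventually_nhds by blast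
  show ?thesis unfolding taylor_def cpartials_def
    using fold_cpartial_cong[OF V(1,3)] V(2) by (intro arg_cong[where f = Abs_mfps]) auto
qed

lemma cpartial_power_commute:
  assumes f: "sepholo f U"
  shows "\<forall>x\<in>U. (cpartial i ^^ n) (cpartial j f) x = cpartial j ((cpartial i ^^ n) f) x"
proof (induction n)
  case (Suc n)
  show ?case
  proof
    fix x assume x: "x \<in> U"
    have "(cpartial i ^^ Suc n) (cpartial j f) x = cpartial i (cpartial j ((cpartial i ^^ n) f)) x"
      using cpartial_cong[OF sepholo_open[OF f] Suc x] by simp
    also have "\<dots> = cpartial j ((cpartial i ^^ Suc n) f) x"
      using cpartial_commute[OF sepholo_cpartial_power[OF f] x] by simp
    finally show "(cpartial i ^^ Suc n) (cpartial j f) x = cpartial j ((cpartial i ^^ Suc n) f) x" .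
  qed
qed simp

text \<open>The additional derivative is moved to the front through the earlier ones by commutation;
  distinctness of the list ensures that it occurs just once.\<close>

lemma fold_cpartial_Suc:
  assumes "sepholo f U" "distinct is" "j \<in> set is"
  shows "\<forall>x\<in>U. fold (\<lambda>i. cpartial i ^^ (\<alpha>(j := Suc (\<alpha> j))) i) is f x = fold (\<lambda>i. cpartial i ^^ \<alpha> i) is (cpartial j f) x"
  using assms
proof (induction "is" arbitrary: f)
  case (Cons i "is")
  note U = sepholo_open[OF Cons.prems(1)]
  show ?case
  proof (cases "i = j")
    case True
    then have j: "j \<notin> set is" using Cons.prems by auto
    have "fold (\<lambda>i. cpartial i ^^ (\<alpha>(j := Suc (\<alpha> j))) i) is g = fold (\<lambda>i. cpartial i ^^ \<alpha> i) is g" for g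
      using j by (intro fold_cong) auto
    then show ?thesis using True by (simp add: funpow_Suc_right del: funpow.simps)
  next
    case False
    then have j: "j \<in> set is" using Cons.prems by auto
    have 1: "\<forall>x\<in>U. fold (\<lambda>i. cpartial i ^^ (\<alpha>(j := Suc (\<alpha> j))) i) is ((cpartial i ^^ \<alpha> i) f) x
       = fold (\<lambda>i. cpartial i ^^ \<alpha> i) is (cpartial j ((cpartial i ^^ \<alpha> i) f)) x"
      using Cons.prems j by (intro Cons.IH sepholo_cpartial_power) auto
    have 2: "\<forall>x\<in>U. fold (\<lambda>i. cpartial i ^^ \<alpha> i) is ((cpartial i ^^ \<alpha> i) (cpartial j f)) x
       = fold (\<lambda>i. cpartial i ^^ \<alpha> i) is (cpartial j ((cpartial i ^^ \<alpha> i) f)) x"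
      by (rule fold_cpartial_cong[OF U cpartial_power_commute[OF Cons.prems(1)]])
    show ?thesis using 1 2 False by simp
  qed
qed simp

lemma taylor_cpartial:
  assumes "hgerm f" shows "taylor (cpartial i f) = mfps_D i (taylor f)"
proof (rule mfps_eqI)
  fix \<beta> :: "'a \<Rightarrow> nat"
  let ?b = "\<beta>(i := Suc (\<beta> i))"
  obtain U where U: "0 \<in> U" "sepholo f U" by (rule hgermE[OF assms])
  have "cpartials ?b f 0 = cpartials \<beta> (cpartial i f) 0"
    unfolding cpartials_def using fold_cpartial_Suc[OF U(2) index_list(1), of i] U(1) by (simp add: index_list(2))
  moreover have "(\<Prod>j\<in>UNIV. fact (?b j)) = of_nat (Suc (\<beta> i)) * (\<Prod>j\<in>UNIV. fact (\<beta> j) :: complex)"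
    by (subst (1 2) prod.remove[of UNIV i]) (auto intro!: prod.cong)
  ultimately show "mfps_coeff (taylor (cpartial i f)) \<beta> = mfps_coeff (mfps_D i (taylor f)) \<beta>"
    unfolding mfps_coeff_deriv_single by (simp add: taylor_def field_simps del: of_nat_Suc)
qed

lemma taylor_coeff_0: "mfps_coeff (taylor f) (\<lambda>_. 0) = f 0"
proof -
  have "fold (\<lambda>i. cpartial i ^^ (0::nat)) is f = f" for "is" by (induction "is") auto
  then show ?thesis by (simp add: taylor_def cpartials_def)
qed

text \<open>Identities between Taylor series are proved by induction on the degree of the
  coefficients, since a series is determined by its constant term and its first derivatives.\<close>

lemma mfps_coeff_eq_induct:
  fixes f g :: "('a::field_char_0, 'i::finite) mfps"
  assumes "mfps_coeff f (\<lambda>_. 0) = mfps_coeff g (\<lambda>_. 0)"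
    and "\<And>i \<beta>. mdeg \<alpha> = Suc (mdeg \<beta>) \<Longrightarrow> mfps_coeff (mfps_D i f) \<beta> = mfps_coeff (mfps_D i g) \<beta>"
  shows "mfps_coeff f \<alpha> = mfps_coeff g \<alpha>"
proof (cases "\<alpha> = (\<lambda>_. 0)")
  case False
  then obtain i where i: "\<alpha> i \<noteq> 0" by auto
  define \<beta> where "\<beta> = \<alpha>(i := \<alpha> i - 1)"
  have \<alpha>: "\<alpha> = \<beta>(i := Suc (\<beta> i))" using i by (auto simp: \<beta>_def)
  have "mdeg \<alpha> = Suc (mdeg \<beta>)" by (subst \<alpha>) (rule mdeg_upd_Suc)
  from assms(2)[OF this, of i] show ?thesis
    unfolding mfps_coeff_deriv_single \<alpha>[symmetric] by (simp del: of_nat_Suc)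
qed (use assms(1) in simp)

section \<open>Taylor series of sums, products and constants\<close>

lemma cpartial_add:
  assumes "sepholo f U" "sepholo g U" "x \<in> U"
  shows "cpartial i (\<lambda>x. f x + g x) x = cpartial i f x + cpartial i g x"
  unfolding cpartial_def by (rule deriv_add) (rule sepholo_differentiable assms)+

lemma cpartial_mult:
  assumes "sepholo f U" "sepholo g U" "x \<in> U"
  shows "cpartial i (\<lambda>x. f x * g x) x = cpartial i f x * g x + f x * cpartial i g x"
  unfolding cpartial_def
  by (subst deriv_mult) (rule sepholo_differentiable assms | simp)+

lemma eventually_nhds_sepholo:
  assumes "sepholo f U" "0 \<in> U" "\<And>x. x \<in> U \<Longrightarrow> P x" shows "\<forall>\<^sub>F x in nhds 0. P x"
  using assms sepholo_open eventually_nhds by blast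

lemma taylor_add:
  fixes f g :: "complex ^ 'i::finite \<Rightarrow> complex"
  assumes "hgerm f" "hgerm g" shows "taylor (\<lambda>x. f x + g x) = taylor f + taylor g"
proof (rule mfps_eqI)
  fix \<alpha> :: "'i \<Rightarrow> nat"
  show "mfps_coeff (taylor (\<lambda>x. f x + g x)) \<alpha> = mfps_coeff (taylor f + taylor g) \<alpha>"
    using assms
  proof (induction "mdeg \<alpha>" arbitrary: \<alpha> f g rule: less_induct)
    case less
    show ?case
    proof (rule mfps_coeff_eq_induct)
      fix i :: 'i and \<beta> :: "'i \<Rightarrow> nat" assume \<beta>: "mdeg \<alpha> = Suc (mdeg \<beta>)"
      obtain U where U: "0 \<in> U" "sepholo f U" "sepholo g U" by (rule hgermE2[OF less.prems])
      have "mfps_D i (taylor (\<lambda>x. f x + g x)) = taylor (cpartial i (\<lambda>x. f x + g x))"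
        by (rule taylor_cpartial[OF hgerm_add[OF less.prems], symmetric])
      also have "\<dots> = taylor (\<lambda>x. cpartial i f x + cpartial i g x)"
        by (intro taylor_cong eventually_nhds_sepholo[OF U(2,1)] cpartial_add[OF U(2,3)])
      finally show "mfps_coeff (mfps_D i (taylor (\<lambda>x. f x + g x))) \<beta> = mfps_coeff (mfps_D i (taylor f + taylor g)) \<beta>"
        using less.hyps[of \<beta> "cpartial i f" "cpartial i g"] \<beta> less.prems
        by (simp add: taylor_cpartial hgerm_cpartial)
    qed (simp add: taylor_coeff_0)
  qed
qed

lemma taylor_mult:
  fixes f g :: "complex ^ 'i::finite \<Rightarrow> complex"
  assumes "hgerm f" "hgerm g" shows "taylor (\<lambda>x. f x * g x) = taylor f * taylor g"
proof (rule mfps_eqI)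
  fix \<alpha> :: "'i \<Rightarrow> nat"
  show "mfps_coeff (taylor (\<lambda>x. f x * g x)) \<alpha> = mfps_coeff (taylor f * taylor g) \<alpha>"
    using assms
  proof (induction "mdeg \<alpha>" arbitrary: \<alpha> f g rule: less_induct)
    case less
    show ?case
    proof (rule mfps_coeff_eq_induct)
      have "{..\<lambda>_ :: 'i. 0} = {\<lambda>_. 0 :: nat}" by (auto simp: le_fun_def)
      then show "mfps_coeff (taylor (\<lambda>x. f x * g x)) (\<lambda>_. 0) = mfps_coeff (taylor f * taylor g) (\<lambda>_. 0)"
        by (simp add: taylor_coeff_0 mfps_coeff_mult)
      fix i :: 'i and \<beta> :: "'i \<Rightarrow> nat" assume \<beta>: "mdeg \<alpha> = Suc (mdeg \<beta>)"
      obtain U where U: "0 \<in> U" "sepholo f U" "sepholo g U" by (rule hgermE2[OF less.prems])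
      note D = hgerm_cpartial[OF less.prems(1), of i] hgerm_cpartial[OF less.prems(2), of i]
      have "mfps_D i (taylor (\<lambda>x. f x * g x)) = taylor (cpartial i (\<lambda>x. f x * g x))"
        by (rule taylor_cpartial[OF hgerm_mult[OF less.prems], symmetric])
      also have "\<dots> = taylor (\<lambda>x. cpartial i f x * g x + f x * cpartial i g x)"
        by (intro taylor_cong eventually_nhds_sepholo[OF U(2,1)] cpartial_mult[OF U(2,3)])
      also have "\<dots> = taylor (\<lambda>x. cpartial i f x * g x) + taylor (\<lambda>x. f x * cpartial i g x)"
        by (intro taylor_add hgerm_mult less.prems D)
      finally have "mfps_coeff (mfps_D i (taylor (\<lambda>x. f x * g x))) \<beta>
        = mfps_coeff (taylor (cpartial i f) * taylor g + taylor f * taylor (cpartial i g)) \<beta>"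
        using less.hyps[of \<beta> "cpartial i f" g] less.hyps[of \<beta> f "cpartial i g"] \<beta> less.prems D by simp
      then show "mfps_coeff (mfps_D i (taylor (\<lambda>x. f x * g x))) \<beta> = mfps_coeff (mfps_D i (taylor f * taylor g)) \<beta>"
        unfolding mfps_D_mult taylor_cpartial[OF less.prems(1)] taylor_cpartial[OF less.prems(2)] .
    qed
  qed
qed

lemma taylor_const: "taylor (\<lambda>_ :: complex ^ 'i::finite. c) = mfps_const c"
proof -
  have D0: "cpartial i (\<lambda>_. b) = (\<lambda>_. 0)" for i :: 'i and b :: complex by (rule ext) (simp add: cpartial_def)
  have p: "(cpartial i ^^ n) (\<lambda>_. 0) = (\<lambda>_. 0)" for i :: 'i and n by (induction n) (simp_all add: D0)
  have "fold (\<lambda>i. cpartial i ^^ \<alpha> i) is (\<lambda>_. 0) = (\<lambda>_. 0)" for \<alpha> and "is" :: "'i list" by (induction "is") (simp_all add: p)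
  then have z: "taylor (\<lambda>_ :: complex ^ 'i. 0) = 0" by (intro mfps_eqI) (simp add: taylor_def cpartials_def)
  show ?thesis
  proof (rule mfps_eqI, rule mfps_coeff_eq_induct)
    fix i :: 'i and \<beta> :: "'i \<Rightarrow> nat"
    show "mfps_coeff (mfps_D i (taylor (\<lambda>_. c))) \<beta> = mfps_coeff (mfps_D i (mfps_const c)) \<beta>"
      unfolding taylor_cpartial[OF hgerm_const, symmetric] D0 z mfps_D_const by simp
  qed (simp add: taylor_coeff_0)
qed

lemma taylor_sum: "(\<And>x. x \<in> I \<Longrightarrow> hgerm (f x)) \<Longrightarrow> taylor (\<lambda>y. \<Sum>x\<in>I. f x y) = (\<Sum>x\<in>I. taylor (f x))"
  by (induction I rule: infinite_finite_induct) (simp_all add: taylor_const taylor_add hgerm_sum)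

lemma taylor_prod: "(\<And>x. x \<in> I \<Longrightarrow> hgerm (f x)) \<Longrightarrow> taylor (\<lambda>y. \<Prod>x\<in>I. f x y) = (\<Prod>x\<in>I. taylor (f x))"
  by (induction I rule: infinite_finite_induct) (simp_all add: taylor_const taylor_mult hgerm_prod)

lemma taylor_power: "hgerm f \<Longrightarrow> taylor (\<lambda>y. f y ^ n) = taylor f ^ n"
  by (induction n) (simp_all add: taylor_const taylor_mult hgerm_power)

text \<open>A finite set of exponents fits into a box, over which the sum factors into one geometric
  sum per variable.\<close>

lemma sum_power_mdeg_le:
  fixes q :: real and S :: "('i::finite \<Rightarrow> nat) set"
  assumes q: "0 \<le> q" "q < 1" and S: "finite S"
  shows "(\<Sum>\<alpha>\<in>S. q ^ mdeg \<alpha>) \<le> (1 / (1 - q)) ^ CARD('i)"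
proof -
  define N where "N = (if S = {} then 0 else Max (mdeg ` S))"
  have N: "\<alpha> i \<le> N" if "\<alpha> \<in> S" for \<alpha> i
  proof -
    have "mdeg \<alpha> \<le> N" using that S by (auto simp: N_def)
    then show ?thesis using le_mdeg[of \<alpha> i] by simp
  qed
  have "(\<Sum>\<alpha>\<in>S. q ^ mdeg \<alpha>) \<le> (\<Sum>\<alpha>\<in>(\<Pi>\<^sub>E i\<in>(UNIV :: 'i set). {..N}). q ^ mdeg \<alpha>)"
    using N q by (intro sum_mono2 finite_PiE) (auto simp: PiE_def extensional_def)
  also have "\<dots> = (\<Sum>\<alpha>\<in>(\<Pi>\<^sub>E i\<in>(UNIV :: 'i set). {..N}). \<Prod>i\<in>UNIV. q ^ \<alpha> i)"
    by (simp add: mdeg_def power_sum)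
  also have "\<dots> = (\<Prod>i\<in>(UNIV :: 'i set). \<Sum>n\<in>{..N}. q ^ n)"
    by (rule prod_sum_PiE[symmetric]) auto
  also have "\<dots> \<le> (\<Prod>i\<in>(UNIV :: 'i set). 1 / (1 - q))"
  proof (rule prod_mono, rule conjI)
    show "(\<Sum>n\<in>{..N}. q ^ n) \<le> 1 / (1 - q)"
      using q sum_le_suminf[of "\<lambda>n. q ^ n" "{..N}"] by (simp add: summable_geometric suminf_geometric)
  qed (use q in \<open>auto intro: sum_nonneg\<close>)
  also have "\<dots> = (1 / (1 - q)) ^ CARD('i)" by simp
  finally show ?thesis .
qed

text \<open>Passes from a bound on single coefficients to the l^1 norm, at the price of a smaller
  radius.\<close>

lemma mfps_bnd_geometric:
  fixes f :: "(complex, 'i::finite) mfps"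
  assumes K: "\<And>\<alpha>. norm (mfps_coeff f \<alpha>) * r ^ mdeg \<alpha> \<le> K" and s: "0 \<le> s" "s < r"
  shows "mfps_bnd (\<lambda>\<alpha>. s ^ mdeg \<alpha>) f (K * (1 / (1 - s / r)) ^ CARD('i))"
proof (rule mfps_bndI)
  fix S :: "('i \<Rightarrow> nat) set" assume S: "finite S"
  have "0 \<le> K" using K[of "\<lambda>_. 0"] by (simp add: order_trans[OF norm_ge_zero])
  have "(\<Sum>\<alpha>\<in>S. norm (mfps_coeff f \<alpha>) * s ^ mdeg \<alpha>) \<le> (\<Sum>\<alpha>\<in>S. K * (s / r) ^ mdeg \<alpha>)"
  proof (rule sum_mono)
    fix \<alpha>
    have "norm (mfps_coeff f \<alpha>) * s ^ mdeg \<alpha> = norm (mfps_coeff f \<alpha>) * r ^ mdeg \<alpha> * (s / r) ^ mdeg \<alpha>"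
      using s by (simp add: power_divide)
    also have "\<dots> \<le> K * (s / r) ^ mdeg \<alpha>" using s by (intro mult_right_mono K) auto
    finally show "norm (mfps_coeff f \<alpha>) * s ^ mdeg \<alpha> \<le> K * (s / r) ^ mdeg \<alpha>" .
  qed
  also have "\<dots> \<le> K * (1 / (1 - s / r)) ^ CARD('i)"
    unfolding sum_distrib_left[symmetric] using s S \<open>0 \<le> K\<close>
    by (intro mult_left_mono sum_power_mdeg_le) auto
  finally show "(\<Sum>\<alpha>\<in>S. norm (mfps_coeff f \<alpha>) * s ^ mdeg \<alpha>) \<le> K * (1 / (1 - s / r)) ^ CARD('i)" .
qed

lemma mfps_conv_taylor:
  fixes f :: "complex ^ 'i::finite \<Rightarrow> complex"
  assumes "hgerm f" shows "mfps_conv (taylor f)"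
proof -
  obtain U where U: "0 \<in> U" "sepholo f U" by (rule hgermE[OF assms])
  obtain e where e: "0 < e" "cball 0 e \<subseteq> U" using sepholo_open[OF U(2)] U(1) by (meson open_contains_cball)
  \<comment> \<open>The norm is at most the sum of the moduli of the coordinates, so the polydisc of
    this radius lies in the ball of radius \<open>e\<close>.\<close>
  define r where "r = e / real CARD('i)"
  have r: "0 < r" using e by (simp add: r_def)
  have sub: "{x. \<forall>i. norm (x $ i) \<le> r} \<subseteq> cball (0 :: complex ^ 'i) e"
  proof
    fix x :: "complex ^ 'i" assume "x \<in> {x. \<forall>i. norm (x $ i) \<le> r}"
    then have "(\<Sum>i\<in>UNIV. norm (x $ i)) \<le> (\<Sum>i\<in>(UNIV :: 'i set). r)" by (intro sum_mono) auto
    moreover have "norm x \<le> (\<Sum>i\<in>UNIV. norm (x $ i))"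
      unfolding norm_vec_def by (rule L2_set_le_sum) simp
    ultimately show "x \<in> cball 0 e" by (simp add: r_def)
  qed
  have "compact (f ` cball 0 e)"
    by (intro compact_continuous_image continuous_on_subset[OF sepholo_cont[OF U(2)] e(2)]) auto
  then have "bounded (f ` cball 0 e)" by (rule compact_imp_bounded)
  then obtain M where M: "\<forall>y\<in>f ` cball 0 e. norm y \<le> M" unfolding bounded_iff by (elim exE)
  have "norm (mfps_coeff (taylor f) \<alpha>) * r ^ mdeg \<alpha> \<le> M" for \<alpha>
  proof -
    have "norm (cpartials \<alpha> f 0) \<le> M * (\<Prod>i\<in>set index_list. fact (\<alpha> i) / r ^ \<alpha> i)"
      unfolding cpartials_def
    proof (rule fold_cpartial_bound[OF U(2) r index_list(1)])
      fix x :: "complex ^ 'i" assume x: "\<forall>l. norm (x $ l) \<le> (if l \<in> set index_list then r else 0)"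
      have "x \<in> cball 0 e" using x sub by (auto simp: index_list(2))
      then show "norm (f x) \<le> M" using M by blast
    qed (use sub e in blast)
    also have "(\<Prod>i\<in>set index_list. fact (\<alpha> i) / r ^ \<alpha> i) = (\<Prod>i\<in>UNIV. fact (\<alpha> i)) / r ^ mdeg \<alpha>"
      by (simp add: index_list(2) prod_dividef mdeg_def power_sum)
    finally have "norm (cpartials \<alpha> f 0) \<le> M * ((\<Prod>i\<in>UNIV. fact (\<alpha> i)) / r ^ mdeg \<alpha>)" .
    moreover have "(0::real) < (\<Prod>i\<in>UNIV. fact (\<alpha> i))" by (intro prod_pos) auto
    moreover have eq: "norm (mfps_coeff (taylor f) \<alpha>) = norm (cpartials \<alpha> f 0) / (\<Prod>i\<in>UNIV. fact (\<alpha> i))"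
      by (simp add: taylor_def norm_divide prod_norm[symmetric] norm_fact)
    ultimately show ?thesis unfolding eq using r by (simp add: field_simps)
  qed
  from mfps_bnd_geometric[OF this, of "r / 2"] r show ?thesis
    by (intro mfps_convI[where r = "r / 2"]) auto
qed

subsection \<open>Sums of convergent series\<close>

text \<open>Collecting terms by total degree replaces the sum over multi-indices by an ordinary
  series.\<close>

definition homog :: "nat \<Rightarrow> (complex, 'i::finite) mfps \<Rightarrow> complex ^ 'i \<Rightarrow> complex" where
  "homog n c x = (\<Sum>\<alpha> | mdeg \<alpha> = n. mfps_coeff c \<alpha> * (\<Prod>i\<in>UNIV. x $ i ^ \<alpha> i))"

definition mfps_sum :: "(complex, 'i::finite) mfps \<Rightarrow> complex ^ 'i \<Rightarrow> complex" where
  "mfps_sum c x = (\<Sum>n. homog n c x)"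

text \<open>Quantifying over all radii below \<open>r\<close> makes the condition stable under
  differentiation, which loses a little of any fixed radius.\<close>

definition conv_within :: "real \<Rightarrow> (complex, 'i::finite) mfps \<Rightarrow> bool" where
  "conv_within r c \<longleftrightarrow> (\<forall>s. 0 < s \<longrightarrow> s < r \<longrightarrow> (\<exists>B. mfps_bnd (\<lambda>\<alpha>. s ^ mdeg \<alpha>) c B))"

text \<open>Each of the \<open>Suc n\<close> copies of \<open>q ^ n\<close> is at most the
  corresponding term of the geometric series.\<close>

lemma Suc_mult_power_le:
  fixes q :: real assumes q: "0 \<le> q" "q < 1"
  shows "real (Suc n) * q ^ n \<le> 1 / (1 - q)"
proof -
  have "real (Suc n) * q ^ n = (\<Sum>i\<in>{..n}. q ^ n)" by simp
  also have "\<dots> \<le> (\<Sum>i\<in>{..n}. q ^ i)" using q by (intro sum_mono power_decreasing) auto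
  also have "\<dots> \<le> 1 / (1 - q)"
    using q sum_le_suminf[of "\<lambda>n. q ^ n" "{..n}"] by (simp add: summable_geometric suminf_geometric)
  finally show ?thesis .
qed

lemma conv_within_D:
  fixes c :: "(complex, 'i::finite) mfps"
  assumes "conv_within r c" shows "conv_within r (mfps_D i c)"
  unfolding conv_within_def
proof (intro allI impI)
  fix s :: real assume s: "0 < s" "s < r"
  define t where "t = (s + r) / 2"
  have t: "s < t" "t < r" using s by (auto simp: t_def)
  then obtain B where B: "mfps_bnd (\<lambda>\<alpha>. t ^ mdeg \<alpha>) c B"
    using assms s unfolding conv_within_def by force
  have "mfps_bnd (\<lambda>\<alpha>. s ^ mdeg \<alpha>) (mfps_D i c) (1 / (1 - s / t) / t * B)"
  proof (rule mfps_bnd_reindex[OF B _ inj_upd_Suc])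
    fix \<alpha> :: "'i \<Rightarrow> nat"
    have "real (Suc (\<alpha> i)) * (s / t) ^ mdeg \<alpha> \<le> real (Suc (mdeg \<alpha>)) * (s / t) ^ mdeg \<alpha>"
      using le_mdeg[of \<alpha> i] s t by (intro mult_right_mono) auto
    also have "\<dots> \<le> 1 / (1 - s / t)" using s t by (intro Suc_mult_power_le) auto
    finally have "real (Suc (\<alpha> i)) * (s / t) ^ mdeg \<alpha> \<le> 1 / (1 - s / t)" .
    moreover have "(s / t) ^ mdeg \<alpha> * t ^ mdeg \<alpha> = s ^ mdeg \<alpha>" using s t by (simp add: power_divide)
    ultimately have "real (Suc (\<alpha> i)) * s ^ mdeg \<alpha> \<le> 1 / (1 - s / t) * t ^ mdeg \<alpha>"
      using mult_right_mono[of "real (Suc (\<alpha> i)) * (s / t) ^ mdeg \<alpha>" "1 / (1 - s / t)" "t ^ mdeg \<alpha>"] s t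
      by (simp add: mult.assoc)
    from mult_left_mono[OF this norm_ge_zero[of "mfps_coeff c (\<alpha>(i := Suc (\<alpha> i)))"]]
    show "norm (mfps_coeff (mfps_D i c) \<alpha>) * s ^ mdeg \<alpha>
       \<le> 1 / (1 - s / t) / t * (norm (mfps_coeff c (\<alpha>(i := Suc (\<alpha> i)))) * t ^ mdeg (\<alpha>(i := Suc (\<alpha> i))))"
      unfolding mfps_coeff_deriv_single mdeg_upd_Suc norm_mult norm_of_nat using s t
      by (simp add: ac_simps del: of_nat_Suc)
  qed (use s t in auto)
  then show "\<exists>B. mfps_bnd (\<lambda>\<alpha>. s ^ mdeg \<alpha>) (mfps_D i c) B" by (rule exI)
qed

lemma homog_bound:
  fixes c :: "(complex, 'i::finite) mfps"
  assumes "\<forall>i. norm (x $ i) \<le> s"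
  shows "norm (homog n c x) \<le> (\<Sum>\<alpha> | mdeg \<alpha> = n. norm (mfps_coeff c \<alpha>) * s ^ mdeg \<alpha>)"
  unfolding homog_def
proof (rule order_trans[OF norm_sum], rule sum_mono)
  fix \<alpha> :: "'i \<Rightarrow> nat"
  have "(\<Prod>i\<in>UNIV. norm (x $ i) ^ \<alpha> i) \<le> (\<Prod>i\<in>UNIV. s ^ \<alpha> i)"
    using assms by (intro prod_mono conjI power_mono) auto
  also have "\<dots> = s ^ mdeg \<alpha>" by (simp add: mdeg_def power_sum)
  finally show "norm (mfps_coeff c \<alpha> * (\<Prod>i\<in>UNIV. x $ i ^ \<alpha> i)) \<le> norm (mfps_coeff c \<alpha>) * s ^ mdeg \<alpha>"
    by (simp add: norm_mult prod_norm[symmetric] norm_power mult_left_mono)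
qed

lemma mfps_bnd_summable:
  fixes c :: "(complex, 'i::finite) mfps"
  assumes B: "mfps_bnd (\<lambda>\<alpha>. s ^ mdeg \<alpha>) c B" and s: "0 \<le> s"
  defines "M \<equiv> \<lambda>n. \<Sum>\<alpha> | mdeg \<alpha> = n. norm (mfps_coeff c \<alpha>) * s ^ mdeg \<alpha>"
  shows "summable M" "suminf M \<le> B"
proof -
  have le: "(\<Sum>n<m. M n) \<le> B" for m
  proof -
    let ?S = "{\<alpha> :: 'i \<Rightarrow> nat. mdeg \<alpha> < m}"
    have fin: "finite ?S" by (rule finite_subset[OF _ finite_mdeg_le[of m]]) auto
    have "(\<Sum>n<m. M n) = (\<Sum>n<m. \<Sum>\<alpha> | \<alpha> \<in> ?S \<and> mdeg \<alpha> = n. norm (mfps_coeff c \<alpha>) * s ^ mdeg \<alpha>)"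
      unfolding M_def by (intro sum.cong) auto
    also have "\<dots> = (\<Sum>\<alpha>\<in>?S. norm (mfps_coeff c \<alpha>) * s ^ mdeg \<alpha>)"
      by (rule sum.group[OF fin]) auto
    also have "\<dots> \<le> B" by (rule mfps_bndD[OF B fin])
    finally show ?thesis .
  qed
  have "0 \<le> M n" for n unfolding M_def using s by (intro sum_nonneg) auto
  then show "summable M" by (rule summableI_nonneg_bounded[OF _ le])
  then show "suminf M \<le> B" by (rule suminf_le_const[OF _ le])
qed

lemma mfps_sum_bound:
  assumes B: "mfps_bnd (\<lambda>\<alpha>. s ^ mdeg \<alpha>) c B" and x: "\<forall>i. norm (x $ i) \<le> s"
  shows "norm (mfps_sum c x) \<le> B" and "(\<lambda>n. homog n c x) sums mfps_sum c x"
proof -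
  have s: "0 \<le> s" using x order_trans[OF norm_ge_zero] by blast
  note M = mfps_bnd_summable[OF B s]
  show "norm (mfps_sum c x) \<le> B"
    unfolding mfps_sum_def by (rule order_trans[OF norm_suminf_le[OF homog_bound[OF x] M(1)] M(2)])
  have "summable (\<lambda>n. homog n c x)"
    by (rule summable_comparison_test'[OF M(1)]) (rule homog_bound[OF x])
  then show "(\<lambda>n. homog n c x) sums mfps_sum c x" unfolding mfps_sum_def by (rule summable_sums)
qed

lemma homog_has_derivative:
  fixes c :: "(complex, 'i::finite) mfps"
  shows "(homog n c has_derivative
    (\<lambda>h. case n of 0 \<Rightarrow> 0 | Suc m \<Rightarrow> \<Sum>i\<in>UNIV. homog m (mfps_D i c) x * h $ i)) (at x within S)"
proof -
  let ?m = "\<lambda>\<alpha>. \<Prod>j\<in>UNIV. x $ j ^ \<alpha> j"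
  have "((\<lambda>x. x $ i ^ \<alpha> i) has_derivative (\<lambda>h. of_nat (\<alpha> i) * h $ i * x $ i ^ (\<alpha> i - 1))) (at x within S)" for i and \<alpha> :: "'i \<Rightarrow> nat"
    by (rule has_derivative_power) (rule bounded_linear_imp_has_derivative[OF bounded_linear_vec_nth])
  then have "(homog n c has_derivative (\<lambda>h. \<Sum>\<alpha> | mdeg \<alpha> = n. mfps_coeff c \<alpha> *
      (\<Sum>i\<in>UNIV. of_nat (\<alpha> i) * h $ i * x $ i ^ (\<alpha> i - 1) * (\<Prod>j\<in>UNIV - {i}. x $ j ^ \<alpha> j)))) (at x within S)"
    unfolding homog_def[abs_def] by (intro has_derivative_sum has_derivative_mult_right has_derivative_prod)
  moreover have "(\<Sum>\<alpha> | mdeg \<alpha> = n. mfps_coeff c \<alpha> *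
      (\<Sum>i\<in>UNIV. of_nat (\<alpha> i) * h $ i * x $ i ^ (\<alpha> i - 1) * (\<Prod>j\<in>UNIV - {i}. x $ j ^ \<alpha> j)))
    = (case n of 0 \<Rightarrow> 0 | Suc m \<Rightarrow> \<Sum>i\<in>UNIV. homog m (mfps_D i c) x * h $ i)" (is "?L = ?R") for h :: "complex ^ 'i"
  proof -
    have mon: "x $ i ^ (\<alpha> i - 1) * (\<Prod>j\<in>UNIV - {i}. x $ j ^ \<alpha> j) = ?m (\<alpha>(i := \<alpha> i - 1))" for i \<alpha>
    proof -
      have "?m (\<alpha>(i := \<alpha> i - 1)) = x $ i ^ (\<alpha> i - 1) * (\<Prod>j\<in>UNIV - {i}. x $ j ^ (\<alpha>(i := \<alpha> i - 1)) j)"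
        by (subst prod.remove[of _ i]) auto
      also have "(\<Prod>j\<in>UNIV - {i}. x $ j ^ (\<alpha>(i := \<alpha> i - 1)) j) = (\<Prod>j\<in>UNIV - {i}. x $ j ^ \<alpha> j)"
        by (intro prod.cong) auto
      finally show ?thesis ..
    qed
    have L: "?L = (\<Sum>i\<in>UNIV. (\<Sum>\<alpha> | mdeg \<alpha> = n. of_nat (\<alpha> i) * mfps_coeff c \<alpha> * ?m (\<alpha>(i := \<alpha> i - 1))) * h $ i)"
      unfolding mon[symmetric] sum_distrib_left sum_distrib_right by (subst sum.swap) (simp add: ac_simps)
    show ?thesis
    proof (cases n)
      case 0
      then show ?thesis by (simp add: mdeg_eq_0_iff)
    next
      case (Suc m)
      have "(\<Sum>\<alpha> | mdeg \<alpha> = n. of_nat (\<alpha> i) * mfps_coeff c \<alpha> * ?m (\<alpha>(i := \<alpha> i - 1))) = homog m (mfps_D i c) x" for i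
      proof -
        have "(\<delta>(i := Suc (\<delta> i)))(i := (\<delta>(i := Suc (\<delta> i))) i - 1) = \<delta>" for \<delta> :: "'i \<Rightarrow> nat" by simp
        then show ?thesis
          unfolding homog_def mfps_coeff_deriv_single mult.assoc Suc
          by (subst sum_upd_Suc[where A = "{\<beta>. mdeg \<beta> = m}"])
            (simp_all only: mdeg_upd_Suc mem_Collect_eq nat.inject finite_mdeg_eq)
      qed
      then show ?thesis unfolding L by (simp add: Suc)
    qed
  qed
  ultimately show ?thesis by simp
qed

abbreviation cube :: "real \<Rightarrow> (complex ^ 'i::finite) set" where
  "cube s \<equiv> {x. \<forall>i. norm (x $ i) < s}"

lemma open_cube: "open (cube s :: (complex ^ 'i::finite) set)"
proof -
  have e: "(cube s :: (complex ^ 'i) set) = (\<Inter>i\<in>UNIV. {x. norm (x $ i) < s})" by auto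
  show ?thesis unfolding e by (intro open_INT ballI open_Collect_less continuous_intros finite)
qed

lemma convex_cube: "convex (cube s)"
proof (rule convexI)
  fix x y :: "complex ^ 'a" and u v :: real
  assume h: "x \<in> cube s" "y \<in> cube s" "0 \<le> u" "0 \<le> v" "u + v = 1"
  have "norm ((u *\<^sub>R x + v *\<^sub>R y) $ i) < s" for i
  proof -
    have "norm ((u *\<^sub>R x + v *\<^sub>R y) $ i) \<le> u * norm (x $ i) + v * norm (y $ i)"
      using h norm_triangle_ineq[of "u *\<^sub>R x $ i" "v *\<^sub>R y $ i"] by simp
    also have "\<dots> < s" using h by (intro convex_bound_lt) auto
    finally show ?thesis .
  qed
  then show "u *\<^sub>R x + v *\<^sub>R y \<in> cube s" by simp
qed

text \<open>Termwise differentiation: by the M-test the series of the finitely many formal partial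
  derivatives converge uniformly on the cube.\<close>

lemma mfps_sum_has_derivative:
  fixes c :: "(complex, 'i::finite) mfps"
  assumes c: "conv_within r c" and s: "0 < s" "s < r" and x: "x \<in> cube s"
  shows "(mfps_sum c has_derivative (\<lambda>h. \<Sum>i\<in>UNIV. mfps_sum (mfps_D i c) x * h $ i)) (at x)"
proof -
  obtain B where B: "mfps_bnd (\<lambda>\<alpha>. s ^ mdeg \<alpha>) c B" using c s unfolding conv_within_def by blast
  have sums: "(\<lambda>n. homog n c x) sums mfps_sum c x" if "x \<in> cube s" for x
    using that by (intro mfps_sum_bound(2)[OF B]) (auto intro: less_imp_le)
  have ul: "uniform_limit (cube s) (\<lambda>n x. \<Sum>k<n. homog k (mfps_D i c) x) (mfps_sum (mfps_D i c)) sequentially" for i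
  proof -
    obtain B where B: "mfps_bnd (\<lambda>\<alpha>. s ^ mdeg \<alpha>) (mfps_D i c) B"
      using conv_within_D[OF c, of i] s unfolding conv_within_def by blast
    have "uniform_limit (cube s) (\<lambda>n x. \<Sum>k<n. homog k (mfps_D i c) x) (\<lambda>x. \<Sum>k. homog k (mfps_D i c) x) sequentially"
      by (rule Weierstrass_m_test[OF homog_bound mfps_bnd_summable(1)[OF B]]) (use s in \<open>auto intro: less_imp_le\<close>)
    then show ?thesis unfolding mfps_sum_def[abs_def] .
  qed
  let ?f' = "\<lambda>n x h. case n of 0 \<Rightarrow> 0 | Suc m \<Rightarrow> \<Sum>i\<in>UNIV. homog m (mfps_D i c) x * h $ i"
  let ?g' = "\<lambda>x h. \<Sum>i\<in>UNIV. mfps_sum (mfps_D i c) x * h $ i"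
  have "\<exists>g. \<forall>x\<in>cube s. (\<lambda>n. homog n c x) sums (g x) \<and> (g has_derivative ?g' x) (at x within cube s)"
  proof (rule has_derivative_series[where S = "cube s" and f = "\<lambda>n. homog n c" and f' = ?f' and g' = ?g' and x = x and l = "mfps_sum c x"])
    show "convex (cube s :: (complex ^ 'i) set)" by (rule convex_cube)
    show "x \<in> cube s" by (rule x)
    show "(\<lambda>n. homog n c x) sums mfps_sum c x" by (rule sums[OF x])
    show "(homog n c has_derivative ?f' n x) (at x within cube s)" for n x by (rule homog_has_derivative)
    fix e :: real assume e: "0 < e"
    \<comment> \<open>The errors in the \<open>CARD('i)\<close> partial derivatives add up to
      \<open>e\<close>.\<close>
    define e' where "e' = e / real CARD('i)"
    have e': "0 < e'" using e by (simp add: e'_def)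
    have "\<forall>\<^sub>F n in sequentially. \<forall>i\<in>UNIV. \<forall>x\<in>cube s. dist (\<Sum>k<n. homog k (mfps_D i c) x) (mfps_sum (mfps_D i c) x) < e'"
      using uniform_limitD[OF ul e'] by (intro eventually_ball_finite) auto
    \<comment> \<open>Differentiation lowers the homogeneous degree by one and kills degree 0, so
      \<open>Suc n\<close> terms of the derivative match \<open>n\<close> terms of each partial
      series.\<close>
    then have "\<forall>\<^sub>F n in sequentially. \<forall>x\<in>cube s. \<forall>h. norm (sum (\<lambda>k. ?f' k x h) {..<Suc n} - ?g' x h) \<le> e * norm h"
    proof eventually_elim
      case (elim n)
      show ?case
      proof (intro ballI allI)
        fix x h :: "complex ^ 'i" assume x: "x \<in> cube s"
        have "sum (\<lambda>k. ?f' k x h) {..<Suc n} - ?g' x h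
          = (\<Sum>i\<in>UNIV. ((\<Sum>k<n. homog k (mfps_D i c) x) - mfps_sum (mfps_D i c) x) * h $ i)"
        proof -
          have "(\<Sum>k<n. \<Sum>i\<in>UNIV. homog k (mfps_D i c) x * h $ i) = (\<Sum>i\<in>UNIV. (\<Sum>k<n. homog k (mfps_D i c) x) * h $ i)"
            by (subst sum.swap) (simp only: sum_distrib_right)
          then show ?thesis unfolding sum.lessThan_Suc_shift
            by (simp only: nat.case add_0_left left_diff_distrib sum_subtractf)
        qed
        also have "norm \<dots> \<le> (\<Sum>i\<in>(UNIV :: 'i set). e' * norm h)"
        proof (rule order_trans[OF norm_sum], rule sum_mono)
          fix i
          show "norm (((\<Sum>k<n. homog k (mfps_D i c) x) - mfps_sum (mfps_D i c) x) * h $ i) \<le> e' * norm h"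
            unfolding norm_mult
          proof (rule mult_mono)
            show "norm ((\<Sum>k<n. homog k (mfps_D i c) x) - mfps_sum (mfps_D i c) x) \<le> e'"
              using elim[rule_format, OF UNIV_I x, of i] by (simp only: dist_norm less_imp_le)
            show "norm (h $ i) \<le> norm h" by (rule Finite_Cartesian_Product.norm_nth_le)
          qed (use e' in auto)
        qed
        also have "\<dots> = e * norm h" by (simp add: e'_def)
        finally show "norm (sum (\<lambda>k. ?f' k x h) {..<Suc n} - ?g' x h) \<le> e * norm h" .
      qed
    qed
    then show "\<forall>\<^sub>F n in sequentially. \<forall>x\<in>cube s. \<forall>h. norm (sum (\<lambda>k. ?f' k x h) {..<n} - ?g' x h) \<le> e * norm h"
      unfolding eventually_sequentially_Suc[of "\<lambda>n. \<forall>x\<in>cube s. \<forall>h. norm (sum (\<lambda>k. ?f' k x h) {..<n} - ?g' x h) \<le> e * norm h"] .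
  qed
  then obtain g where g: "\<And>x. x \<in> cube s \<Longrightarrow> (\<lambda>n. homog n c x) sums (g x)"
    "\<And>x. x \<in> cube s \<Longrightarrow> (g has_derivative ?g' x) (at x within cube s)" by blast
  have eq: "mfps_sum c x = g x" if "x \<in> cube s" for x
    by (rule sums_unique2[OF sums[OF that] g(1)[OF that]])
  have "(mfps_sum c has_derivative ?g' x) (at x within cube s)"
    by (rule has_derivative_transform[OF x eq g(2)[OF x]])
  then show ?thesis using at_within_open[OF x open_cube] by simp
qed

lemma mholomorphic_mfps_sum:
  fixes c :: "(complex, 'i::finite) mfps"
  assumes c: "conv_within r c" and s: "0 < s" "s < r"
  shows "mholomorphic_on (mfps_sum c) (cube s)"
    and "x \<in> cube s \<Longrightarrow> cpartial i (mfps_sum c) x = mfps_sum (mfps_D i c) x"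
proof -
  let ?D = "\<lambda>x h. \<Sum>i\<in>UNIV. mfps_sum (mfps_D i c) x * h $ i"
  have lin: "?D x (a *s v) = a * ?D x v" for x a v
    by (simp add: sum_distrib_left ac_simps)
  show "mholomorphic_on (mfps_sum c) (cube s)"
    unfolding mholomorphic_on_def
  proof (intro conjI ballI open_cube)
    fix x assume "x \<in> (cube s :: (complex ^ 'i) set)"
    from mfps_sum_has_derivative[OF c s this] lin
    show "\<exists>D. (mfps_sum c has_derivative D) (at x) \<and> (\<forall>c v. D (c *s v) = c * D v)" by blast
  qed
  assume x: "x \<in> cube s"
  have "((\<lambda>z. mfps_sum c (x + axis i z)) has_field_derivative ?D x (axis i 1)) (at 0)"
    by (rule mholomorphic_on_derivative) (use mfps_sum_has_derivative[OF c s x] lin in simp_all)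
  moreover have "?D x (axis i 1) = (\<Sum>j\<in>UNIV. if j = i then mfps_sum (mfps_D j c) x else 0)"
    by (intro sum.cong) (auto simp: axis_def)
  ultimately show "cpartial i (mfps_sum c) x = mfps_sum (mfps_D i c) x"
    unfolding cpartial_def by (simp add: DERIV_imp_deriv)
qed

text \<open>Induction on the degree: near 0 the analytic partial derivative of the sum is the sum of
  the formal one, which again satisfies the hypothesis.\<close>

lemma taylor_mfps_sum:
  fixes c :: "(complex, 'i::finite) mfps"
  assumes "conv_within r c" and r: "0 < r"
  shows "taylor (mfps_sum c) = c"
proof (rule mfps_eqI)
  fix \<alpha> :: "'i \<Rightarrow> nat"
  show "mfps_coeff (taylor (mfps_sum c)) \<alpha> = mfps_coeff c \<alpha>"
    using assms(1)
  proof (induction "mdeg \<alpha>" arbitrary: \<alpha> c rule: less_induct)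
    case less
    have s: "0 < r / 2" "r / 2 < r" using r by auto
    have z: "(0 :: complex ^ 'i) \<in> cube (r / 2)" using r by simp
    have sh: "sepholo (mfps_sum c) (cube (r / 2))"
      by (rule mholomorphic_imp_sepholo[OF mholomorphic_mfps_sum(1)[OF less.prems s]])
    then have hg: "hgerm (mfps_sum c)" unfolding hgerm_def by (intro exI[of _ "cube (r / 2)"] conjI z)
    show ?case
    proof (rule mfps_coeff_eq_induct)
      have "homog n c 0 = (if n = 0 then mfps_coeff c (\<lambda>_. 0) else 0)" for n
      proof (cases n)
        case 0
        have "{\<alpha> :: 'i \<Rightarrow> nat. mdeg \<alpha> = 0} = {\<lambda>_. 0}" by (auto simp: mdeg_eq_0_iff)
        then show ?thesis using 0 by (simp add: homog_def)
      next
        case (Suc m)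
        have "(\<Prod>i\<in>UNIV. (0 :: complex ^ 'i) $ i ^ \<alpha> i) = 0" if a: "mdeg \<alpha> = n" for \<alpha>
        proof -
          have "\<alpha> \<noteq> (\<lambda>_. 0)" using a Suc by auto
          then obtain i where "\<alpha> i \<noteq> 0" by auto
          then show ?thesis by (intro prod_zero) (auto intro: exI[of _ i])
        qed
        then have "homog n c 0 = 0" unfolding homog_def by (intro sum.neutral) simp
        then show ?thesis using Suc by simp
      qed
      then show "mfps_coeff (taylor (mfps_sum c)) (\<lambda>_. 0) = mfps_coeff c (\<lambda>_. 0)"
        unfolding taylor_coeff_0 mfps_sum_def using sums_single[of 0 "\<lambda>_. mfps_coeff c (\<lambda>_. 0)"]
        by (simp add: sums_iff)
      fix i :: 'i and \<beta> :: "'i \<Rightarrow> nat" assume \<beta>: "mdeg \<alpha> = Suc (mdeg \<beta>)"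
      have "mfps_D i (taylor (mfps_sum c)) = taylor (cpartial i (mfps_sum c))"
        by (rule taylor_cpartial[OF hg, symmetric])
      also have "\<dots> = taylor (mfps_sum (mfps_D i c))"
        by (intro taylor_cong eventually_nhds_sepholo[OF sh z] mholomorphic_mfps_sum(2)[OF less.prems s])
      finally show "mfps_coeff (mfps_D i (taylor (mfps_sum c))) \<beta> = mfps_coeff (mfps_D i c) \<beta>"
        using less.hyps[of \<beta> "mfps_D i c"] \<beta> conv_within_D[OF less.prems] by simp
    qed
  qed
qed

subsection \<open>From bounds to Gevrey series\<close>

text \<open>The coefficient of \<open>t^n\<close>, as a series in \<open>x\<close>.\<close>

definition mfps_slice :: "nat \<Rightarrow> ('a::comm_ring_1, 'i::finite option) mfps \<Rightarrow> ('a, 'i) mfps" where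
  "mfps_slice n Y = Abs_mfps (\<lambda>\<alpha>. mfps_coeff Y (case_option n \<alpha>))"

text \<open>The binomial coefficient is bounded by the sum of its row. Of the two powers,
  \<open>2 ^ p\<close> halves the radius in \<open>x\<close> and \<open>2 ^ n\<close> enters the
  geometric constant of the Gevrey bound.\<close>

lemma gevrey_fact_le:
  assumes "1 \<le> k" shows "gevrey_fact k p n \<le> 2 ^ p * 2 ^ n * fact n ^ k"
proof -
  have "p + n choose n \<le> (\<Sum>j\<le>p + n. p + n choose j)" by (rule member_le_sum) auto
  also have "\<dots> = 2 ^ (p + n)" by (rule choose_row_sum)
  finally have "real (p + n choose n) \<le> 2 ^ (p + n)" by (metis of_nat_le_iff of_nat_numeral of_nat_power)
  moreover have "fact n * fact n ^ (k - 1) = (fact n ^ k :: real)"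
    using assms by (cases k) auto
  ultimately show ?thesis
    unfolding gevrey_fact_eq mult.assoc by (simp add: power_add mult_right_mono)
qed

lemma mfps_slice_bound:
  assumes k: "1 \<le> k" and \<rho>: "0 < \<rho>" and \<tau>: "0 < \<tau>" and Y: "mfps_bnd (gwt k \<rho> \<tau>) Y \<delta>"
  shows "norm (mfps_coeff (mfps_slice n Y) \<alpha>) * (\<rho> / 2) ^ mdeg \<alpha> \<le> \<delta> * (2 / \<tau>) ^ n * fact n ^ k"
proof -
  let ?y = "norm (mfps_coeff (mfps_slice n Y) \<alpha>)" and ?p = "mdeg \<alpha>"
  have "gwt k \<rho> \<tau> (case_option n \<alpha>) = \<rho> ^ ?p * \<tau> ^ n / gevrey_fact k ?p n"
    by (simp add: gwt_def pdeg_def)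
  then have "?y * (\<rho> ^ ?p * \<tau> ^ n / gevrey_fact k ?p n) \<le> \<delta>"
    using mfps_bnd_coeff[OF Y, of "case_option n \<alpha>"] by (simp add: mfps_slice_def)
  then have 1: "?y * (\<rho> ^ ?p * \<tau> ^ n) \<le> \<delta> * gevrey_fact k ?p n"
    using gevrey_fact_pos[of k ?p n] by (simp add: field_simps)
  also have "\<dots> \<le> \<delta> * (2 ^ ?p * 2 ^ n * fact n ^ k)"
    by (intro mult_left_mono gevrey_fact_le k mfps_bnd_nonneg[OF Y])
  finally have "?y * (\<rho> ^ ?p * \<tau> ^ n) / (2 ^ ?p * \<tau> ^ n) \<le> \<delta> * (2 ^ ?p * 2 ^ n * fact n ^ k) / (2 ^ ?p * \<tau> ^ n)"
    using \<tau> by (intro divide_right_mono) auto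
  then show ?thesis using \<tau> by (simp add: power_divide field_simps)
qed

text \<open>Since \<open>p ^ n\<close> has no terms of degree below \<open>n\<close>, a coefficient
  of the partial sums is final as soon as \<open>m\<close> exceeds its degree.\<close>

lemma mfps_sums_slice:
  fixes p :: "(complex, 'i::finite) mfps"
  assumes p0: "mfps_coeff p (\<lambda>_. 0) = 0"
  shows "mfps_sums (\<lambda>n. mfps_slice n Y * p ^ n) (mfps_eval p Y)"
  unfolding mfps_sums_def
proof (intro allI eventually_sequentiallyI)
  fix \<gamma> :: "'i \<Rightarrow> nat" and m assume m: "Suc (mdeg \<gamma>) \<le> m"
  let ?g = "case_option p mfps_X"
  let ?S = "{\<beta> :: 'i option \<Rightarrow> nat. mdeg \<beta> \<le> m + mdeg \<gamma>}"
  let ?T = "{\<beta> :: 'i option \<Rightarrow> nat. \<beta> None < m \<and> (\<lambda>i. \<beta> (Some i)) \<le> \<gamma>}"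
  have mono: "mfps_coeff (mfps_mono ?g \<beta>) \<gamma> =
      (if (\<lambda>i. \<beta> (Some i)) \<le> \<gamma> then mfps_coeff (p ^ \<beta> None) (\<lambda>i. \<gamma> i - \<beta> (Some i)) else 0)" for \<beta>
  proof -
    have "mfps_mono ?g \<beta> = mfps_mono mfps_X (\<lambda>i. \<beta> (Some i)) * p ^ \<beta> None"
      by (simp add: mfps_mono_def UNIV_option_prod mult.commute)
    then show ?thesis by (simp only: mfps_coeff_mono_X_mult)
  qed
  have "mfps_coeff (mfps_eval p Y) \<gamma> = (\<Sum>\<beta>\<in>?S. mfps_coeff Y \<beta> * mfps_coeff (mfps_mono ?g \<beta>) \<gamma>)"
    unfolding mfps_eval_def by (rule mfps_coeff_subst[OF mfps_vanish_case[OF p0]]) simp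
  also have "\<dots> = (\<Sum>\<beta>\<in>?T. mfps_coeff Y \<beta> * mfps_coeff (mfps_mono ?g \<beta>) \<gamma>)"
  proof (rule sum.mono_neutral_right)
    show "finite ?S" by (rule finite_mdeg_le)
    show "?T \<subseteq> ?S"
    proof
      fix \<beta> assume b: "\<beta> \<in> ?T"
      then have "pdeg \<beta> \<le> mdeg \<gamma>" unfolding pdeg_def by (intro mdeg_mono) simp
      then show "\<beta> \<in> ?S" using b by (simp add: mdeg_option)
    qed
    show "\<forall>\<beta>\<in>?S - ?T. mfps_coeff Y \<beta> * mfps_coeff (mfps_mono ?g \<beta>) \<gamma> = 0"
    proof
      fix \<beta> assume b: "\<beta> \<in> ?S - ?T"
      show "mfps_coeff Y \<beta> * mfps_coeff (mfps_mono ?g \<beta>) \<gamma> = 0"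
      proof (cases "(\<lambda>i. \<beta> (Some i)) \<le> \<gamma>")
        case True
        then have "mdeg \<gamma> < mdeg \<beta>" using b m by (simp add: mdeg_option)
        then show ?thesis using mfps_coeff_mono_eq_0[OF mfps_vanish_case[OF p0]] by simp
      qed (simp add: mono)
    qed
  qed
  also have "\<dots> = (\<Sum>(n,\<alpha>)\<in>{..<m} \<times> {..\<gamma>}. mfps_coeff (mfps_slice n Y) \<alpha> * mfps_coeff (p ^ n) (\<lambda>i. \<gamma> i - \<alpha> i))"
  proof (rule sum.reindex_bij_witness[where i = "\<lambda>(n,\<alpha>). case_option n \<alpha>" and j = "\<lambda>\<beta>. (\<beta> None, \<lambda>i. \<beta> (Some i))"], goal_cases)
    case (1 \<beta>)
    show ?case by (rule ext) (simp split: option.split)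
  next
    case (5 \<beta>)
    have "case_option (\<beta> None) (\<lambda>i. \<beta> (Some i)) = \<beta>" by (rule ext) (simp split: option.split)
    then show ?case using 5 by (simp add: mono mfps_slice_def)
  qed auto
  also have "\<dots> = mfps_coeff (\<Sum>n<m. mfps_slice n Y * p ^ n) \<gamma>"
    by (simp add: mfps_coeff_sum mfps_coeff_mult sum.cartesian_product)
  finally show "mfps_coeff (\<Sum>n<m. mfps_slice n Y * p ^ n) \<gamma> = mfps_coeff (mfps_eval p Y) \<gamma>" ..
qed

lemma gevrey_eval:
  fixes P :: "complex ^ 'i::finite \<Rightarrow> complex"
  assumes k: "1 \<le> k" and \<rho>: "0 < \<rho>" and \<tau>: "0 < \<tau>" and Y: "mfps_bnd (gwt k \<rho> \<tau>) Y \<delta>"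
    and P0: "mfps_coeff (taylor P) (\<lambda>_. 0) = 0"
  shows "gevrey P (real k) (mfps_eval (taylor P) Y)"
proof -
  \<comment> \<open>The slices are bounded at radius \<open>\<rho> / 2\<close>. Halving once more
    gives ratio \<open>1 / 2\<close>, hence a geometric sum 2 per variable and the factor
    \<open>2 ^ CARD('i)\<close>.\<close>
  define r where "r = (\<chi> i :: 'i. \<rho> / 4)"
  define u where "u = (\<lambda>n. mfps_sum (mfps_slice n Y))"
  \<comment> \<open>The added 1 keeps the constant positive when \<open>\<delta>\<close> is
    0.\<close>
  define C where "C = (\<delta> + 1) * 2 ^ CARD('i)"
  have \<delta>: "0 \<le> \<delta>" by (rule mfps_bnd_nonneg[OF Y])
  have pd: "polydisc r = cube (\<rho> / 4)" by (simp add: polydisc_def r_def)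
  note bnd = mfps_bnd_geometric[OF mfps_slice_bound[OF k \<rho> \<tau> Y]]
  have conv: "conv_within (\<rho> / 2) (mfps_slice n Y)" for n
    unfolding conv_within_def by (intro allI impI exI, rule bnd) auto
  have s: "0 < \<rho> / 4" "\<rho> / 4 < \<rho> / 2" "0 < \<rho> / 2" using \<rho> by auto
  have ub: "norm (u n x) \<le> C * (2 / \<tau>) ^ n * fact n powr real k" if "x \<in> cube (\<rho> / 4)" for n x
  proof -
    have "mfps_bnd (\<lambda>\<alpha>. (\<rho> / 4) ^ mdeg \<alpha>) (mfps_slice n Y) (\<delta> * (2 / \<tau>) ^ n * fact n ^ k * 2 ^ CARD('i))"
      using bnd[of "\<rho> / 4" n] \<rho> by simp
    from mfps_sum_bound(1)[OF this, of x] that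
    have "norm (u n x) \<le> \<delta> * (2 / \<tau>) ^ n * fact n ^ k * 2 ^ CARD('i)"
      by (simp add: u_def less_imp_le)
    also have "\<dots> = \<delta> * 2 ^ CARD('i) * (2 / \<tau>) ^ n * fact n ^ k" by simp
    also have "\<dots> \<le> C * (2 / \<tau>) ^ n * fact n ^ k"
      unfolding C_def using \<tau> by (intro mult_right_mono) auto
    also have "fact n ^ k = (fact n powr real k :: real)" by (simp add: powr_realpow)
    finally show ?thesis .
  qed
  show ?thesis
    unfolding gevrey_def
  proof (rule exI[of _ r], rule exI[of _ C], rule exI[of _ "2 / \<tau>"], rule exI[of _ u], intro conjI allI ballI)
    show "0 < r $ i" for i using \<rho> by (simp add: r_def)
    show "0 < C" using \<delta> by (simp add: C_def)
    show "0 < 2 / \<tau>" using \<tau> by simp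
    show "mholomorphic_on (u n) (polydisc r)" for n
      unfolding u_def pd by (rule mholomorphic_mfps_sum(1)[OF conv s(1,2)])
    show "mfps_sums (\<lambda>n. taylor (u n) * taylor P ^ n) (mfps_eval (taylor P) Y)"
      unfolding u_def taylor_mfps_sum[OF conv s(3)] by (rule mfps_sums_slice[OF P0])
    show "norm (u n x) \<le> C * (2 / \<tau>) ^ n * fact n powr real k" if "x \<in> polydisc r" for n x
      using that unfolding pd by (rule ub)
  qed
qed

section \<open>From the analytic data to the lifted system\<close>

lemma taylor_coeff_munit: 
  fixes f :: "complex ^ 'i::finite \<Rightarrow> complex"
  assumes "hgerm f" shows "mfps_coeff (taylor f) (munit x) = cpartial x f 0"
proof -
  have "(\<lambda>_. 0)(x := Suc 0) = (munit x :: 'i \<Rightarrow> nat)" by auto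
  then have "mfps_coeff (taylor f) (munit x) = mfps_coeff (mfps_D x (taylor f)) (\<lambda>_. 0)"
    unfolding mfps_coeff_deriv_single by simp
  then show ?thesis by (simp only: taylor_cpartial[OF assms, symmetric] taylor_coeff_0)
qed

lemma taylor_L_star:
  fixes P :: "complex ^ 'd::finite \<Rightarrow> complex"
  assumes P: "hgerm P" and a: "\<And>\<alpha>. mdeg \<alpha> = j \<Longrightarrow> hgerm (a j \<alpha>)"
  shows "taylor (L_star a j P) = (\<Sum>\<alpha> | mdeg \<alpha> = j. taylor (a j \<alpha>) * mfps_mono (\<lambda>i. mfps_D i (taylor P)) \<alpha>)"
proof -
  note h = hgerm_prod hgerm_power hgerm_cpartial[OF P]
  have "taylor (L_star a j P) = taylor (\<lambda>x. \<Sum>\<alpha> | mdeg \<alpha> = j. a j \<alpha> x * (\<Prod>i\<in>UNIV. cpartial i P x ^ \<alpha> i))"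
    unfolding L_star_def[abs_def] ..
  also have "\<dots> = (\<Sum>\<alpha> | mdeg \<alpha> = j. taylor (\<lambda>x. a j \<alpha> x * (\<Prod>i\<in>UNIV. cpartial i P x ^ \<alpha> i)))"
  proof (rule taylor_sum)
    fix \<alpha> assume "\<alpha> \<in> {\<alpha> :: 'd \<Rightarrow> nat. mdeg \<alpha> = j}"
    then have "hgerm (a j \<alpha>)" by (intro a) simp
    then show "hgerm (\<lambda>x. a j \<alpha> x * (\<Prod>i\<in>UNIV. cpartial i P x ^ \<alpha> i))" by (intro hgerm_mult h)
  qed
  also have "\<dots> = (\<Sum>\<alpha> | mdeg \<alpha> = j. taylor (a j \<alpha>) * mfps_mono (\<lambda>i. mfps_D i (taylor P)) \<alpha>)"
  proof (rule sum.cong[OF refl])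
    fix \<alpha> assume "\<alpha> \<in> {\<alpha> :: 'd \<Rightarrow> nat. mdeg \<alpha> = j}"
    then have "hgerm (a j \<alpha>)" by (intro a) simp
    then have "taylor (\<lambda>x. a j \<alpha> x * (\<Prod>i\<in>UNIV. cpartial i P x ^ \<alpha> i))
      = taylor (a j \<alpha>) * taylor (\<lambda>x. \<Prod>i\<in>UNIV. cpartial i P x ^ \<alpha> i)"
      by (intro taylor_mult h)
    also have "taylor (\<lambda>x. \<Prod>i\<in>UNIV. cpartial i P x ^ \<alpha> i) = (\<Prod>i\<in>UNIV. taylor (\<lambda>x. cpartial i P x ^ \<alpha> i))"
      by (intro taylor_prod h)
    also have "\<dots> = mfps_mono (\<lambda>i. mfps_D i (taylor P)) \<alpha>"
      by (simp only: mfps_mono_def taylor_power[OF hgerm_cpartial[OF P]] taylor_cpartial[OF P])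
    finally show "taylor (\<lambda>x. a j \<alpha> x * (\<Prod>i\<in>UNIV. cpartial i P x ^ \<alpha> i))
      = taylor (a j \<alpha>) * mfps_mono (\<lambda>i. mfps_D i (taylor P)) \<alpha>" .
  qed
  finally show ?thesis .
qed

lemma mfps_eval_pderiv_sum:
  fixes P :: "complex ^ 'd::finite \<Rightarrow> complex"
  assumes k: "1 \<le> k" and P: "hgerm P" "P 0 = 0"
    and a: "\<And>j \<alpha>. 1 \<le> j \<Longrightarrow> j \<le> k \<Longrightarrow> mdeg \<alpha> = j \<Longrightarrow> hgerm (a j \<alpha>)"
    and dvd: "\<And>j. 1 \<le> j \<Longrightarrow> j \<le> k \<Longrightarrow> germ_dvd P (L_star a j P)"
  shows "\<exists>G. contracting k G \<and> (\<forall>Y. mfps_eval (taylor P) (G Y) = (\<Sum>j=1..k. taylor P ^ j * L_op a j (mfps_eval (taylor P) Y)))"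
proof -
  let ?p = "taylor P"
  have p0: "mfps_coeff ?p (\<lambda>_. 0) = 0" by (simp add: taylor_coeff_0 P)
  have "\<exists>G. contracting k G \<and> (\<forall>Y. mfps_eval ?p (G Y) = ?p ^ j * L_op a j (mfps_eval ?p Y))" if j: "j \<in> {1..k}" for j
  proof -
    have j': "1 \<le> j" "j \<le> k" using j by auto
    obtain q where q: "holomorphic_near_0 q" "\<forall>\<^sub>F x in nhds 0. L_star a j P x = P x * q x"
      using dvd[OF j'] unfolding germ_dvd_def by blast
    have hq: "hgerm q" by (rule hgerm_holomorphic_near_0[OF q(1)])
    have "(\<Sum>\<alpha> | mdeg \<alpha> = j. taylor (a j \<alpha>) * mfps_mono (\<lambda>i. mfps_D i ?p) \<alpha>) = taylor (L_star a j P)"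
      by (rule taylor_L_star[of P j a, OF P(1), symmetric]) (rule a[OF j'])
    also have "\<dots> = ?p * taylor q"
      unfolding taylor_cong[OF q(2)] by (rule taylor_mult[OF P(1) hq])
    finally show ?thesis
      unfolding L_op_def using j' k a
      by (intro operator_lift[where q = "taylor q"] p0 mfps_conv_taylor P(1) hq) auto
  qed
  then have "\<forall>j\<in>{1..k}. \<exists>G. contracting k G \<and> (\<forall>Y. mfps_eval ?p (G Y) = ?p ^ j * L_op a j (mfps_eval ?p Y))" by (rule ballI)
  from bchoice[OF this] obtain G where
    G: "\<forall>j\<in>{1..k}. contracting k (G j) \<and> (\<forall>Y. mfps_eval ?p (G j Y) = ?p ^ j * L_op a j (mfps_eval ?p Y))" ..
  show ?thesis
  proof (rule exI[of _ "\<lambda>Y. \<Sum>j=1..k. G j Y"], intro conjI allI)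
    show "contracting k (\<lambda>Y. \<Sum>j=1..k. G j Y)"
      by (rule contracting_sum) (rule G[rule_format, THEN conjunct1])
    show "mfps_eval ?p (\<Sum>j=1..k. G j Y) = (\<Sum>j=1..k. ?p ^ j * L_op a j (mfps_eval ?p Y))" for Y
      unfolding mfps_eval_sum by (rule sum.cong[OF refl]) (rule G[rule_format, THEN conjunct2, rule_format])
  qed
qed

text \<open>Shows that applying \<open>B\<close> to a vector of series loses nothing, so a system
  may be multiplied by \<open>B\<close> without changing its solutions.\<close>

lemma matrix_left_inverse_sums:
  fixes J B :: "complex ^ 'n::finite ^ 'n" and W :: "'n \<Rightarrow> (complex, 'i::finite) mfps"
  assumes "J ** B = mat 1"
  shows "(\<Sum>l\<in>UNIV. mfps_const (J $ m $ l) * (\<Sum>n\<in>UNIV. mfps_const (B $ l $ n) * W n)) = W m"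
proof -
  have "(\<Sum>l\<in>UNIV. mfps_const (J $ m $ l) * (\<Sum>n\<in>UNIV. mfps_const (B $ l $ n) * W n))
     = (\<Sum>n\<in>UNIV. (\<Sum>l\<in>UNIV. mfps_const (J $ m $ l * B $ l $ n)) * W n)"
    unfolding sum_distrib_left sum_distrib_right mfps_const_mult
    by (subst sum.swap) (simp only: mult.assoc)
  also have "\<dots> = (\<Sum>n\<in>UNIV. mfps_const ((J ** B) $ m $ n) * W n)"
    by (simp add: mfps_const_sum matrix_matrix_mult_def)
  also have "\<dots> = (\<Sum>n\<in>UNIV. if n = m then W n else 0)"
    unfolding assms by (intro sum.cong) (auto simp: mat_def)
  finally show ?thesis by simp
qed

theorem theorem1p1:
  fixes P :: "complex ^ 'd::finite \<Rightarrow> complex"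
    and k :: nat
    and a :: "nat \<Rightarrow> ('d \<Rightarrow> nat) \<Rightarrow> complex ^ 'd \<Rightarrow> complex"
    and F :: "complex ^ 'd \<Rightarrow> complex ^ 'n::finite \<Rightarrow> complex ^ 'n"
  assumes "k \<ge> 1"
    and "holomorphic_near_0 P" and "\<not> zero_germ P" and "P 0 = 0"
    and "\<And>j \<alpha>. 1 \<le> j \<Longrightarrow> j \<le> k \<Longrightarrow> mdeg \<alpha> = j \<Longrightarrow> holomorphic_near_0 (a j \<alpha>)"
    and "\<And>l. holomorphic_near_0 (joint (\<lambda>x y. F x y $ l))"
    and "F 0 0 = 0"
    and "invertible (jacobian_y F 0 0)"
    and "\<exists>\<alpha>. mdeg \<alpha> = k \<and> \<not> zero_germ (a k \<alpha>)"
    and "\<And>j. 1 \<le> j \<Longrightarrow> j \<le> k \<Longrightarrow> germ_dvd P (L_star a j P)"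
  shows "(\<exists>!y. formal_solution P k a F y \<and> (\<forall>l. mfps_coeff (y $ l) (\<lambda>_. 0) = 0)) \<and>
    (\<forall>y. formal_solution P k a F y \<and> (\<forall>l. mfps_coeff (y $ l) (\<lambda>_. 0) = 0)
       \<longrightarrow> (\<forall>l. gevrey P (real k) (y $ l)))"
proof -
  note k = assms(1) and hP = hgerm_holomorphic_near_0[OF assms(2)]
  let ?p = "taylor P"
  have p0: "mfps_coeff ?p (\<lambda>_. 0) = 0" by (simp add: taylor_coeff_0 assms(4))
  define R where "R = (\<lambda>y. \<Sum>j=1..k. ?p ^ j * L_op a j y)"
  have "\<exists>G. contracting k G \<and> (\<forall>Y. mfps_eval ?p (G Y) = R (mfps_eval ?p Y))"
    unfolding R_def
  proof (rule mfps_eval_pderiv_sum[OF k hP assms(4)])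
    show "hgerm (a j \<alpha>)" if "1 \<le> j" "j \<le> k" "mdeg \<alpha> = j" for j \<alpha>
      by (rule hgerm_holomorphic_near_0[OF assms(5)[OF that]])
    show "germ_dvd P (L_star a j P)" if "1 \<le> j" "j \<le> k" for j by (rule assms(10)[OF that])
  qed
  then obtain G where G: "contracting k G" "\<forall>Y. mfps_eval ?p (G Y) = R (mfps_eval ?p Y)"
    by (elim exE conjE)
  define J where "J = jacobian_y F 0 0"
  obtain B where B: "J ** B = mat 1" "B ** J = mat 1"
    using assms(8) unfolding J_def invertible_def by blast
  define f where "f = (\<lambda>l. taylor (joint (\<lambda>x y. F x y $ l)))"
  have hF: "hgerm (joint (\<lambda>x y. F x y $ l))" for l by (rule hgerm_holomorphic_near_0[OF assms(6)])
  have f0: "mfps_coeff (f l) (\<lambda>_. 0) = 0" for l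
  proof -
    have "(\<chi> i. (0 :: complex ^ ('d + 'n)) $ Inl i) = 0" "(\<chi> i. (0 :: complex ^ ('d + 'n)) $ Inr i) = 0"
      by (simp_all add: vec_eq_iff)
    then show ?thesis unfolding f_def taylor_coeff_0 joint_def by (simp add: assms(7))
  qed
  have f1: "mfps_coeff (f l) (munit (Inr m)) = J $ l $ m" for l m
  proof -
    have e: "(\<chi> i. (axis (Inr m) z :: complex ^ ('d + 'n)) $ Inl i) = 0"
      "(\<chi> i. (axis (Inr m) z :: complex ^ ('d + 'n)) $ Inr i) = axis m z" for z
      by (simp_all add: vec_eq_iff axis_def)
    show ?thesis
      unfolding f_def taylor_coeff_munit[OF hF] J_def jacobian_y_def cpartial_def joint_def by (simp add: e)
  qed
  \<comment> \<open>\<open>y - B F(x, y)\<close> with \<open>B\<close> the inverse Jacobian: its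
    terms linear in \<open>y\<close> cancel because \<open>B ** J\<close> is the identity.\<close>
  define H where "H = (\<lambda>l. mfps_X (Inr l) - (\<Sum>m\<in>UNIV. mfps_const (B $ l $ m) * f m))"
  have H: "mfps_conv (H l)" for l
  proof -
    have "H l = mfps_X (Inr l) + mfps_const (-1) * (\<Sum>m\<in>UNIV. mfps_const (B $ l $ m) * f m)"
      unfolding H_def by (rule mfps_eqI) simp
    moreover have "mfps_conv \<dots>"
      unfolding f_def by (intro mfps_conv_add mfps_conv_mult mfps_conv_sum mfps_conv_const mfps_conv_X mfps_conv_taylor hF)
    ultimately show ?thesis by simp
  qed
  have H0: "mfps_coeff (H l) (\<lambda>_. 0) = 0" for l
    by (simp add: H_def mfps_coeff_sum mfps_coeff_X_0 f0)
  have H1: "mfps_coeff (H l) (munit (Inr m)) = 0" for l m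
  proof -
    have "(munit (Inr m) :: 'd + 'n \<Rightarrow> nat) = munit (Inr l) \<longleftrightarrow> m = l" by (auto simp: fun_eq_iff)
    then have "mfps_coeff (mfps_X (Inr l) :: (complex, 'd + 'n) mfps) (munit (Inr m)) = (if l = m then 1 else 0)"
      unfolding mfps_X_def mfps_coeff_Abs by auto
    moreover have "(\<Sum>n\<in>UNIV. B $ l $ n * J $ n $ m) = (B ** J) $ l $ m" by (simp add: matrix_matrix_mult_def)
    ultimately show ?thesis
      unfolding H_def mfps_coeff_diff mfps_coeff_sum mfps_coeff_const_mult f1 by (simp add: B(2) mat_def)
  qed
  obtain Y \<rho> \<tau> \<delta> where \<rho>: "0 < \<rho>" and \<tau>: "0 < \<tau>" and Y0: "\<forall>l. mfps_coeff (Y l) (\<lambda>_. 0) = 0"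
    and Yb: "\<forall>l. mfps_bnd (gwt k \<rho> \<tau>) (Y l) \<delta>"
    and sol: "\<forall>y. (\<forall>l. mfps_coeff (y l) (\<lambda>_. 0) = 0) \<longrightarrow>
      ((\<forall>l. y l = mfps_subst (H l) (case_sum mfps_X y) + (\<Sum>m\<in>UNIV. mfps_const (B $ l $ m) * R (y m)))
        \<longleftrightarrow> y = (\<lambda>l. mfps_eval ?p (Y l)))"
    using formal_fixed_point[where H = H and R = R and B = "\<lambda>l m. B $ l $ m", OF p0 G(1) G(2)[rule_format] H H0 H1]
    by (elim exE conjE)
  have iff: "formal_solution P k a F y \<longleftrightarrow> y = (\<chi> l. mfps_eval ?p (Y l))"
    if y0: "\<forall>l. mfps_coeff (y $ l) (\<lambda>_. 0) = 0" for y
  proof -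
    let ?g = "case_sum mfps_X (\<lambda>m. y $ m)"
    have vg: "mfps_vanish ?g"
      using y0 by (auto simp: mfps_vanish_def mfps_coeff_X_0 split: sum.split)
    \<comment> \<open>The residual of the system. The fixed point equation says that
      \<open>B\<close> applied to \<open>W\<close> is zero, which by invertibility is the same as
      \<open>W = 0\<close>.\<close>
    define W where "W = (\<lambda>m. R (y $ m) - mfps_subst (f m) ?g)"
    have "mfps_subst (H l) ?g + (\<Sum>m\<in>UNIV. mfps_const (B $ l $ m) * R (y $ m))
       = y $ l + (\<Sum>m\<in>UNIV. mfps_const (B $ l $ m) * W m)" for l
      by (simp add: H_def W_def mfps_subst_X[OF vg] mfps_subst_sum mfps_subst_mult[OF vg] right_diff_distrib sum_subtractf)
    then have "(\<forall>l. y $ l = mfps_subst (H l) ?g + (\<Sum>m\<in>UNIV. mfps_const (B $ l $ m) * R (y $ m)))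
       \<longleftrightarrow> (\<forall>l. (\<Sum>m\<in>UNIV. mfps_const (B $ l $ m) * W m) = 0)" by simp
    also have "\<dots> \<longleftrightarrow> (\<forall>m. W m = 0)"
    proof
      assume z: "\<forall>l. (\<Sum>m\<in>UNIV. mfps_const (B $ l $ m) * W m) = 0"
      show "\<forall>m. W m = 0"
        using matrix_left_inverse_sums[OF B(1), of _ W] unfolding z[rule_format] by simp
    qed simp
    also have "\<dots> \<longleftrightarrow> formal_solution P k a F y"
      unfolding formal_solution_def W_def R_def f_def by simp
    finally have "formal_solution P k a F y \<longleftrightarrow> (\<lambda>l. y $ l) = (\<lambda>l. mfps_eval ?p (Y l))"
      using sol[rule_format, of "\<lambda>l. y $ l", OF y0[rule_format]] by simp
    then show ?thesis by (auto simp: vec_eq_iff fun_eq_iff)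
  qed
  have y0: "\<forall>l. mfps_coeff ((\<chi> l. mfps_eval ?p (Y l)) $ l) (\<lambda>_. 0) = 0"
    by (simp add: mfps_eval_def Y0)
  show ?thesis
  proof (intro conjI allI impI)
    show "\<exists>!y. formal_solution P k a F y \<and> (\<forall>l. mfps_coeff (y $ l) (\<lambda>_. 0) = 0)"
      using iff y0 by (intro ex1I[of _ "\<chi> l. mfps_eval ?p (Y l)"]) blast+
    fix y l assume y: "formal_solution P k a F y \<and> (\<forall>l. mfps_coeff (y $ l) (\<lambda>_. 0) = 0)"
    have "y = (\<chi> l. mfps_eval ?p (Y l))"
      by (rule iff[THEN iffD1, OF conjunct2[OF y] conjunct1[OF y]])
    then have "y $ l = mfps_eval ?p (Y l)" by simp
    then show "gevrey P (real k) (y $ l)"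
      using gevrey_eval[OF k \<rho> \<tau> Yb[rule_format] p0, of l] by simp
  qed
qed

end
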